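(* Let $G$ be a finite group of order $660$. Then $\Omega_{\rho}(L_2(11))\leq\Omega_{\rho}(G)$, and $\Omega_{\rho}(G)=769$ if and only if $G\cong L_2(11)$.
   Context: For a finite group $G$, let $o(x)$ denote the order of $x\in G$ and set $\rho(G)=\prod_{x\in G} o(x)$. For a positive integer $m=p_1^{\alpha_1}\cdots p_k^{\alpha_k}$ with $p_1,\dots,p_k$ distinct primes, $\Omega(m)=\alpha_1+\cdots+\alpha_k$ is the number of prime factors of $m$ counted with multiplicity (so $\Omega(1)=0$). Define $\Omega_{\rho}(G)=\Omega(\rho(G))$. $L_2(q)=\mathrm{PSL}(2,q)$ denotes the projective special linear group of degree $2$ over the field with $q$ elements; $|L_2(11)|=660$. *)

theory Defs
  imports "HOL-Algebra.Algebra" "HOL-Number_Theory.Number_Theory"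
begin

definition big_omega :: "nat \<Rightarrow> nat" where
  "big_omega m = size (prime_factorization m)"

definition rho :: "('a, 'b) monoid_scheme \<Rightarrow> nat" where
  "rho G = (\<Prod>x\<in>carrier G. group.ord G x)"

definition Omega_rho :: "('a, 'b) monoid_scheme \<Rightarrow> nat" where
  "Omega_rho G = big_omega (rho G)"

definition centre :: "('a, 'b) monoid_scheme \<Rightarrow> 'a set" where
  "centre G = {z \<in> carrier G. \<forall>x \<in> carrier G. z \<otimes>\<^bsub>G\<^esub> x = x \<otimes>\<^bsub>G\<^esub> z}"

(* The tuple (a, b, c, d) stands for the 2 x 2 matrix with rows (a, b) and (c, d). *)

type_synonym 'a mat2 = "'a \<times> 'a \<times> 'a \<times> 'a"

definition det2 :: "('a, 'b) ring_scheme \<Rightarrow> 'a mat2 \<Rightarrow> 'a" where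
  "det2 R = (\<lambda>(a, b, c, d). a \<otimes>\<^bsub>R\<^esub> d \<ominus>\<^bsub>R\<^esub> b \<otimes>\<^bsub>R\<^esub> c)"

definition mult2 :: "('a, 'b) ring_scheme \<Rightarrow> 'a mat2 \<Rightarrow> 'a mat2 \<Rightarrow> 'a mat2" where
  "mult2 R = (\<lambda>(a, b, c, d) (a', b', c', d').
     (a \<otimes>\<^bsub>R\<^esub> a' \<oplus>\<^bsub>R\<^esub> b \<otimes>\<^bsub>R\<^esub> c', a \<otimes>\<^bsub>R\<^esub> b' \<oplus>\<^bsub>R\<^esub> b \<otimes>\<^bsub>R\<^esub> d',
      c \<otimes>\<^bsub>R\<^esub> a' \<oplus>\<^bsub>R\<^esub> d \<otimes>\<^bsub>R\<^esub> c', c \<otimes>\<^bsub>R\<^esub> b' \<oplus>\<^bsub>R\<^esub> d \<otimes>\<^bsub>R\<^esub> d'))"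

definition SL2 :: "('a, 'b) ring_scheme \<Rightarrow> 'a mat2 monoid" where
  "SL2 R =
     \<lparr>carrier = {A \<in> carrier R \<times> carrier R \<times> carrier R \<times> carrier R. det2 R A = \<one>\<^bsub>R\<^esub>},
      monoid.mult = mult2 R,
      one = (\<one>\<^bsub>R\<^esub>, \<zero>\<^bsub>R\<^esub>, \<zero>\<^bsub>R\<^esub>, \<one>\<^bsub>R\<^esub>)\<rparr>"

definition PSL2 :: "('a, 'b) ring_scheme \<Rightarrow> 'a mat2 set monoid" where
  "PSL2 R = SL2 R Mod centre (SL2 R)"

lemma (in group) centre_normal: "centre G \<lhd> G"
proof (rule normal_invI)
  show "subgroup (centre G) G"
  proof (rule subgroupI)
    show "centre G \<subseteq> carrier G"
      by (auto simp: centre_def)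
    have "\<one> \<in> centre G"
      by (simp add: centre_def)
    then show "centre G \<noteq> {}"
      by blast
  next
    fix z assume "z \<in> centre G"
    then have z: "z \<in> carrier G" and comm: "\<And>x. x \<in> carrier G \<Longrightarrow> z \<otimes> x = x \<otimes> z"
      by (auto simp: centre_def)
    have "inv z \<otimes> x = x \<otimes> inv z" if x: "x \<in> carrier G" for x
    proof -
      have "z \<otimes> (x \<otimes> inv z) = x \<otimes> (z \<otimes> inv z)"
        using z x comm[OF x] by (metis inv_closed m_assoc)
      also have "\<dots> = x"
        using z x by simp
      finally show ?thesis
        using z x by (metis inv_solve_left inv_closed m_closed)
    qed
    with z show "inv z \<in> centre G"
      by (simp add: centre_def)
  next
    fix z w assume "z \<in> centre G" "w \<in> centre G"
    then have zw: "z \<in> carrier G" "w \<in> carrier G"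
      and comm: "\<And>x. x \<in> carrier G \<Longrightarrow> z \<otimes> x = x \<otimes> z" "\<And>x. x \<in> carrier G \<Longrightarrow> w \<otimes> x = x \<otimes> w"
      by (auto simp: centre_def)
    have "z \<otimes> w \<otimes> x = x \<otimes> (z \<otimes> w)" if x: "x \<in> carrier G" for x
    proof -
      have "z \<otimes> w \<otimes> x = z \<otimes> (x \<otimes> w)"
        using zw x comm(2)[OF x] by (simp add: m_assoc)
      also have "\<dots> = x \<otimes> z \<otimes> w"
        using zw x comm(1)[OF x] by (simp flip: m_assoc)
      finally show ?thesis
        using zw x by (simp add: m_assoc)
    qed
    with zw show "z \<otimes> w \<in> centre G"
      by (simp add: centre_def)
  qed
next
  fix x h assume x: "x \<in> carrier G" and h: "h \<in> centre G"
  then have "h \<in> carrier G" "x \<otimes> h = h \<otimes> x"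
    by (auto simp: centre_def)
  then have "x \<otimes> h \<otimes> inv x = h"
    using x by (simp add: m_assoc)
  with h show "x \<otimes> h \<otimes> inv x \<in> centre G"
    by simp
qed

lemma SL2_group:
  fixes R (structure)
  assumes "cring R"
  shows "group (SL2 R)"
proof -
  interpret cring R by fact
  show ?thesis
  proof (rule groupI)
    fix x y assume "x \<in> carrier (SL2 R)" "y \<in> carrier (SL2 R)"
    then obtain a b c d a' b' c' d' where
      xy: "x = (a, b, c, d)" "y = (a', b', c', d')" and
      car: "a \<in> carrier R" "b \<in> carrier R" "c \<in> carrier R" "d \<in> carrier R"
           "a' \<in> carrier R" "b' \<in> carrier R" "c' \<in> carrier R" "d' \<in> carrier R" and
      det: "a \<otimes> d \<ominus> b \<otimes> c = \<one>" "a' \<otimes> d' \<ominus> b' \<otimes> c' = \<one>"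
      by (auto simp: SL2_def det2_def)
    have "(a \<otimes> a' \<oplus> b \<otimes> c') \<otimes> (c \<otimes> b' \<oplus> d \<otimes> d') \<ominus> (a \<otimes> b' \<oplus> b \<otimes> d') \<otimes> (c \<otimes> a' \<oplus> d \<otimes> c')
          = (a \<otimes> d \<ominus> b \<otimes> c) \<otimes> (a' \<otimes> d' \<ominus> b' \<otimes> c')"
      using car by Ring.algebra
    then show "x \<otimes>\<^bsub>SL2 R\<^esub> y \<in> carrier (SL2 R)"
      using car det by (simp add: xy SL2_def det2_def mult2_def)
  next
    show "\<one>\<^bsub>SL2 R\<^esub> \<in> carrier (SL2 R)"
      by (simp add: SL2_def det2_def a_minus_def)
  next
    fix x y z assume "x \<in> carrier (SL2 R)" "y \<in> carrier (SL2 R)" "z \<in> carrier (SL2 R)"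
    then show "x \<otimes>\<^bsub>SL2 R\<^esub> y \<otimes>\<^bsub>SL2 R\<^esub> z = x \<otimes>\<^bsub>SL2 R\<^esub> (y \<otimes>\<^bsub>SL2 R\<^esub> z)"
      by (auto simp: SL2_def mult2_def l_distr r_distr m_assoc a_ac)
  next
    fix x assume "x \<in> carrier (SL2 R)"
    then show "\<one>\<^bsub>SL2 R\<^esub> \<otimes>\<^bsub>SL2 R\<^esub> x = x"
      by (auto simp: SL2_def mult2_def)
  next
    fix x assume "x \<in> carrier (SL2 R)"
    then obtain a b c d where
      x: "x = (a, b, c, d)" and
      car: "a \<in> carrier R" "b \<in> carrier R" "c \<in> carrier R" "d \<in> carrier R" and
      det: "a \<otimes> d \<ominus> b \<otimes> c = \<one>"
      by (auto simp: SL2_def det2_def)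
    have "d \<otimes> a \<oplus> (\<ominus> b) \<otimes> c = a \<otimes> d \<ominus> b \<otimes> c"
      using car by Ring.algebra
    moreover have "d \<otimes> b \<oplus> (\<ominus> b) \<otimes> d = \<zero>"
      using car by Ring.algebra
    moreover have "(\<ominus> c) \<otimes> a \<oplus> a \<otimes> c = \<zero>"
      using car by Ring.algebra
    moreover have "(\<ominus> c) \<otimes> b \<oplus> a \<otimes> d = a \<otimes> d \<ominus> b \<otimes> c"
      using car by Ring.algebra
    moreover have "d \<otimes> a \<ominus> (\<ominus> b) \<otimes> (\<ominus> c) = a \<otimes> d \<ominus> b \<otimes> c"
      using car by Ring.algebra
    ultimately
    show "\<exists>y\<in>carrier (SL2 R). y \<otimes>\<^bsub>SL2 R\<^esub> x = \<one>\<^bsub>SL2 R\<^esub>"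
      using car det
      by - (rule bexI[of _ "(d, \<ominus> b, \<ominus> c, a)"], simp_all add: x SL2_def det2_def mult2_def)
  qed
qed

lemma PSL2_group:
  assumes "cring R"
  shows "group (PSL2 R)"
  unfolding PSL2_def
  by (intro normal.factorgroup_is_group group.centre_normal SL2_group assms)

end

theory Submission
  imports Defs
begin

text \<open>
  Call an element of a group composite if it is not the identity and its order is not a prime.
  Every \<open>x \<noteq> \<one>\<close> contributes at least 1 to \<open>\<Omega>\<^sub>\<rho>(G)\<close>, and at least 2 if it is composite. Hence a group of
  order 660 with \<open>D\<close> composite elements has \<open>\<Omega>\<^sub>\<rho>(G) \<ge> 659 + D\<close>. In \<open>L\<^sub>2(11)\<close> the composite elements
  are the 110 elements of order 6, so that \<open>\<Omega>\<^sub>\<rho>(L\<^sub>2(11)) = 659 + 110 = 769\<close>. Everything therefore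
  follows once the groups of order 660 with at most 110 composite elements are known to form a
  single isomorphism class (\<open>few_composite_elements_iso\<close>): \<open>L\<^sub>2(11)\<close> belongs to that class, and this
  identifies all its members without ever matching the elements of \<open>G\<close> with matrices.

  Few composite elements force a rigid structure. Let \<open>u\<close> have order 11. If the group generated by
  \<open>u\<close> is normal, the products of powers of \<open>u\<close> with elements of its centralizer, together with
  products involving elements of order 5, already give too many composite elements
  (\<open>normal_sylow_11_composites\<close>). So the normalizer \<open>N\<close> of that subgroup has index 12 and order 55.
  An element of order 5 in \<open>N\<close> that commutes with \<open>u\<close> would produce at least 120 elements of order 55
  (\<open>commuting_11_5_composites\<close>). Take an involution \<open>t\<close>. Because \<open>55\<^sup>2 > 660\<close>, the subgroup \<open>N\<close> meets
  its conjugate under \<open>t\<close> nontrivially, in fact in a group of order 5 generated by some \<open>h\<close>, and \<open>t\<close>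
  centralizes or inverts \<open>h\<close>. In the first case there are at least 264 elements of order 10
  (\<open>order_10_composites\<close>). Hence \<open>t\<close> inverts \<open>h\<close>.

  This structure determines the group. The twelve cosets of \<open>N\<close> can be labelled by the projective
  line over the field with eleven elements: \<open>N\<close> is the point at infinity and the coset of \<open>u\<^sup>k t\<close> is
  the point \<open>k\<close>. Then \<open>u\<close> acts as \<open>k \<mapsto> k + 1\<close>, a power of \<open>h\<close> acts as \<open>k \<mapsto> 3 k\<close>, and \<open>t\<close> exchanges
  0 and infinity. Since \<open>t\<close> inverts \<open>h\<close>, its action is governed by the image \<open>c\<close> of the point 1. An
  involution cannot fix a point, because the stabilizers have the odd order 55; this makes \<open>c\<close> a
  non-square, and replacing \<open>t\<close> by some \<open>h\<^sup>i t\<close> turns \<open>c\<close> into \<open>-1\<close> (\<open>exists_sl2_triple\<close>). Now \<open>u\<close>, \<open>h\<close>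
  and \<open>t\<close> generate a faithful group of permutations given by formulas that do not mention \<open>G\<close>, so any
  two such groups are isomorphic (\<open>triples_iso\<close>).
\<close>

section \<open>Maps of prime period on a finite set\<close>

text \<open>The orbits of \<open>f\<close> have length 1 or \<open>p\<close>, because the length divides the prime \<open>p\<close>. All
  congruences for numbers of fixed cosets and of centralized elements come from this count.\<close>

lemma dvd_card_moved_points:
  fixes f :: "'a \<Rightarrow> 'a"
  assumes p: "Factorial_Ring.prime p" and fin: "finite S" and into: "f ` S \<subseteq> S"
    and period: "\<And>x. x \<in> S \<Longrightarrow> (f ^^ p) x = x"
  shows "p dvd card {x \<in> S. f x \<noteq> x}"
proof -
  define orb where "orb x = (\<lambda>i. (f ^^ i) x) ` {..<p}" for x
  let ?T = "{x \<in> S. f x \<noteq> x}"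
  have p0: "p > 0" using p prime_gt_0_nat by blast
  have plus: "(f ^^ i) ((f ^^ j) x) = (f ^^ (i + j)) x" for i j x
    by (simp add: funpow_add)
  have iter: "(f ^^ i) x \<in> S" if "x \<in> S" for i x
    using that into by (induction i) auto
  have mult: "(f ^^ (k * i)) x = x" if "(f ^^ k) x = x" for i k x
    using that by (induction i) (auto simp: funpow_add)
  have mod: "(f ^^ i) x = (f ^^ (i mod p)) x" if "x \<in> S" for i x
  proof -
    have "(f ^^ i) x = (f ^^ (i mod p + p * (i div p))) x" by simp
    also have "\<dots> = (f ^^ (i mod p)) x"
      using mult[OF period[OF that]] by (simp only: funpow_add o_apply)
    finally show ?thesis .
  qed
  have inT: "(f ^^ i) x \<in> ?T" if x: "x \<in> ?T" for i x
  proof -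
    have "f x = x" if "f ((f ^^ i) x) = (f ^^ i) x"
    proof -
      have "(f ^^ (p * i - i)) ((f ^^ i) (f x)) = (f ^^ (p * i - i)) ((f ^^ i) x)"
        using that by (simp add: funpow_swap1)
      then have "(f ^^ (p * i)) (f x) = (f ^^ (p * i)) x"
        using p0 by (simp add: plus)
      moreover have "f x \<in> S" using x into by auto
      ultimately show ?thesis
        using x mult[OF period] by auto
    qed
    then show ?thesis using x iter by auto
  qed
  have orbT: "orb x \<subseteq> ?T" if "x \<in> ?T" for x
    using inT[OF that] by (auto simp: orb_def)
  have step: "(f ^^ d) x \<noteq> x" if x: "x \<in> ?T" and d: "0 < d" "d < p" for d x
  proof
    assume "(f ^^ d) x = x"
    have "coprime d p"
      using d p by (metis coprime_commute nat_dvd_not_less prime_imp_coprime)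
    then obtain a where "[d * a = 1] (mod p)"
      using cong_solve_coprime_nat by auto
    moreover have "1 mod p = 1" using d by simp
    ultimately have "(d * a) mod p = 1" by (simp add: cong_def)
    then have "f x = x"
      using mod[of x "d * a"] x mult[OF \<open>(f ^^ d) x = x\<close>, of a] by simp
    then show False using x by simp
  qed
  have inj: "inj_on (\<lambda>i. (f ^^ i) x) {..<p}" if x: "x \<in> ?T" for x
  proof (rule linorder_inj_onI)
    fix i j assume ij: "i < j" "i \<in> {..<p}" "j \<in> {..<p}"
    have "(f ^^ j) x = (f ^^ (j - i)) ((f ^^ i) x)"
      using ij by (simp add: plus)
    then show "(f ^^ i) x \<noteq> (f ^^ j) x"
      using step[OF inT[OF x, of i], of "j - i"] ij by (metis lessThan_iff less_imp_diff_less zero_less_diff)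
  qed auto
  have self: "x \<in> orb x" for x
    using p0 by (auto simp: orb_def intro!: image_eqI[of _ _ 0])
  have orb_eq: "orb y = orb x" if x: "x \<in> S" and y: "y \<in> orb x" for x y
  proof -
    obtain i where i: "i < p" "y = (f ^^ i) x" using y by (auto simp: orb_def)
    have yS: "y \<in> S" using i iter x by simp
    have sub: "orb ((f ^^ k) z) \<subseteq> orb z" if "z \<in> S" for k z
    proof
      fix w assume "w \<in> orb ((f ^^ k) z)"
      then obtain j where "w = (f ^^ (j + k)) z" by (auto simp: orb_def funpow_add)
      then show "w \<in> orb z"
        using mod[OF that, of "j + k"] p0 by (auto simp: orb_def)
    qed
    have "(f ^^ (p - i)) y = x"
      using i period[OF x] by (simp add: plus)
    then show ?thesis using sub[OF x, of i] sub[OF yS, of "p - i"] i by auto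
  qed
  have "p dvd card (\<Union>(orb ` ?T))"
  proof (rule dvd_partition)
    show "finite (\<Union>(orb ` ?T))" using fin by (auto simp: orb_def)
    show "\<forall>c\<in>orb ` ?T. p dvd card c"
      using inj by (auto simp: orb_def card_image)
    show "\<forall>c1\<in>orb ` ?T. \<forall>c2\<in>orb ` ?T. c1 \<noteq> c2 \<longrightarrow> c1 \<inter> c2 = {}"
    proof (intro ballI impI, rule ccontr)
      fix c1 c2 assume c: "c1 \<in> orb ` ?T" "c2 \<in> orb ` ?T" "c1 \<noteq> c2" "c1 \<inter> c2 \<noteq> {}"
      then obtain x y z where "x \<in> S" "y \<in> S" "c1 = orb x" "c2 = orb y" "z \<in> orb x" "z \<in> orb y"
        by blast
      then show False using orb_eq[of x z] orb_eq[of y z] c(3) by simp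
    qed
  qed
  moreover have "\<Union>(orb ` ?T) = ?T"
    using orbT self by blast
  ultimately show ?thesis by simp
qed

section \<open>Counting prime factors of element orders\<close>

lemma big_omega_prod:
  assumes "finite A" "\<And>x. x \<in> A \<Longrightarrow> f x \<noteq> 0"
  shows "big_omega (\<Prod>x\<in>A. f x) = (\<Sum>x\<in>A. big_omega (f x))"
  using assms by (induction A rule: finite_induct)
    (auto simp: big_omega_def prime_factorization_mult)

lemma big_omega_1 [simp]: "big_omega 1 = 0"
  by (simp add: big_omega_def)

lemma big_omega_prime: "Factorial_Ring.prime p \<Longrightarrow> big_omega p = 1"
  by (simp add: big_omega_def prime_factorization_prime)

lemma big_omega_mult: "a \<noteq> 0 \<Longrightarrow> b \<noteq> 0 \<Longrightarrow> big_omega (a * b) = big_omega a + big_omega b"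
  by (simp add: big_omega_def prime_factorization_mult)

lemma big_omega_pos: "n > 1 \<Longrightarrow> big_omega n \<ge> 1"
  using prime_factor_nat[of n] prime_factorization_empty_iff[of n]
  by (auto simp: big_omega_def Suc_le_eq nonempty_has_size)

lemma big_omega_composite:
  assumes "n > 1" "\<not> Factorial_Ring.prime n"
  shows "big_omega n \<ge> 2"
proof -
  obtain p where p: "Factorial_Ring.prime p" "p dvd n" using prime_factor_nat[of n] assms by auto
  then obtain m where m: "n = p * m" by auto
  with assms p have "m > 1" by (metis Suc_lessI bot_nat_0.not_eq_extremum mult_0_right mult.right_neutral not_less_zero One_nat_def)
  then show ?thesis
    using m p big_omega_pos[of m] big_omega_prime[of p] by (auto simp: big_omega_mult)
qed

text \<open>These are the elements whose order has at least two prime factors, so they measure the excess of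
  \<open>\<Omega>\<^sub>\<rho>(G)\<close> over its minimal conceivable value \<open>|G| - 1\<close>.\<close>

definition composite_elements :: "('a, 'b) monoid_scheme \<Rightarrow> 'a set" where
  "composite_elements G = {x \<in> carrier G. x \<noteq> \<one>\<^bsub>G\<^esub> \<and> \<not> Factorial_Ring.prime (group.ord G x)}"

context group begin

lemma Omega_rho_eq_sum:
  assumes "finite (carrier G)"
  shows "Omega_rho G = (\<Sum>x\<in>carrier G. big_omega (ord x))"
  unfolding Omega_rho_def rho_def
  using assms ord_ge_1[OF assms] by (intro big_omega_prod) fastforce+

lemma Omega_rho_ge:
  assumes fin: "finite (carrier G)"
  shows "order G + card (composite_elements G) \<le> Omega_rho G + 1"
proof -
  let ?D = "composite_elements G"
  have "order G + card ?D = (\<Sum>x\<in>carrier G. 1 + (if x \<in> ?D then 1 else 0))"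
    using fin by (simp only: sum.distrib order_def)
      (simp add: sum.If_cases composite_elements_def Collect_conj_eq Int_assoc)
  also have "\<dots> \<le> (\<Sum>x\<in>carrier G. big_omega (ord x) + (if x = \<one> then 1 else 0))"
  proof (rule sum_mono)
    fix x assume x: "x \<in> carrier G"
    have "ord x > 1" if "x \<noteq> \<one>" using ord_ge_1[OF fin x] ord_eq_1[OF x] that by linarith
    then show "1 + (if x \<in> ?D then 1 else 0) \<le> big_omega (ord x) + (if x = \<one> then 1 else 0)"
      using big_omega_pos[of "ord x"] big_omega_composite[of "ord x"]
      by (auto simp: composite_elements_def)
  qed
  also have "\<dots> = Omega_rho G + 1"
    using fin by (simp add: sum.distrib Omega_rho_eq_sum)
  finally show ?thesis .
qed

lemma Omega_rho_eq:
  assumes fin: "finite (carrier G)"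
    and two: "\<And>x. x \<in> composite_elements G \<Longrightarrow> big_omega (ord x) = 2"
  shows "Omega_rho G + 1 = order G + card (composite_elements G)"
proof -
  let ?D = "composite_elements G"
  have "Omega_rho G + 1 = (\<Sum>x\<in>carrier G. big_omega (ord x) + (if x = \<one> then 1 else 0))"
    using fin by (simp add: sum.distrib Omega_rho_eq_sum)
  also have "\<dots> = (\<Sum>x\<in>carrier G. 1 + (if x \<in> ?D then 1 else 0))"
  proof (rule sum.cong[OF refl])
    fix x assume "x \<in> carrier G"
    then show "big_omega (ord x) + (if x = \<one> then 1 else 0) = 1 + (if x \<in> ?D then 1 else 0)"
      using two[of x] big_omega_prime[of "ord x"] big_omega_1 by (auto simp: composite_elements_def)
  qed
  also have "\<dots> = order G + card ?D"
    using fin by (simp only: sum.distrib order_def)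
      (simp add: sum.If_cases composite_elements_def Collect_conj_eq Int_assoc)
  finally show ?thesis .
qed

text \<open>If the order were a prime, it would divide \<open>a\<close> or \<open>b\<close>. In this form compositeness can be checked
  with three powers, without computing the order.\<close>

lemma composite_elementsI:
  assumes "x \<in> carrier G" "x [^] (a * b :: nat) = \<one>" "x [^] a \<noteq> \<one>" "x [^] b \<noteq> \<one>"
  shows "x \<in> composite_elements G"
proof -
  have "\<not> Factorial_Ring.prime (ord x)"
    using assms prime_dvd_mult_nat[of "ord x" a b] by (auto simp: pow_eq_id)
  then show ?thesis using assms by (auto simp: composite_elements_def)
qed

lemma inv_cancel_left [simp]:
  assumes "g \<in> carrier G" "y \<in> carrier G"
  shows "inv g \<otimes> (g \<otimes> y) = y" "g \<otimes> (inv g \<otimes> y) = y"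
  using assms by (simp_all flip: m_assoc)

lemma conj_pow:
  assumes "x \<in> carrier G" "g \<in> carrier G"
  shows "(g \<otimes> x \<otimes> inv g) [^] (n::nat) = g \<otimes> x [^] n \<otimes> inv g"
proof (induction n)
  case (Suc n)
  have "g \<otimes> x [^] n \<otimes> inv g \<otimes> (g \<otimes> x \<otimes> inv g) = g \<otimes> x [^] n \<otimes> (inv g \<otimes> g) \<otimes> x \<otimes> inv g"
    using assms by (simp add: m_assoc inv_cancel_left)
  then show ?case using assms Suc by (simp add: m_assoc)
qed (use assms in auto)

lemma pow_mod:
  assumes "x \<in> carrier G" "x [^] n = \<one>"
  shows "x [^] (k mod n :: nat) = x [^] k"
proof -
  have "x [^] k = x [^] (n * (k div n) + k mod n)" by simp
  also have "\<dots> = (x [^] n) [^] (k div n) \<otimes> x [^] (k mod n)"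
    using assms(1) by (metis nat_pow_closed nat_pow_mult nat_pow_pow)
  finally show ?thesis using assms by simp
qed

text \<open>Cauchy's theorem for a subgroup, phrased by powers in the ambient group.\<close>

lemma exists_prime_order:
  assumes "finite (carrier G)" "subgroup H G" "Factorial_Ring.prime p" "p dvd card H"
  shows "\<exists>x\<in>H. x \<noteq> \<one> \<and> x [^] p = \<one>"
proof -
  interpret H: group "G\<lparr>carrier := H\<rparr>"
    using assms(2) by (rule subgroup_imp_group)
  have fH: "finite H" using assms(1,2) subgroup.subset finite_subset by blast
  obtain m where "card H = p ^ 1 * m" using assms(4) by auto
  then obtain K where K: "subgroup K (G\<lparr>carrier := H\<rparr>)" "card K = p ^ 1"
    using sylow_thm[OF assms(3) H.group_axioms, of 1 m] fH by (auto simp: order_def)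
  have KG: "subgroup K G" "K \<subseteq> H"
    using K(1) assms(2) incl_subgroup subgroup.subset by fastforce+
  interpret K: group "G\<lparr>carrier := K\<rparr>"
    using KG(1) by (rule subgroup_imp_group)
  have "K \<noteq> {\<one>}" using K(2) assms(3) by auto
  then obtain x where x: "x \<in> K" "x \<noteq> \<one>"
    using subgroup.one_closed[OF KG(1)] by auto
  have "x [^]\<^bsub>G\<lparr>carrier := K\<rparr>\<^esub> (order (G\<lparr>carrier := K\<rparr>)) = \<one>\<^bsub>G\<lparr>carrier := K\<rparr>\<^esub>"
    by (rule K.pow_order_eq_1) (use x in simp)
  then have "x [^] p = \<one>"
    using K(2) by (simp add: order_def nat_pow_consistent[symmetric])
  then show ?thesis using x KG by blast
qed

lemma subgroup_finite_closedI:
  assumes "finite (carrier G)" "H \<subseteq> carrier G" "\<one> \<in> H" "\<And>x y. x \<in> H \<Longrightarrow> y \<in> H \<Longrightarrow> x \<otimes> y \<in> H"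
  shows "subgroup H G"
proof (rule subgroupI)
  fix x assume x: "x \<in> H"
  have xc: "x \<in> carrier G" using x assms by auto
  have pw: "x [^] (n::nat) \<in> H" for n
    by (induction n) (use x assms in auto)
  have "x [^] (order G - 1) \<otimes> x = \<one>"
    using pow_order_eq_1[OF xc] order_gt_0_iff_finite assms(1)
    by (metis Suc_diff_1 nat_pow_Suc)
  then show "inv x \<in> H"
    using xc pw inv_equality by (metis nat_pow_closed)
qed (use assms in auto)

lemma subgroup_pow_closed: "subgroup H G \<Longrightarrow> x \<in> H \<Longrightarrow> x [^] (n::nat) \<in> H"
  by (induction n) (auto simp: subgroup.m_closed subgroup.one_closed)

lemma subgroup_pow_card:
  assumes "subgroup H G" "x \<in> H"
  shows "x [^] card H = \<one>"
proof -
  interpret H: group "G\<lparr>carrier := H\<rparr>"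
    using assms(1) by (rule subgroup_imp_group)
  show ?thesis using H.pow_order_eq_1[of x] assms
    by (simp add: order_def nat_pow_consistent[symmetric])
qed

lemma pow_coprime_trivial:
  assumes "x \<in> carrier G" "x [^] m = \<one>" "x [^] n = \<one>" "coprime m (n::nat)"
  shows "x = \<one>"
  using assms by (metis coprime_common_divisor_nat ord_eq_1 pow_eq_id)

end

section \<open>Conjugation, cosets and elements of prime order\<close>

text \<open>For \<open>u\<close> of finite order this is the normalizer of the cyclic group generated by \<open>u\<close>; the exponent
  records the automorphism induced by \<open>g\<close>.\<close>

definition cyclic_normalizer :: "('a, 'b) monoid_scheme \<Rightarrow> 'a \<Rightarrow> 'a set" where
  "cyclic_normalizer G u =
     {g \<in> carrier G. \<exists>i::nat. g \<otimes>\<^bsub>G\<^esub> u \<otimes>\<^bsub>G\<^esub> inv\<^bsub>G\<^esub> g = u [^]\<^bsub>G\<^esub> i}"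

context group begin

text \<open>A set \<open>B\<close> that meets few of its conjugates has many of them: two pairs \<open>(g, b)\<close> with the same value
  \<open>g b g\<^sup>-\<^sup>1\<close> have first components that differ by an element of \<open>M\<close>, and the first component
  determines the second, so the fibres of \<open>(g, b) \<mapsto> g b g\<^sup>-\<^sup>1\<close> have at most \<open>|M|\<close> elements.\<close>

lemma card_conjugates_ge:
  assumes fin: "finite (carrier G)" and B: "B \<subseteq> carrier G" and M: "M \<subseteq> carrier G"
    and TI: "\<And>g b. g \<in> carrier G \<Longrightarrow> b \<in> B \<Longrightarrow> g \<otimes> b \<otimes> inv g \<in> B \<Longrightarrow> g \<in> M"
  shows "order G * card B \<le> card M * card ((\<lambda>(g, b). g \<otimes> b \<otimes> inv g) ` (carrier G \<times> B))"
proof -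
  let ?f = "\<lambda>(g, b). g \<otimes> b \<otimes> inv g" and ?A = "carrier G \<times> B"
  have finA: "finite ?A" and finM: "finite M"
    using finite_subset[OF B fin] finite_subset[OF M fin] fin by auto
  have fibre: "card {q \<in> ?A. ?f q = y} \<le> card M" if y: "y \<in> ?f ` ?A" for y
  proof -
    obtain g0 b0 where 0: "g0 \<in> carrier G" "b0 \<in> B" "y = g0 \<otimes> b0 \<otimes> inv g0"
      using y by auto
    have b0: "b0 \<in> carrier G" using 0 B by auto
    let ?h = "\<lambda>q. inv g0 \<otimes> fst q"
    have "inj_on ?h {q \<in> ?A. ?f q = y}"
    proof (rule inj_onI)
      fix q r assume q: "q \<in> {q \<in> ?A. ?f q = y}" and r: "r \<in> {q \<in> ?A. ?f q = y}" and e: "?h q = ?h r"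
      have "fst q = fst r" using q r e 0 by auto
      moreover from this have "fst q \<otimes> snd q \<otimes> inv fst q = fst q \<otimes> snd r \<otimes> inv fst q"
        using q r by (auto simp: case_prod_beta)
      ultimately show "q = r" using q r B by (auto simp: case_prod_beta prod_eq_iff subset_iff)
    qed
    moreover have "?h ` {q \<in> ?A. ?f q = y} \<subseteq> M"
    proof
      fix m assume "m \<in> ?h ` {q \<in> ?A. ?f q = y}"
      then obtain g b where g: "g \<in> carrier G" and b: "b \<in> B" and e: "g \<otimes> b \<otimes> inv g = y"
        and m: "m = inv g0 \<otimes> g" by auto
      have bc: "b \<in> carrier G" using b B by auto
      have "inv g0 \<otimes> g \<otimes> b \<otimes> inv (inv g0 \<otimes> g) = inv g0 \<otimes> (g \<otimes> b \<otimes> inv g) \<otimes> g0"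
        using g bc 0 by (simp add: m_assoc inv_mult_group)
      also have "\<dots> = b0"
        unfolding e using 0 b0 by (simp add: m_assoc)
      finally show "m \<in> M"
        unfolding m using TI[of "inv g0 \<otimes> g" b] g b 0 by simp
    qed
    ultimately show ?thesis using card_inj_on_le[OF _ _ finM] by blast
  qed
  have "order G * card B = (\<Sum>q\<in>?A. 1)"
    by (simp add: order_def card_cartesian_product)
  also have "\<dots> = (\<Sum>y\<in>?f ` ?A. card {q \<in> ?A. ?f q = y})"
    using sum.image_gen[OF finA, of "\<lambda>_. 1::nat" ?f] by simp
  also have "\<dots> \<le> (\<Sum>y\<in>?f ` ?A. card M)"
    using fibre by (rule sum_mono)
  finally show ?thesis by (simp add: mult.commute)
qed

lemma l_coset_eq_iff:
  assumes "subgroup H G" "x \<in> carrier G" "y \<in> carrier G"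
  shows "x <# H = y <# H \<longleftrightarrow> inv y \<otimes> x \<in> H"
proof
  assume "x <# H = y <# H"
  then have "x \<in> y <# H" using lcos_self[OF assms(2,1)] by simp
  then show "inv y \<otimes> x \<in> H"
    using subgroup.lcos_module_imp[OF assms(1) group_axioms assms(3)] by simp
next
  assume "inv y \<otimes> x \<in> H"
  then have "x \<in> y <# H"
    using assms by (auto simp: l_coset_def intro!: bexI[of _ "inv y \<otimes> x"])
  then show "x <# H = y <# H"
    using l_repr_independence assms by metis
qed

lemma l_coset_assoc:
  assumes "H \<subseteq> carrier G" "x \<in> carrier G" "y \<in> carrier G"
  shows "x <# (y <# H) = (x \<otimes> y) <# H"
  using assms by (rule lcos_m_assoc)

lemma fixed_coset_iff:
  assumes "subgroup H G" "x \<in> carrier G" "g \<in> carrier G"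
  shows "x <# (g <# H) = g <# H \<longleftrightarrow> inv g \<otimes> x \<otimes> g \<in> H"
  using assms by (simp add: l_coset_assoc subgroup.subset l_coset_eq_iff m_assoc)

text \<open>Left multiplication by \<open>x\<close> permutes the left cosets with period \<open>p\<close>.\<close>

lemma fixed_cosets_cong:
  assumes fin: "finite (carrier G)" and H: "subgroup H G" and p: "Factorial_Ring.prime (p::nat)"
    and x: "x \<in> carrier G" "x [^] p = \<one>"
  shows "[card (lcosets H) = card {K \<in> lcosets H. x <# K = K}] (mod p)"
proof -
  have finL: "finite (lcosets H)" using fin by (simp add: LCOSETS_def)
  have sub: "H \<subseteq> carrier G" using H by (rule subgroup.subset)
  have iter: "((\<lambda>K. x <# K) ^^ n) (g <# H) = (x [^] n \<otimes> g) <# H" if "g \<in> carrier G" for g n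
  proof (induction n)
    case (Suc n)
    have "x \<otimes> (x [^] n \<otimes> g) = x [^] Suc n \<otimes> g"
      using x that by (metis m_assoc nat_pow_Suc2 nat_pow_closed)
    then show ?case using Suc x sub that by (simp add: l_coset_assoc)
  qed (use that in simp)
  have "p dvd card {K \<in> lcosets H. x <# K \<noteq> K}"
  proof (rule dvd_card_moved_points[OF p finL])
    show "(\<lambda>K. x <# K) ` (lcosets H) \<subseteq> lcosets H"
      using x sub by (auto simp: LCOSETS_def l_coset_assoc)
    show "((\<lambda>K. x <# K) ^^ p) K = K" if "K \<in> lcosets H" for K
      using that iter x by (auto simp: LCOSETS_def)
  qed
  moreover have "card (lcosets H) = card {K \<in> lcosets H. x <# K = K} + card {K \<in> lcosets H. x <# K \<noteq> K}"
    using finL by (subst card_Un_disjoint[symmetric]) (auto intro: arg_cong[where f = card])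
  ultimately show ?thesis
    by (auto simp: cong_def elim!: dvdE)
qed

text \<open>The conjugacy part of Sylow's theorem for elements of prime order: a coset \<open>g H\<close> fixed by \<open>x\<close>
  conjugates \<open>x\<close> into \<open>H\<close>.\<close>

lemma conjugate_into_subgroup:
  assumes fin: "finite (carrier G)" and H: "subgroup H G" and p: "Factorial_Ring.prime (p::nat)"
    and x: "x \<in> carrier G" "x [^] p = \<one>" and ndvd: "\<not> p dvd card (lcosets H)"
  shows "\<exists>g\<in>carrier G. inv g \<otimes> x \<otimes> g \<in> H"
proof -
  have "{K \<in> lcosets H. x <# K = K} \<noteq> {}"
    using fixed_cosets_cong[OF fin H p x] ndvd by (metis card.empty cong_dvd_iff dvd_0_right)
  then obtain g where "g \<in> carrier G" "x <# (g <# H) = g <# H"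
    by (auto simp: LCOSETS_def)
  then show ?thesis using fixed_coset_iff[OF H x(1)] by blast
qed

lemma prime_ord:
  assumes "Factorial_Ring.prime (p::nat)" "u \<in> carrier G" "u [^] p = \<one>" "u \<noteq> \<one>"
  shows "ord u = p"
  using assms ord_eq_1[of u] pow_eq_id[of u p] by (auto simp: prime_nat_iff)

lemma pow_eq_cong:
  assumes "Factorial_Ring.prime (p::nat)" "u \<in> carrier G" "u [^] p = \<one>" "u \<noteq> \<one>"
  shows "u [^] (i::nat) = u [^] (j::nat) \<longleftrightarrow> [i = j] (mod p)"
proof -
  have "u [^] i = u [^] j \<longleftrightarrow> int p dvd int j - int i"
    using int_pow_eq[OF assms(2), of "int i" "int j"] prime_ord[OF assms] by (simp add: int_pow_int)
  also have "\<dots> \<longleftrightarrow> [int j = int i] (mod int p)"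
    by (simp add: cong_iff_dvd_diff)
  finally show ?thesis
    using cong_int_iff cong_sym_eq by blast
qed

lemma pow_eq_one_cong:
  assumes "Factorial_Ring.prime (p::nat)" "u \<in> carrier G" "u [^] p = \<one>" "u \<noteq> \<one>"
  shows "u [^] (i::nat) = \<one> \<longleftrightarrow> p dvd i"
  using pow_eq_id[OF assms(2)] prime_ord[OF assms] by simp

lemma pow_root:
  assumes "Factorial_Ring.prime (p::nat)" "u \<in> carrier G" "u [^] p = \<one>" "u [^] (i::nat) \<noteq> \<one>"
  shows "\<exists>j. (u [^] i) [^] (j::nat) = u"
proof -
  have u: "u \<noteq> \<one>" using assms by auto
  then have "\<not> p dvd i" using pow_eq_one_cong[OF assms(1-3) u] assms(4) by blast
  then have "coprime i p"
    using assms(1) coprime_commute prime_imp_coprime by blast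
  then obtain j where "[i * j = 1] (mod p)" using cong_solve_coprime_nat by auto
  then have "u [^] (i * j) = u [^] (1::nat)" using pow_eq_cong[OF assms(1-3) u] by blast
  then show ?thesis using assms by (auto simp: nat_pow_pow)
qed

lemma powers_subgroup:
  assumes "Factorial_Ring.prime (p::nat)" "u \<in> carrier G" "u [^] p = \<one>" "u \<noteq> \<one>"
  shows "subgroup (range (\<lambda>i::nat. u [^] i)) G" "card (range (\<lambda>i::nat. u [^] i)) = p"
proof -
  have p0: "p > 0" using assms(1) prime_gt_0_nat by blast
  show "subgroup (range (\<lambda>i::nat. u [^] i)) G"
  proof (rule subgroupI)
    fix a assume "a \<in> range (\<lambda>i::nat. u [^] i)"
    then obtain i where i: "a = u [^] (i::nat)" by auto
    have "u [^] (i * (p - 1)) \<otimes> a = u [^] (p * i)"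
    proof -
      have "i * (p - 1) + i = p * i" using p0 by (cases p) auto
      then show ?thesis unfolding i using assms by (simp add: nat_pow_mult)
    qed
    also have "\<dots> = \<one>" using assms by (simp flip: nat_pow_pow)
    finally have "inv a = u [^] (i * (p - 1))"
      using i assms inv_equality by blast
    then show "inv a \<in> range (\<lambda>i::nat. u [^] i)" by simp
  next
    fix a b assume "a \<in> range (\<lambda>i::nat. u [^] i)" "b \<in> range (\<lambda>i::nat. u [^] i)"
    then show "a \<otimes> b \<in> range (\<lambda>i::nat. u [^] i)"
      using assms by (auto simp: nat_pow_mult)
  qed (use assms in auto)
  have "range (\<lambda>i::nat. u [^] i) = (\<lambda>i. u [^] i) ` {..<p}"
  proof (intro equalityI subsetI)
    fix a assume "a \<in> range (\<lambda>i::nat. u [^] i)"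
    then obtain i where i: "a = u [^] (i::nat)" by auto
    then have "a = u [^] (i mod p)" using pow_mod assms by simp
    then show "a \<in> (\<lambda>i. u [^] i) ` {..<p}" using p0 by auto
  qed auto
  moreover have "inj_on (\<lambda>i::nat. u [^] i) {..<p}"
    using pow_eq_cong[OF assms] by (auto simp: inj_on_def cong_def)
  ultimately show "card (range (\<lambda>i::nat. u [^] i)) = p"
    by (simp add: card_image)
qed

lemma cyclic_normalizer_subgroup:
  assumes fin: "finite (carrier G)" and u: "u \<in> carrier G"
  shows "subgroup (cyclic_normalizer G u) G"
proof (rule subgroup_finite_closedI[OF fin])
  show "\<one> \<in> cyclic_normalizer G u"
    using u by (auto simp: cyclic_normalizer_def intro!: exI[of _ 1])
next
  fix x y assume "x \<in> cyclic_normalizer G u" "y \<in> cyclic_normalizer G u"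
  then obtain i j :: nat where xy: "x \<in> carrier G" "y \<in> carrier G"
    and i: "x \<otimes> u \<otimes> inv x = u [^] i" and j: "y \<otimes> u \<otimes> inv y = u [^] j"
    by (auto simp: cyclic_normalizer_def)
  have "x \<otimes> y \<otimes> u \<otimes> inv (x \<otimes> y) = x \<otimes> (y \<otimes> u \<otimes> inv y) \<otimes> inv x"
    using xy u by (simp add: m_assoc inv_mult_group)
  also have "\<dots> = (x \<otimes> u \<otimes> inv x) [^] j"
    unfolding j using xy u by (simp add: conj_pow)
  also have "\<dots> = u [^] (i * j)" unfolding i using u by (simp add: nat_pow_pow)
  finally show "x \<otimes> y \<in> cyclic_normalizer G u"
    using xy by (auto simp: cyclic_normalizer_def)
qed (auto simp: cyclic_normalizer_def)

lemma iterated_conj: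
  assumes "u \<in> carrier G" "x \<in> carrier G" "x \<otimes> u \<otimes> inv x = u [^] (i::nat)"
  shows "x [^] n \<otimes> u \<otimes> inv (x [^] n) = u [^] (i ^ n)"
proof (induction n)
  case (Suc n)
  have "x [^] Suc n \<otimes> u \<otimes> inv (x [^] Suc n) = x [^] n \<otimes> (x \<otimes> u \<otimes> inv x) \<otimes> inv (x [^] n)"
    using assms(1,2) by (simp add: m_assoc inv_mult_group)
  also have "\<dots> = u [^] (i ^ n * i)"
    unfolding assms(3) using assms(1,2) Suc conj_pow[of u "x [^] n" i] by (simp add: nat_pow_pow)
  finally show ?case by (simp add: mult.commute)
qed (use assms in simp)

text \<open>Conjugation by \<open>g\<close> permutes \<open>T\<close> with period \<open>p\<close>, and it fixes exactly the elements that commute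
  with \<open>g\<close>.\<close>

lemma dvd_card_not_commuting:
  assumes "finite T" "T \<subseteq> carrier G" "g \<in> carrier G" "Factorial_Ring.prime (p::nat)" "g [^] p = \<one>"
    and "\<And>x. x \<in> T \<Longrightarrow> g \<otimes> x \<otimes> inv g \<in> T"
  shows "p dvd card {x \<in> T. g \<otimes> x \<noteq> x \<otimes> g}"
proof -
  let ?f = "\<lambda>x. g \<otimes> x \<otimes> inv g"
  have iter: "(?f ^^ n) x = g [^] n \<otimes> x \<otimes> inv (g [^] n)" if "x \<in> carrier G" for n x
  proof (induction n)
    case (Suc n)
    have "g \<otimes> g [^] n = g [^] n \<otimes> g" using assms(3) by (simp add: group_commutes_pow)
    then have "inv g [^] n \<otimes> inv g = inv g \<otimes> inv g [^] n"
      using assms(3) by (simp add: group_commutes_pow)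
    then show ?case using Suc assms(3) that \<open>g \<otimes> g [^] n = g [^] n \<otimes> g\<close>
      by (simp add: inv_mult_group m_assoc flip: nat_pow_inv) (simp flip: m_assoc)
  qed (use that in simp)
  have "p dvd card {x \<in> T. ?f x \<noteq> x}"
    using assms iter by (intro dvd_card_moved_points) (auto simp: subset_iff)
  moreover have "{x \<in> T. ?f x \<noteq> x} = {x \<in> T. g \<otimes> x \<noteq> x \<otimes> g}"
    using assms(2,3) by (auto simp: subset_iff inv_solve_right')
  ultimately show ?thesis by simp
qed

text \<open>Inside its normalizer the group \<open>P\<close> of powers of \<open>u\<close> has index prime to \<open>p\<close>, so \<open>x\<close> is conjugate
  into \<open>P\<close> there; but conjugation inside the normalizer preserves \<open>P\<close>.\<close>

lemma prime_order_in_cyclic_normalizer: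
  assumes fin: "finite (carrier G)" and p: "Factorial_Ring.prime (p::nat)" and nd: "\<not> p ^ 2 dvd order G"
    and u: "u \<in> carrier G" "u [^] p = \<one>" "u \<noteq> \<one>"
    and x: "x \<in> cyclic_normalizer G u" "x [^] p = \<one>"
  shows "x \<in> range (\<lambda>i::nat. u [^] i)"
proof -
  let ?N = "cyclic_normalizer G u" and ?P = "range (\<lambda>i::nat. u [^] i)"
  have N: "subgroup ?N G" using cyclic_normalizer_subgroup[OF fin u(1)] .
  interpret N: group "G\<lparr>carrier := ?N\<rparr>" using N by (rule subgroup_imp_group)
  have P: "subgroup ?P G" "card ?P = p" using powers_subgroup[OF p u] by auto
  have "?P \<subseteq> ?N"
  proof
    fix v assume "v \<in> ?P"
    then obtain i where v: "v = u [^] (i::nat)" by auto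
    have "v \<otimes> u \<otimes> inv v = u [^] (1::nat)"
      unfolding v using u by (simp add: m_assoc group_commutes_pow[of u u])
    then show "v \<in> ?N" using v u unfolding cyclic_normalizer_def by blast
  qed
  then have PN: "subgroup ?P (G\<lparr>carrier := ?N\<rparr>)"
    using P N subgroup_incl by blast
  have finN: "finite ?N" using fin N subgroup.subset finite_subset by blast
  have "card (lcosets\<^bsub>G\<lparr>carrier := ?N\<rparr>\<^esub> ?P) * p = card ?N"
    using N.l_lagrange[OF _ PN] finN P by (simp add: order_def)
  moreover have "card ?N dvd order G"
    using lagrange[OF N] by (metis dvd_triv_right)
  ultimately have "\<not> p dvd card (lcosets\<^bsub>G\<lparr>carrier := ?N\<rparr>\<^esub> ?P)"
    using nd by (metis dvd_trans mult_dvd_mono dvd_refl power2_eq_square)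
  moreover have "x [^]\<^bsub>G\<lparr>carrier := ?N\<rparr>\<^esub> p = \<one>\<^bsub>G\<lparr>carrier := ?N\<rparr>\<^esub>"
    using x by (simp flip: nat_pow_consistent)
  ultimately obtain g where g: "g \<in> ?N" "inv\<^bsub>G\<lparr>carrier := ?N\<rparr>\<^esub> g \<otimes> x \<otimes> g \<in> ?P"
    using N.conjugate_into_subgroup[OF _ PN p, of x] finN x by auto
  have gc: "g \<in> carrier G" "x \<in> carrier G" using g x by (auto simp: cyclic_normalizer_def)
  obtain k where k: "inv g \<otimes> x \<otimes> g = u [^] (k::nat)"
    using g m_inv_consistent[OF N g(1)] by auto
  obtain i where i: "g \<otimes> u \<otimes> inv g = u [^] (i::nat)" using g by (auto simp: cyclic_normalizer_def)
  have "x = g \<otimes> (inv g \<otimes> x \<otimes> g) \<otimes> inv g"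
    using gc by (simp add: m_assoc)
  also have "\<dots> = (g \<otimes> u \<otimes> inv g) [^] k"
    unfolding k using gc u by (simp add: conj_pow)
  also have "\<dots> = u [^] (i * k)" unfolding i using u by (simp add: nat_pow_pow)
  finally show ?thesis by auto
qed

end

section \<open>Groups of order 660 with a normal subgroup of order 11\<close>

locale order_660 = group +
  assumes finite_G: "finite (carrier G)" and order_G: "order G = 660"
begin

lemma prime_11: "Factorial_Ring.prime (11::nat)"
  by (simp add: prime_nat_numeral_eq)

lemma prime_5: "Factorial_Ring.prime (5::nat)"
  by (simp add: prime_nat_numeral_eq)

lemma coprime_11_60: "coprime 11 (60::nat)"
  using prime_imp_coprime[OF prime_11, of 60] by simp

lemma coprime_5_132: "coprime 5 (132::nat)"
  using prime_imp_coprime[OF prime_5, of 132] by simp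

lemma coprime_5_66: "coprime 5 (66::nat)"
  using prime_imp_coprime[OF prime_5, of 66] by simp

lemma pow_660: "x \<in> carrier G \<Longrightarrow> x [^] (660::nat) = \<one>"
  using pow_order_eq_1 order_G by metis

lemma composite_elements_660I:
  assumes "x \<in> carrier G" "a * b = (660::nat)" "x [^] a \<noteq> \<one>" "x [^] b \<noteq> \<one>"
  shows "x \<in> composite_elements G"
  using assms pow_660 by (intro composite_elementsI[of x a b]) auto

lemma finite_composite: "finite (composite_elements G)"
  using finite_G by (simp add: composite_elements_def)

lemma fermat_11: "\<not> 11 dvd (i::nat) \<Longrightarrow> [i ^ 10 = 1] (mod 11)"
  using fermat_theorem[OF prime_11, of i] by simp

text \<open>Conjugation by \<open>g\<close> raises \<open>u\<close> to some power \<open>i\<close> prime to 11, so conjugation by \<open>g\<^sup>1\<^sup>0\<close> raises it to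
  the power \<open>i\<^sup>1\<^sup>0\<close>, and Fermat's theorem applies.\<close>

lemma pow_10_commutes:
  assumes u: "u \<in> carrier G" "u [^] (11::nat) = \<one>" "u \<noteq> \<one>" and g: "g \<in> cyclic_normalizer G u"
  shows "g [^] (10::nat) \<otimes> u = u \<otimes> g [^] (10::nat)"
proof -
  obtain i where gc: "g \<in> carrier G" and i: "g \<otimes> u \<otimes> inv g = u [^] (i::nat)"
    using g by (auto simp: cyclic_normalizer_def)
  have "\<not> 11 dvd i"
  proof
    assume "11 dvd i"
    then have "g \<otimes> u \<otimes> inv g = \<one>"
      using i pow_eq_one_cong[OF prime_11 u] by simp
    then have "g \<otimes> u \<otimes> inv g \<otimes> g = \<one> \<otimes> g" by simp
    then show False using gc u by (simp add: m_assoc)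
  qed
  then have "u [^] (i ^ 10) = u [^] (1::nat)"
    using fermat_11 pow_eq_cong[OF prime_11 u] by blast
  then have "g [^] (10::nat) \<otimes> u \<otimes> inv (g [^] (10::nat)) = u"
    using iterated_conj[OF u(1) gc i, of 10] u by simp
  then show ?thesis
    using gc u by (metis inv_solve_right' m_closed nat_pow_closed)
qed

end

text \<open>The case of a normal subgroup of order 11. Its centralizer \<open>C\<close> is the product of the powers of \<open>u\<close>
  with the set \<open>S\<close> of those elements of \<open>C\<close> whose order is prime to 11, as each element of \<open>C\<close> splits
  into its two commuting parts. A nontrivial power of \<open>u\<close> times a nontrivial element of \<open>S\<close> is
  composite. If \<open>S\<close> has at least 15 elements this suffices; in the two remaining cases \<open>|S| = 12\<close>
  and \<open>|S| = 6\<close> further composite elements are products of an element of order 5, which lies outside \<open>C\<close>, with an element of \<open>S\<close> that it centralizes.\<close>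

locale normal_sylow_11 = order_660 +
  fixes u :: 'a
  assumes u_G: "u \<in> carrier G" and u_11: "u [^] (11::nat) = \<one>" and u_ne: "u \<noteq> \<one>"
    and normal: "cyclic_normalizer G u = carrier G"
begin

lemmas u = u_G u_11 u_ne

definition C where "C = {g \<in> carrier G. g \<otimes> u = u \<otimes> g}"

definition S where "S = {c \<in> C. c [^] (60::nat) = \<one>}"

abbreviation us where "us \<equiv> \<lambda>(i::nat, s). u [^] i \<otimes> s"

abbreviation mixed where "mixed \<equiv> us ` ({1..<11} \<times> (S - {\<one>}))"

lemma C_S_sub: "C \<subseteq> carrier G" "S \<subseteq> carrier G" "S \<subseteq> C"
  by (auto simp: C_def S_def)

lemmas C_sub = C_S_sub(1) and S_sub = C_S_sub(2) and S_sub_C = C_S_sub(3)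

lemma finite_S: "finite S"
  using S_sub finite_G finite_subset by blast

lemma C_subgroup: "subgroup C G"
proof (rule subgroup_finite_closedI[OF finite_G C_sub])
  show "\<one> \<in> C" using u by (simp add: C_def)
  show "x \<otimes> y \<in> C" if "x \<in> C" "y \<in> C" for x y
    using that u by (simp add: C_def) (metis m_assoc)
qed

lemma upow_C: "u [^] (i::nat) \<in> C"
  using u by (auto simp: C_def group_commutes_pow)

lemma upow_eq: "u [^] (i::nat) = u [^] (j::nat) \<longleftrightarrow> [i = j] (mod 11)"
  using pow_eq_cong[OF prime_11 u] .

lemma upow_commutes:
  assumes c: "c \<in> C"
  shows "u [^] (i::nat) \<otimes> c = c \<otimes> u [^] i"
  using c u by (auto simp: C_def group_commutes_pow)

lemma C660:
  assumes c: "c \<in> C"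
  shows "c [^] (660::nat) = \<one>"
  using c C_sub pow_660 by blast

lemma pow_us:
  assumes s: "s \<in> S"
  shows "(u [^] i \<otimes> s) [^] n = u [^] (i * n) \<otimes> s [^] (n::nat)"
proof -
  have "s \<in> carrier G" and "u [^] i \<otimes> s = s \<otimes> u [^] i"
    using s S_sub S_sub_C upow_commutes by auto
  then show ?thesis using u pow_mult_distrib[of "u [^] i" s n] by (simp only: nat_pow_closed nat_pow_pow)
qed

lemma inj_us: "inj_on us ({..<11} \<times> S)"
proof (rule inj_onI, clarify)
  fix i j :: nat and s r
  assume ij: "i < 11" "j < 11" and sr: "s \<in> S" "r \<in> S" and e: "u [^] i \<otimes> s = u [^] j \<otimes> r"
  have "s [^] (60::nat) = \<one>" "r [^] (60::nat) = \<one>" using sr by (auto simp: S_def)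
  moreover have "(u [^] i \<otimes> s) [^] (60::nat) = (u [^] j \<otimes> r) [^] (60::nat)" using e by simp
  ultimately have "u [^] (i * 60) = u [^] (j * 60)"
    using pow_us sr u by simp
  then have "[i * 60 = j * 60] (mod 11)" using upow_eq by blast
  then have "[i = j] (mod 11)"
    using cong_mult_rcancel_nat[of 60 11 i j] coprime_11_60 by (simp add: coprime_commute)
  then have "i = j" using ij by (simp add: cong_def)
  moreover from this have "s = r" using e u sr S_sub by (auto simp: subset_iff)
  ultimately show "i = j \<and> s = r" by simp
qed

lemma image_us: "us ` ({..<11} \<times> S) = C"
proof (intro equalityI subsetI)
  fix c assume "c \<in> us ` ({..<11} \<times> S)"
  then show "c \<in> C" using S_sub_C upow_C subgroup.m_closed[OF C_subgroup] by auto
next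
  fix c assume c: "c \<in> C"
  have cc: "c \<in> carrier G" using c C_sub by auto
  \<comment> \<open>As \<open>540 = 9 \<cdot> 60 \<equiv> 1\<close> modulo 11 and \<open>121 = 11\<^sup>2 \<equiv> 1\<close> modulo 60, the two parts of \<open>c\<close> are \<open>c\<^sup>5\<^sup>4\<^sup>0\<close> and \<open>c\<^sup>1\<^sup>2\<^sup>1\<close>.\<close>
  have "(c [^] (540::nat)) [^] (11::nat) = (c [^] (660::nat)) [^] (9::nat)"
    using cc by (simp add: nat_pow_pow)
  then have "(c [^] (540::nat)) [^] (11::nat) = \<one>" using C660[OF c] by simp
  then have "c [^] (540::nat) \<in> range (\<lambda>i::nat. u [^] i)"
    using prime_order_in_cyclic_normalizer[OF finite_G prime_11 _ u, of "c [^] (540::nat)"] cc normal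
    by (simp add: order_G)
  then obtain k where k: "c [^] (540::nat) = u [^] (k::nat)" by auto
  have "(c [^] (121::nat)) [^] (60::nat) = (c [^] (660::nat)) [^] (11::nat)"
    using cc by (simp add: nat_pow_pow)
  then have s: "c [^] (121::nat) \<in> S"
    using C660[OF c] subgroup_pow_closed[OF C_subgroup c] by (simp add: S_def)
  have "c = c [^] (661::nat)"
    using pow_mod[OF cc C660[OF c], of 661] cc by simp
  also have "\<dots> = c [^] (540::nat) \<otimes> c [^] (121::nat)"
    using cc by (simp add: nat_pow_mult)
  also have "\<dots> = u [^] (k mod 11) \<otimes> c [^] (121::nat)"
    unfolding k using pow_mod[OF u(1,2)] by simp
  finally show "c \<in> us ` ({..<11} \<times> S)"
    using s by (auto intro!: image_eqI[of _ _ "(k mod 11, c [^] (121::nat))"])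
qed

lemma card_C: "card C = 11 * card S"
  using card_image[OF inj_us] image_us by (simp add: card_cartesian_product)

lemma card_S_dvd: "card S dvd 60"
proof -
  have "card (rcosets C) * card C = 660"
    using lagrange[OF C_subgroup] order_G by simp
  then have "60 = card S * card (rcosets C)" using card_C by simp
  then show ?thesis by (rule dvdI)
qed

text \<open>The conjugates of \<open>u\<close> are among the ten elements \<open>u, \<dots>, u\<^sup>1\<^sup>0\<close>, so \<open>C\<close> has index at most 10.\<close>

lemma card_S_ge: "card S \<ge> 6"
proof -
  have "order G * card {u} \<le> card C * card ((\<lambda>(g, b). g \<otimes> b \<otimes> inv g) ` (carrier G \<times> {u}))"
  proof (rule card_conjugates_ge[OF finite_G _ C_sub])
    fix g b assume g: "g \<in> carrier G" "b \<in> {u}" "g \<otimes> b \<otimes> inv g \<in> {u}"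
    then have "g \<otimes> u = u \<otimes> g" using u by (metis inv_solve_right' m_closed singletonD)
    then show "g \<in> C" using g by (simp add: C_def)
  qed (use u in auto)
  then have "660 \<le> card C * card ((\<lambda>(g, b). g \<otimes> b \<otimes> inv g) ` (carrier G \<times> {u}))"
    by (simp add: order_G)
  moreover have "(\<lambda>(g, b). g \<otimes> b \<otimes> inv g) ` (carrier G \<times> {u}) \<subseteq> (\<lambda>i. u [^] i) ` {1..<11::nat}"
  proof clarify
    fix g assume g: "g \<in> carrier G"
    then obtain i where i: "g \<otimes> u \<otimes> inv g = u [^] (i::nat)"
      using normal by (auto simp: cyclic_normalizer_def)
    have "i mod 11 \<noteq> 0"
    proof
      assume "i mod 11 = 0"
      then have "g \<otimes> u \<otimes> inv g = \<one>" using i pow_mod[OF u(1,2), of i] by simp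
      then have "g \<otimes> u \<otimes> inv g \<otimes> g = \<one> \<otimes> g" by simp
      then show False using g u by (simp add: m_assoc)
    qed
    then show "g \<otimes> u \<otimes> inv g \<in> (\<lambda>i. u [^] i) ` {1..<11::nat}"
      using i pow_mod[OF u(1,2), of i] by (auto intro!: image_eqI[of _ _ "i mod 11"])
  qed
  then have "card ((\<lambda>(g, b). g \<otimes> b \<otimes> inv g) ` (carrier G \<times> {u})) \<le> card {1..<11::nat}"
    by (intro surj_card_le) simp_all
  then have "card C * card ((\<lambda>(g, b). g \<otimes> b \<otimes> inv g) ` (carrier G \<times> {u})) \<le> card C * 10"
    by (intro mult_le_mono2) simp
  ultimately have "660 \<le> card C * 10"
    by linarith
  then show ?thesis using card_C by simp
qed

text \<open>For \<open>z\<close> of order 3 the element \<open>z = z\<^sup>1\<^sup>0\<close> centralizes \<open>u\<close>. This rules out \<open>|S| = 10\<close>, for which the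
  count of composite elements would be too small.\<close>

lemma three_dvd_card_S: "3 dvd card S"
proof (rule ccontr)
  assume n3: "\<not> 3 dvd card S"
  obtain z where z: "z \<in> carrier G" "z \<noteq> \<one>" "z [^] (3::nat) = \<one>"
    using exists_prime_order[OF finite_G subgroup_self, of 3] order_G by (auto simp: order_def)
  have "z [^] (10::nat) = z" using pow_mod[OF z(1,3), of 10] z by simp
  then have "z \<in> C" using pow_10_commutes[OF u, of z] z normal by (simp add: C_def)
  then have "z [^] card C = \<one>" using subgroup_pow_card[OF C_subgroup] by blast
  moreover have "coprime 3 (card C)"
    using n3 card_C by (simp add: prime_imp_coprime prime_dvd_mult_iff prime_nat_numeral_eq)
  ultimately show False using pow_coprime_trivial[OF z(1,3)] z(2) by blast
qed

lemma one_S: "\<one> \<in> S"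
  using u by (simp add: S_def C_def)

text \<open>The order of \<open>u\<^sup>i s\<close> divides neither 60 nor 11, since \<open>s\<close> survives in the 11th power and \<open>u\<^sup>i\<close> in
  the 60th.\<close>

lemma mixed_composite: "mixed \<subseteq> composite_elements G"
proof
  fix a assume "a \<in> mixed"
  then obtain q where q: "q \<in> {1..<11} \<times> (S - {\<one>})" "a = us q" by blast
  obtain i s where "q = (i, s)" by (cases q)
  then have i: "i \<in> {1..<11}" and s: "s \<in> S" "s \<noteq> \<one>" and a: "a = u [^] i \<otimes> s"
    using q by auto
  have sc: "s \<in> carrier G" "s [^] (60::nat) = \<one>" using s S_sub by (auto simp: S_def)
  have "(u [^] i \<otimes> s) [^] (60::nat) = u [^] (i * 60)"
    using pow_us[OF s(1)] sc u by simp
  moreover have "u [^] (i * 60) \<noteq> \<one>"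
    using pow_eq_one_cong[OF prime_11 u, of "i * 60"] i prime_dvd_mult_nat[OF prime_11, of i 60]
    by (auto dest!: dvd_imp_le)
  moreover have "(u [^] i \<otimes> s) [^] (11::nat) = s [^] (11::nat)"
    using pow_us[OF s(1)] sc u nat_pow_pow[of u 11 i] by (simp add: mult.commute)
  moreover have "s [^] (11::nat) \<noteq> \<one>"
    using pow_coprime_trivial[OF sc(1) _ sc(2), of 11] s(2) coprime_11_60 by blast
  ultimately show "a \<in> composite_elements G"
    unfolding a using u sc by (intro composite_elements_660I[of _ 60 11]) simp_all
qed

lemma mixed_C: "mixed \<subseteq> C"
proof -
  have "mixed \<subseteq> us ` ({..<11} \<times> S)" by (rule image_mono) auto
  then show ?thesis by (simp only: image_us)
qed

lemma card_mixed: "card mixed = 10 * (card S - 1)"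
proof -
  have "inj_on us ({1..<11} \<times> (S - {\<one>}))" by (rule inj_on_subset[OF inj_us]) auto
  then show ?thesis using one_S finite_S by (simp add: card_image card_cartesian_product)
qed

lemma card_S_cases: "card S \<ge> 15 \<or> card S = 12 \<or> card S = 6"
proof -
  obtain k where k: "card S = 3 * k" using three_dvd_card_S by auto
  obtain l where "60 = card S * l" using card_S_dvd by blast
  then have "k * l = 20" using k by simp
  have "k \<noteq> 3"
  proof
    assume "k = 3"
    with \<open>k * l = 20\<close> have "3 * l = 20" by simp
    then show False by presburger
  qed
  then have "card S = 6 \<or> card S = 12 \<or> card S \<ge> 15" using k card_S_ge by presburger
  then show ?thesis by blast
qed

lemma conj_S:
  assumes g: "g \<in> carrier G" and s: "s \<in> S"
  shows "g \<otimes> s \<otimes> inv g \<in> S"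
proof -
  have sc: "s \<in> carrier G" and sC: "s \<in> C" using s S_sub S_sub_C by auto
  have "inv g \<in> cyclic_normalizer G u" using normal g by simp
  then obtain j where j: "inv g \<otimes> u \<otimes> g = u [^] (j::nat)"
    using g by (auto simp: cyclic_normalizer_def)
  have "g \<otimes> s \<otimes> inv g \<otimes> u = g \<otimes> (s \<otimes> (inv g \<otimes> u \<otimes> g)) \<otimes> inv g"
    using g sc u by (simp add: m_assoc)
  also have "\<dots> = g \<otimes> ((inv g \<otimes> u \<otimes> g) \<otimes> s) \<otimes> inv g"
    unfolding j using upow_commutes[OF sC] by simp
  also have "\<dots> = u \<otimes> (g \<otimes> s \<otimes> inv g)"
    using g sc u by (simp add: m_assoc)
  finally have "g \<otimes> s \<otimes> inv g \<in> C" using g sc by (simp add: C_def)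
  moreover have "(g \<otimes> s \<otimes> inv g) [^] (60::nat) = \<one>"
    using conj_pow[OF sc g, of 60] s g by (simp add: S_def)
  ultimately show ?thesis by (simp add: S_def)
qed

lemma order_5_notin_C:
  assumes S: "card S = 6 \<or> card S = 12" and y: "y \<in> carrier G" "y \<noteq> \<one>" "y [^] (5::nat) = \<one>"
  shows "y \<notin> C"
proof
  assume "y \<in> C"
  then have "y [^] card C = \<one>" by (rule subgroup_pow_card[OF C_subgroup])
  moreover have "card C = 66 \<or> card C = 132" using S card_C by auto
  then have "coprime 5 (card C)"
    using coprime_5_66 coprime_5_132 by (elim disjE) (simp_all only:)
  ultimately show False using pow_coprime_trivial[OF y(1,3)] y(2) by blast
qed

lemma order_5_times_S:
  assumes S: "card S = 6 \<or> card S = 12" and y: "y \<in> carrier G" "y \<noteq> \<one>" "y [^] (5::nat) = \<one>"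
    and s: "s \<in> S" "s \<noteq> \<one>" "y \<otimes> s = s \<otimes> y"
  shows "y \<otimes> s \<in> composite_elements G \<and> y \<otimes> s \<notin> C"
proof
  have sc: "s \<in> carrier G" and sC: "s \<in> C" using s S_sub S_sub_C by auto
  have pw: "(y \<otimes> s) [^] n = y [^] n \<otimes> s [^] n" for n :: nat
    using pow_mult_distrib[OF s(3) y(1) sc] .
  have scard: "s [^] card C = \<one>" using subgroup_pow_card[OF C_subgroup sC] .
  then have s132: "s [^] (132::nat) = \<one>"
    using S card_C nat_pow_pow[OF sc, of 66 2] by auto
  have "y [^] (132::nat) = y [^] (2::nat)"
    using pow_mod[OF y(1,3), of 132] by simp
  moreover have "y [^] (2::nat) \<noteq> \<one>"
    using pow_coprime_trivial[OF y(1) _ y(3), of 2] y(2) by auto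
  ultimately have "(y \<otimes> s) [^] (132::nat) \<noteq> \<one>" using pw s132 y by simp
  moreover have "(y \<otimes> s) [^] (5::nat) \<noteq> \<one>"
    using pow_coprime_trivial[OF sc _ s132, of 5] coprime_5_132 pw[of 5] y(3) s(2) sc by auto
  ultimately show "y \<otimes> s \<in> composite_elements G"
    using y sc by (intro composite_elements_660I[of _ 132 5]) simp_all
  show "y \<otimes> s \<notin> C"
  proof
    assume "y \<otimes> s \<in> C"
    then have "y \<otimes> s \<otimes> inv s \<in> C"
      using subgroup.m_closed[OF C_subgroup] subgroup.m_inv_closed[OF C_subgroup sC] by blast
    then show False using order_5_notin_C[OF S y] y sc by (simp add: m_assoc)
  qed
qed

text \<open>An element \<open>y\<close> of order 5 fixes \<open>\<one>\<close> in \<open>S\<close> and hence, as \<open>12 \<equiv> 2\<close> modulo 5, also some \<open>s \<noteq> \<one>\<close>. The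
  composite element \<open>y s\<close> is the one that is missing beyond the 110 elements in \<open>C\<close>.\<close>

lemma composites_12:
  assumes 2: "card S = 12"
  shows "card (composite_elements G) > 110"
proof -
  obtain y where y: "y \<in> carrier G" "y \<noteq> \<one>" "y [^] (5::nat) = \<one>"
    using exists_prime_order[OF finite_G subgroup_self prime_5] order_G by (auto simp: order_def)
  have "5 dvd card {s \<in> S. y \<otimes> s \<noteq> s \<otimes> y}"
    using dvd_card_not_commuting[OF finite_S S_sub y(1) prime_5 y(3)] conj_S[OF y(1)] by blast
  moreover have "card (S - {\<one>}) = 11" using 2 one_S finite_S by simp
  ultimately have "{s \<in> S. y \<otimes> s \<noteq> s \<otimes> y} \<noteq> S - {\<one>}" by (intro notI) simp
  moreover have "{s \<in> S. y \<otimes> s \<noteq> s \<otimes> y} \<subseteq> S - {\<one>}" using y(1) by force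
  ultimately obtain s where s: "s \<in> S" "s \<noteq> \<one>" "y \<otimes> s = s \<otimes> y" by blast
  have ys: "y \<otimes> s \<in> composite_elements G" "y \<otimes> s \<notin> C" using order_5_times_S[OF disjI2[OF 2] y s] by blast+
  have "y \<otimes> s \<notin> mixed" using ys(2) mixed_C by blast
  moreover have "finite mixed" using finite_S by simp
  ultimately have "card (insert (y \<otimes> s) mixed) = Suc (card mixed)"
    by (rule card_insert_disjoint[rotated])
  moreover have "insert (y \<otimes> s) mixed \<subseteq> composite_elements G" by (rule insert_subsetI[OF ys(1) mixed_composite])
  then have "card (insert (y \<otimes> s) mixed) \<le> card (composite_elements G)" by (rule card_mono[OF finite_composite])
  ultimately show ?thesis using card_mixed 2 by linarith
qed

text \<open>The set \<open>T\<close> of elements of order 3 in \<open>S\<close> has between 1 and 4 members, because \<open>S\<close> also contains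
  the identity and an involution. So \<open>y\<close> fixes a member of \<open>T\<close>, hence at least two elements of \<open>S\<close>,
  and the remaining four are too few to form an orbit of length 5.\<close>

lemma order_5_central_on_S:
  assumes 3: "card S = 6" and y: "y \<in> carrier G" "y [^] (5::nat) = \<one>" and s: "s \<in> S"
  shows "y \<otimes> s = s \<otimes> y"
proof -
  define T where "T = {s \<in> S. s [^] (3::nat) = \<one> \<and> s \<noteq> \<one>}"
  have T0: "T \<noteq> {}"
  proof -
    have "3 dvd card C" using three_dvd_card_S card_C by simp
    then obtain z where z: "z \<in> C" "z \<noteq> \<one>" "z [^] (3::nat) = \<one>"
      using exists_prime_order[OF finite_G C_subgroup, of 3] by (auto simp: prime_nat_numeral_eq)
    then have "z [^] (60::nat) = \<one>"
      using C_sub nat_pow_pow[of z 3 20] by auto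
    then show ?thesis using z by (auto simp: T_def S_def)
  qed
  have T4: "card T \<le> 4"
  proof -
    have "2 dvd card C" using 3 card_C by simp
    then obtain w where w: "w \<in> C" "w \<noteq> \<one>" "w [^] (2::nat) = \<one>"
      using exists_prime_order[OF finite_G C_subgroup two_is_prime_nat] by auto
    then have "w [^] (60::nat) = \<one>"
      using C_sub nat_pow_pow[of w 2 30] by auto
    then have wS: "w \<in> S" using w by (simp add: S_def)
    have "w [^] (3::nat) \<noteq> \<one>"
      using pow_coprime_trivial[of w 2 3] w C_sub by auto
    then have "T \<subseteq> S - {\<one>, w}" by (auto simp: T_def)
    then have "card T \<le> card (S - {\<one>, w})"
      using finite_S by (intro card_mono) auto
    also have "\<dots> = 4" using 3 w wS one_S finite_S by (subst card_Diff_subset) auto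
    finally show ?thesis .
  qed
  have finT: "finite T" using finite_S by (simp add: T_def)
  have conjT: "y \<otimes> t \<otimes> inv y \<in> T" if "t \<in> T" for t
  proof -
    have tc: "t \<in> carrier G" using that S_sub by (auto simp: T_def)
    have "y \<otimes> t \<otimes> inv y \<noteq> \<one>"
    proof
      assume "y \<otimes> t \<otimes> inv y = \<one>"
      then have "y \<otimes> t \<otimes> inv y \<otimes> y = \<one> \<otimes> y" by simp
      then show False using that tc y by (simp add: m_assoc T_def)
    qed
    then show ?thesis
      using that conj_S[OF y(1), of t] conj_pow[OF tc y(1), of 3] y(1) by (simp add: T_def)
  qed
  have "5 dvd card {t \<in> T. y \<otimes> t \<noteq> t \<otimes> y}"
    using dvd_card_not_commuting[OF finT _ y(1) prime_5 y(2)] conjT S_sub by (auto simp: T_def)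
  moreover have "card {t \<in> T. y \<otimes> t \<noteq> t \<otimes> y} \<le> card T" using finT by (intro card_mono) auto
  ultimately have "card {t \<in> T. y \<otimes> t \<noteq> t \<otimes> y} = 0" using T4 by (auto elim!: dvdE)
  then have "{t \<in> T. y \<otimes> t \<noteq> t \<otimes> y} = {}" using finT by simp
  then obtain t where t: "t \<in> S" "t \<noteq> \<one>" "y \<otimes> t = t \<otimes> y" using T0 by (auto simp: T_def)
  have d5: "5 dvd card {s \<in> S. y \<otimes> s \<noteq> s \<otimes> y}"
    using dvd_card_not_commuting[OF finite_S S_sub y(1) prime_5 y(2)] conj_S[OF y(1)] by blast
  have "card {s \<in> S. y \<otimes> s \<noteq> s \<otimes> y} \<le> card (S - {\<one>, t})"
    using finite_S t y by (intro card_mono) auto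
  also have "\<dots> = 4" using 3 t one_S finite_S by (subst card_Diff_subset) auto
  finally have "card {s \<in> S. y \<otimes> s \<noteq> s \<otimes> y} = 0" using d5 by (auto elim!: dvdE)
  then have "{s \<in> S. y \<otimes> s \<noteq> s \<otimes> y} = {}" using finite_S by simp
  then show ?thesis using s by blast
qed

text \<open>The number of elements of order 5 is divisible by 11, since \<open>u\<close> permutes them without fixed points,
  and by 2, since inversion does so too. Each of these at least 22 elements centralizes \<open>S\<close>, so it
  yields 5 composite elements outside \<open>C\<close>.\<close>

lemma composites_6:
  assumes 3: "card S = 6"
  shows "card (composite_elements G) > 110"
proof -
  have S6: "card S = 6 \<or> card S = 12" using 3 by simp
  note central = order_5_central_on_S[OF 3]
  define Y where "Y = {y \<in> carrier G. y [^] (5::nat) = \<one> \<and> y \<noteq> \<one>}"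
  have finY: "finite Y" and Yc: "Y \<subseteq> carrier G" using finite_G by (auto simp: Y_def)
  have cardY: "card Y \<ge> 22"
  proof -
    have "{y \<in> Y. u \<otimes> y \<noteq> y \<otimes> u} = Y"
    proof -
      have "u \<otimes> y \<noteq> y \<otimes> u" if "y \<in> Y" for y
        using order_5_notin_C[OF S6, of y] that by (auto simp: Y_def C_def)
      then show ?thesis by blast
    qed
    moreover have "11 dvd card {y \<in> Y. u \<otimes> y \<noteq> y \<otimes> u}"
    proof (rule dvd_card_not_commuting[OF finY Yc u(1) prime_11 u(2)])
      fix y assume y: "y \<in> Y"
      then have yc: "y \<in> carrier G" by (simp add: Y_def)
      have "u \<otimes> y \<otimes> inv u \<noteq> \<one>"
      proof
        assume "u \<otimes> y \<otimes> inv u = \<one>"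
        then have "u \<otimes> y \<otimes> inv u \<otimes> u = \<one> \<otimes> u" by simp
        then show False using y u(1) yc by (simp add: m_assoc Y_def)
      qed
      then show "u \<otimes> y \<otimes> inv u \<in> Y"
        using y u(1) conj_pow[OF yc u(1), of 5] by (simp add: Y_def)
    qed
    ultimately have "11 dvd card Y" by simp
    moreover have "2 dvd card {y \<in> Y. inv y \<noteq> y}"
    proof (rule dvd_card_moved_points[OF two_is_prime_nat finY])
      show "m_inv G ` Y \<subseteq> Y" by (auto simp: Y_def nat_pow_inv)
    qed (auto simp: Y_def numeral_2_eq_2)
    moreover have "{y \<in> Y. inv y \<noteq> y} = Y"
    proof -
      have False if y: "y \<in> Y" and "inv y = y" for y
      proof -
        have y': "y \<in> carrier G" "y [^] (5::nat) = \<one>" "y \<noteq> \<one>"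
          using y by (simp_all add: Y_def)
        have "y \<otimes> y = \<one>" using l_inv[OF y'(1)] \<open>inv y = y\<close> by simp
        then have "y [^] (2::nat) = \<one>" using y'(1) by (simp add: numeral_2_eq_2)
        moreover have "coprime 2 (5::nat)" by simp
        ultimately show False using pow_coprime_trivial[OF y'(1) _ y'(2)] y'(3) by blast
      qed
      then show ?thesis by auto
    qed
    moreover have "Y \<noteq> {}"
    proof -
      have "5 dvd card (carrier G)" using order_G by (simp add: order_def)
      then show ?thesis
        using exists_prime_order[OF finite_G subgroup_self prime_5] by (force simp: Y_def)
    qed
    ultimately have "11 dvd card Y" "2 dvd card Y" "card Y > 0"
      using finY by (auto simp: card_gt_0_iff)
    then show ?thesis by presburger
  qed
  let ?g = "\<lambda>(y, s). y \<otimes> s" and ?YS = "Y \<times> (S - {\<one>})"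
  have "inj_on ?g ?YS"
  proof (rule inj_onI)
    fix q q' assume q: "q \<in> ?YS" "q' \<in> ?YS" "?g q = ?g q'"
    obtain y s y' s' where qq: "q = (y, s)" "q' = (y', s')" by (cases q, cases q')
    then have y: "y \<in> Y" "y' \<in> Y" and s: "s \<in> S" "s' \<in> S" and e: "y \<otimes> s = y' \<otimes> s'"
      using q by auto
    \<comment> \<open>The exponent 66 kills \<open>S\<close> and is 1 modulo 5, so this power recovers \<open>y\<close> from \<open>y s\<close>.\<close>
    have p66: "(y \<otimes> s) [^] (66::nat) = y" if "y \<in> Y" "s \<in> S" for y s
    proof -
      have c: "y \<in> carrier G" "s \<in> carrier G" "y [^] (5::nat) = \<one>"
        using that S_sub by (auto simp: Y_def)
      have "s [^] (66::nat) = \<one>"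
        using subgroup_pow_card[OF C_subgroup, of s] that S_sub_C card_C 3 by auto
      moreover have "y [^] (66::nat) = y"
        using pow_mod[OF c(1,3), of 66] c by simp
      ultimately show ?thesis
        using pow_mult_distrib[of y s 66] central[of y s] c that by simp
    qed
    have "y = y'" using p66[OF y(1) s(1)] p66[OF y(2) s(2)] e by simp
    moreover from this have "s = s'" using e y s S_sub Yc by (auto simp: subset_iff)
    ultimately show "q = q'" by (simp add: qq)
  qed
  then have cardYS: "card (?g ` ?YS) = card Y * 5"
    using 3 one_S finite_S by (simp add: card_image card_cartesian_product)
  have "y \<otimes> s \<in> composite_elements G \<and> y \<otimes> s \<notin> C" if "y \<in> Y" "s \<in> S - {\<one>}" for y s
  proof -
    have "y \<in> carrier G" "y \<noteq> \<one>" "y [^] (5::nat) = \<one>" "s \<in> S" "s \<noteq> \<one>"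
      using that by (simp_all add: Y_def)
    then show ?thesis using order_5_times_S[OF S6] central by blast
  qed
  then have YS: "?g ` ?YS \<subseteq> composite_elements G" "?g ` ?YS \<inter> C = {}" by auto
  have "card (mixed \<union> ?g ` ?YS) = card mixed + card (?g ` ?YS)"
  proof (rule card_Un_disjoint)
    show "finite mixed" "finite (?g ` ?YS)" using finite_S finY by simp_all
    show "mixed \<inter> ?g ` ?YS = {}" using YS(2) mixed_C by blast
  qed
  moreover have "card (mixed \<union> ?g ` ?YS) \<le> card (composite_elements G)"
    by (rule card_mono[OF finite_composite Un_least[OF mixed_composite YS(1)]])
  ultimately show ?thesis using cardYS cardY card_mixed 3 by linarith
qed

lemma composites_gt: "card (composite_elements G) > 110"
  using card_S_cases
proof (elim disjE)
  assume "card S \<ge> 15"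
  then show ?thesis using card_mixed card_mono[OF finite_composite mixed_composite] by simp
qed (rule composites_12 composites_6, assumption)+

end

lemma (in order_660) normal_sylow_11_composites:
  assumes "u \<in> carrier G" "u [^] (11::nat) = \<one>" "u \<noteq> \<one>"
    and "cyclic_normalizer G u = carrier G"
  shows "card (composite_elements G) > 110"
proof -
  interpret normal_sylow_11 G u
    by (intro normal_sylow_11.intro normal_sylow_11_axioms.intro order_660_axioms assms)
  show ?thesis by (rule composites_gt)
qed

section \<open>The normalizer of a subgroup of order 11\<close>

lemma (in group) l_coset_absorb:
  assumes "subgroup H G" "x \<in> carrier G" "n \<in> H"
  shows "(x \<otimes> n) <# H = x <# H"
proof -
  have "n \<in> carrier G" using assms subgroup.mem_carrier by metis
  then show ?thesis using assms by (simp add: l_coset_eq_iff)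
qed

text \<open>Among the cosets of \<open>N\<close>, the element \<open>u\<close> fixes \<open>N\<close> only. So the index of \<open>N\<close> is a divisor of 60
  that is congruent to 1 modulo 11, that is, 1 or 12.\<close>

lemma (in order_660) sylow_11_normalizer_card:
  assumes u: "u \<in> carrier G" "u [^] (11::nat) = \<one>" "u \<noteq> \<one>"
    and not_normal: "cyclic_normalizer G u \<noteq> carrier G"
  shows "card (cyclic_normalizer G u) = 55"
proof -
  let ?N = "cyclic_normalizer G u"
  have N: "subgroup ?N G" using cyclic_normalizer_subgroup[OF finite_G u(1)] .
  have not121: "\<not> 11 ^ 2 dvd order G" by (simp add: order_G)
  have "{K \<in> lcosets ?N. u <# K = K} = {?N}"
  proof (intro equalityI subsetI)
    fix K assume "K \<in> {K \<in> lcosets ?N. u <# K = K}"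
    then obtain g where g: "g \<in> carrier G" "K = g <# ?N" "u <# (g <# ?N) = g <# ?N"
      by (auto simp: LCOSETS_def)
    have "inv g \<otimes> u \<otimes> g \<in> ?N" using fixed_coset_iff[OF N u(1) g(1)] g(3) by blast
    moreover have "(inv g \<otimes> u \<otimes> g) [^] (11::nat) = \<one>"
      using conj_pow[OF u(1) inv_closed[OF g(1)], of 11] g(1) u(2) by simp
    ultimately have "inv g \<otimes> u \<otimes> g \<in> range (\<lambda>i::nat. u [^] i)"
      using prime_order_in_cyclic_normalizer[OF finite_G prime_11 not121 u] by blast
    then have "inv g \<in> ?N" using g(1) by (auto simp: cyclic_normalizer_def)
    then have "g \<in> ?N" using subgroup.m_inv_closed[OF N] g(1) by fastforce
    then have "(\<one> \<otimes> g) <# ?N = \<one> <# ?N"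
      using l_coset_absorb[OF N one_closed] by blast
    then show "K \<in> {?N}" using g(1,2) subgroup.subset[OF N] by (simp add: lcos_mult_one)
  next
    fix K assume "K \<in> {?N}"
    then have K: "K = \<one> <# ?N" using subgroup.subset[OF N] by (simp add: lcos_mult_one)
    have "u \<in> ?N" using u by (auto simp: cyclic_normalizer_def m_assoc intro!: exI[of _ 1])
    then have "u <# K = K" unfolding K using fixed_coset_iff[OF N u(1) one_closed] u(1) by simp
    moreover have "K \<in> lcosets ?N" unfolding K LCOSETS_def by blast
    ultimately show "K \<in> {K \<in> lcosets ?N. u <# K = K}" by blast
  qed
  then have cong: "[card (lcosets ?N) = 1] (mod 11)"
    using fixed_cosets_cong[OF finite_G N prime_11 u(1,2)] by simp
  have lag: "card (lcosets ?N) * card ?N = 660"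
    using l_lagrange[OF finite_G N] order_G by simp
  have "u \<in> ?N" using u by (auto simp: cyclic_normalizer_def m_assoc intro!: exI[of _ 1])
  then have "u [^] card ?N = \<one>" by (rule subgroup_pow_card[OF N])
  then have "11 dvd card ?N" using pow_eq_one_cong[OF prime_11 u] by blast
  then obtain m where m: "card ?N = 11 * m" by blast
  have Lm: "card (lcosets ?N) * m = 60" using lag unfolding m by (simp add: mult.commute)
  obtain q where q: "card (lcosets ?N) = 11 * q + 1"
  proof -
    have "card (lcosets ?N) mod 11 = 1" using cong by (simp add: cong_def)
    then have "card (lcosets ?N) = 11 * (card (lcosets ?N) div 11) + 1" by presburger
    then show ?thesis using that by blast
  qed
  have q0: "q \<noteq> 0"
  proof
    assume "q = 0"
    then have "card ?N = card (carrier G)" using lag q order_G by (simp add: order_def)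
    then show False using card_subset_eq[OF finite_G subgroup.subset[OF N]] not_normal by blast
  qed
  have "m = 5"
  proof -
    have "m \<noteq> 0" using Lm by (cases m) auto
    then have "card (lcosets ?N) \<le> 60" using mult_le_mono2[of 1 m "card (lcosets ?N)"] Lm by simp
    then have "q \<in> {1, 2, 3, 4, 5}" using q q0 by auto
    then have "12 * m = 60 \<or> 23 * m = 60 \<or> 34 * m = 60 \<or> 45 * m = 60 \<or> 56 * m = 60"
      using Lm q by auto
    then show ?thesis by (elim disjE) presburger+
  qed
  then show ?thesis using m by simp
qed

text \<open>The 55 products \<open>u\<^sup>i h\<^sup>j\<close> are distinct because a common element of the two cyclic groups has order
  dividing both 11 and 5.\<close>

lemma (in order_660) powers_11_5_fill:
  assumes N: "subgroup N G" "card N = 55"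
    and u: "u \<in> N" "u [^] (11::nat) = \<one>" "u \<noteq> \<one>" and h: "h \<in> N" "h [^] (5::nat) = \<one>" "h \<noteq> \<one>"
  shows "N = (\<lambda>(i, j). u [^] i \<otimes> h [^] j) ` ({..<11::nat} \<times> {..<5::nat})"
proof -
  let ?f = "\<lambda>(i, j). u [^] i \<otimes> h [^] j" and ?A = "{..<11::nat} \<times> {..<5::nat}"
  have NG: "N \<subseteq> carrier G" using N subgroup.subset by blast
  have uc: "u \<in> carrier G" and hc: "h \<in> carrier G" using u h NG by auto
  have finN: "finite N" using NG finite_G finite_subset by blast
  have inj: "inj_on ?f ?A"
  proof (rule inj_onI)
    fix q q' assume q: "q \<in> ?A" "q' \<in> ?A" "?f q = ?f q'"
    obtain i j i' j' where qq: "q = (i, j)" "q' = (i', j')" by (cases q, cases q')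
    then have lt: "i < 11" "i' < 11" "j < 5" "j' < 5"
      and e: "u [^] i \<otimes> h [^] j = u [^] i' \<otimes> h [^] j'" using q by auto
    define x where "x = inv (u [^] i') \<otimes> u [^] i"
    have "inv (u [^] i') \<otimes> (u [^] i \<otimes> h [^] j) \<otimes> inv (h [^] j)
        = inv (u [^] i') \<otimes> (u [^] i' \<otimes> h [^] j') \<otimes> inv (h [^] j)" using e by simp
    then have x: "x = h [^] j' \<otimes> inv (h [^] j)"
      unfolding x_def using uc hc by (simp add: m_assoc)
    have "x \<in> range (\<lambda>i::nat. u [^] i)"
      unfolding x_def using powers_subgroup(1)[OF prime_11 uc u(2,3)]
      by (intro subgroup.m_closed subgroup.m_inv_closed) auto
    then have x11: "x [^] (11::nat) = \<one>"
      using powers_subgroup(2)[OF prime_11 uc u(2,3)] subgroup_pow_card[OF powers_subgroup(1)[OF prime_11 uc u(2,3)], of x]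
      by simp
    have "x \<in> range (\<lambda>i::nat. h [^] i)"
      unfolding x using powers_subgroup(1)[OF prime_5 hc h(2,3)]
      by (intro subgroup.m_closed subgroup.m_inv_closed) auto
    then have x5: "x [^] (5::nat) = \<one>"
      using powers_subgroup(2)[OF prime_5 hc h(2,3)] subgroup_pow_card[OF powers_subgroup(1)[OF prime_5 hc h(2,3)], of x]
      by simp
    have "coprime 11 (5::nat)" using prime_imp_coprime[OF prime_11, of 5] by simp
    then have x1: "x = \<one>"
      using pow_coprime_trivial[OF _ x11 x5] x uc hc by simp
    have "u [^] i' \<otimes> x = u [^] i" unfolding x_def using uc by simp
    then have "u [^] i = u [^] i'" using x1 uc by simp
    then have "i = i'" using pow_eq_cong[OF prime_11 uc u(2,3)] lt by (simp add: cong_def)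
    moreover have "x \<otimes> h [^] j = h [^] j'" unfolding x using hc by (simp add: m_assoc)
    then have "h [^] j = h [^] j'" using x1 hc by simp
    then have "j = j'" using pow_eq_cong[OF prime_5 hc h(2,3)] lt by (simp add: cong_def)
    ultimately show "q = q'" by (simp add: qq)
  qed
  have "?f ` ?A \<subseteq> N"
    using subgroup_pow_closed[OF N(1)] u(1) h(1) subgroup.m_closed[OF N(1)] by auto
  moreover have "card (?f ` ?A) = card N"
    using card_image[OF inj] N(2) by (simp add: card_cartesian_product)
  ultimately show ?thesis using card_subset_eq[OF finN] by metis
qed

text \<open>The elements \<open>u\<^sup>i h\<close> have order 55, and whoever conjugates one of them to another one normalizes the
  group generated by \<open>u\<close>. So these ten elements have \<open>12 \<cdot> 10\<close> conjugates.\<close>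

lemma (in order_660) commuting_11_5_composites:
  assumes u: "u \<in> carrier G" "u [^] (11::nat) = \<one>" "u \<noteq> \<one>" and N: "card (cyclic_normalizer G u) = 55"
    and h: "h \<in> carrier G" "h [^] (5::nat) = \<one>" "h \<noteq> \<one>" and comm: "h \<otimes> u = u \<otimes> h"
  shows "card (composite_elements G) > 110"
proof -
  let ?N = "cyclic_normalizer G u" and ?B = "(\<lambda>i. u [^] i \<otimes> h) ` {1..<11::nat}"
  let ?C = "(\<lambda>(g, b). g \<otimes> b \<otimes> inv g) ` (carrier G \<times> ?B)"
  have cu: "u [^] i \<otimes> h = h \<otimes> u [^] i" for i :: nat
    using group_commutes_pow[of u h i] comm u h by simp
  have pw: "(u [^] i \<otimes> h) [^] n = u [^] (i * n) \<otimes> h [^] n" for i n :: nat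
    using pow_mult_distrib[OF cu _ h(1), of i n] u by (simp only: nat_pow_closed nat_pow_pow)
  have notdvd: "\<not> 11 dvd i * 45" if "i \<in> {1..<11}" for i :: nat
  proof
    assume "11 dvd i * 45"
    then have "11 dvd i" using prime_dvd_mult_nat[OF prime_11, of i 45] by auto
    then show False using that by (auto dest: dvd_imp_le)
  qed
  have "order G * card ?B \<le> card ?N * card ?C"
  proof (rule card_conjugates_ge[OF finite_G])
    fix g b assume g: "g \<in> carrier G" and b: "b \<in> ?B" "g \<otimes> b \<otimes> inv g \<in> ?B"
    then obtain i j where i: "i \<in> {1..<11}" "b = u [^] (i::nat) \<otimes> h"
      and j: "g \<otimes> b \<otimes> inv g = u [^] (j::nat) \<otimes> h" by auto
    \<comment> \<open>The 45th power removes \<open>h\<close> and keeps \<open>u\<close>, as 45 is divisible by 5 and is 1 modulo 11.\<close>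
    have h45: "h [^] (45::nat) = \<one>" using pow_mod[OF h(1,2), of 45] by simp
    have "(g \<otimes> b \<otimes> inv g) [^] (45::nat) = g \<otimes> b [^] (45::nat) \<otimes> inv g"
      using conj_pow[of b g 45] g i u h by simp
    then have e: "u [^] (j * 45) = g \<otimes> u [^] (i * 45) \<otimes> inv g"
      unfolding j using i pw h45 u by simp
    obtain k where k: "(u [^] (i * 45)) [^] (k::nat) = u"
      using pow_root[OF prime_11 u(1,2)] pow_eq_one_cong[OF prime_11 u] notdvd[OF i(1)] by blast
    have "g \<otimes> u \<otimes> inv g = (u [^] (j * 45)) [^] k"
      unfolding e using conj_pow[of "u [^] (i * 45)" g k] k g u by simp
    also have "\<dots> = u [^] (j * 45 * k)" using u by (simp add: nat_pow_pow)
    finally show "g \<in> ?N" using g by (auto simp: cyclic_normalizer_def)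
  qed (use u h in \<open>auto simp: cyclic_normalizer_def\<close>)
  moreover have "inj_on (\<lambda>i. u [^] i \<otimes> h) {1..<11::nat}"
    using pow_eq_cong[OF prime_11 u] u h by (auto simp: inj_on_def cong_def)
  then have "card ?B = 10" by (simp add: card_image)
  moreover have "?C \<subseteq> composite_elements G"
  proof
    fix c assume "c \<in> ?C"
    then obtain g i where g: "g \<in> carrier G" and i: "i \<in> {1..<11}"
      and c: "c = g \<otimes> (u [^] (i::nat) \<otimes> h) \<otimes> inv g" by auto
    have cp: "c [^] n = g \<otimes> (u [^] (i * n) \<otimes> h [^] n) \<otimes> inv g" for n :: nat
      unfolding c using conj_pow[of "u [^] i \<otimes> h" g n] pw g u h by simp
    have conj1: "x = \<one>" if "g \<otimes> x \<otimes> inv g = \<one>" "x \<in> carrier G" for x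
    proof -
      have "inv g \<otimes> (g \<otimes> x \<otimes> inv g) \<otimes> g = x" using g that(2) by (simp add: m_assoc)
      then show ?thesis using that(1) g by simp
    qed
    have h55: "h [^] (55::nat) = \<one>" using pow_mod[OF h(1,2), of 55] by simp
    have h11: "h [^] (11::nat) = h" using pow_mod[OF h(1,2), of 11] h(1) by simp
    have u55: "u [^] (i * 55) = \<one>" and u1: "u [^] (i * 11) = \<one>"
      using pow_eq_one_cong[OF prime_11 u] by simp_all
    have "c [^] (11 * 5 :: nat) = \<one>" using cp[of 55] g h55 u55 by simp
    moreover have "c [^] (11::nat) \<noteq> \<one>" using cp[of 11] conj1[of h] h h11 u1 by auto
    moreover have "c [^] (5::nat) \<noteq> \<one>"
    proof
      assume "c [^] (5::nat) = \<one>"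
      then have "u [^] (i * 5) = \<one>" using cp[of 5] conj1[of "u [^] (i * 5)"] h u by simp
      then have "11 dvd i * 5" using pow_eq_one_cong[OF prime_11 u] by blast
      then have "11 dvd i * 5 * 9" by (rule dvd_mult2)
      moreover have "i * 5 * 9 = i * 45" by simp
      ultimately show False using notdvd[OF i] by simp
    qed
    moreover have "c \<in> carrier G" unfolding c using g u h by simp
    ultimately show "c \<in> composite_elements G" by (intro composite_elementsI)
  qed
  then have "card ?C \<le> card (composite_elements G)"
    using card_mono[OF finite_composite] by blast
  ultimately show ?thesis using N order_G by simp
qed

section \<open>Generators for a group with few elements of composite order\<close>

text \<open>The situation in which \<open>N\<close> is not normal. The assumption \<open>t_moves\<close> says that \<open>N\<close> and its conjugate
  under \<open>t\<close> have no element of order 11 in common; it is the source of the decomposition of \<open>G\<close> into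
  \<open>N\<close> and the eleven cosets of \<open>u\<^sup>k t\<close>.\<close>

locale big_cell = order_660 +
  fixes N :: "'a set" and u t :: 'a
  assumes N_eq: "N = cyclic_normalizer G u" and card_N: "card N = 55"
    and u_G: "u \<in> carrier G" and u_11: "u [^] (11::nat) = \<one>" and u_ne: "u \<noteq> \<one>"
    and t_G: "t \<in> carrier G" and t_t: "t \<otimes> t = \<one>" and t_notin_N: "t \<notin> N"
    and t_moves: "\<And>k::nat. \<not> 11 dvd k \<Longrightarrow> t \<otimes> u [^] k \<otimes> t \<notin> N"
begin

lemma N_sub: "subgroup N G"
  unfolding N_eq using cyclic_normalizer_subgroup[OF finite_G u_G] .

lemma u_N: "u \<in> N"
  unfolding N_eq using u_G by (auto simp: cyclic_normalizer_def m_assoc intro!: exI[of _ 1])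

lemma N_G: "x \<in> N \<Longrightarrow> x \<in> carrier G"
  using N_sub subgroup.mem_carrier by metis

lemma upow_N: "u [^] (k::nat) \<in> N"
  using subgroup_pow_closed[OF N_sub u_N] .

lemmas N_m = subgroup.m_closed[OF N_sub]
lemmas N_inv = subgroup.m_inv_closed[OF N_sub]

lemma inv_t: "inv t = t"
  using t_t t_G inv_equality by blast

lemma t_t_left: "x \<in> carrier G \<Longrightarrow> t \<otimes> (t \<otimes> x) = x"
  using t_G t_t by (simp flip: m_assoc)

lemma conj_t_pow: "x \<in> carrier G \<Longrightarrow> (t \<otimes> x \<otimes> t) [^] (n::nat) = t \<otimes> x [^] n \<otimes> t"
  using conj_pow[OF _ t_G, of x n] inv_t by simp

lemma u_pow_eq: "u [^] (i::nat) = u [^] (j::nat) \<longleftrightarrow> [i = j] (mod 11)"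
  using pow_eq_cong[OF prime_11 u_G u_11 u_ne] .

lemma N_no_involution:
  assumes "x \<in> N" "x \<otimes> x = \<one>"
  shows "x = \<one>"
proof -
  have "x [^] (2::nat) = \<one>" using assms N_G by (simp add: numeral_2_eq_2)
  moreover have "x [^] (55::nat) = \<one>" using subgroup_pow_card[OF N_sub assms(1)] card_N by simp
  moreover have "coprime 2 (55::nat)" by simp
  ultimately show ?thesis using pow_coprime_trivial N_G[OF assms(1)] by blast
qed

lemma order_11_in_N:
  assumes "x \<in> N" "x [^] (11::nat) = \<one>"
  shows "\<exists>i::nat. x = u [^] i"
  using prime_order_in_cyclic_normalizer[OF finite_G prime_11 _ u_G u_11 u_ne, of x] assms
  by (auto simp: N_eq order_G)

lemma cell_inj:
  assumes "u [^] i \<otimes> t \<otimes> n = u [^] j \<otimes> t \<otimes> n'" "n \<in> N" "n' \<in> N"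
  shows "[i = j] (mod (11::nat))"
proof -
  have c: "n \<in> carrier G" "n' \<in> carrier G" using assms N_G by auto
  \<comment> \<open>Natural exponents: 10 times \<open>j\<close> stands for \<open>-j\<close>.\<close>
  define k where "k = i + (10 * j :: nat)"
  have "u [^] (10 * j) \<otimes> u [^] j = \<one>"
    using u_G u_11 nat_pow_pow[of u 11 j] by (simp add: nat_pow_mult)
  then have uj: "u [^] (10 * j) \<otimes> (u [^] j \<otimes> x) = x" if "x \<in> carrier G" for x
    using that u_G by (simp flip: m_assoc)
  have ij: "u [^] i \<otimes> (t \<otimes> n) = u [^] j \<otimes> (t \<otimes> n')"
    using assms(1) c u_G t_G by (simp add: m_assoc)
  have "u [^] k = u [^] (10 * j) \<otimes> u [^] i"
    using u_G by (simp add: k_def nat_pow_mult add.commute)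
  then have "t \<otimes> u [^] k \<otimes> t = t \<otimes> (u [^] (10 * j) \<otimes> (u [^] i \<otimes> (t \<otimes> n))) \<otimes> inv n"
    using c u_G t_G by (simp add: m_assoc)
  also have "\<dots> = n' \<otimes> inv n"
    unfolding ij using c u_G t_G uj[of "t \<otimes> n'"] t_t_left[of n'] by simp
  finally have "t \<otimes> u [^] k \<otimes> t = n' \<otimes> inv n" .
  then have "t \<otimes> u [^] k \<otimes> t \<in> N" using assms N_m N_inv by simp
  then have "11 dvd i + 10 * j" using t_moves unfolding k_def by blast
  then have "[i + 10 * j = 0] (mod 11)" by (simp add: cong_0_iff)
  then have "[i + 10 * j + j = 0 + j] (mod 11)" by (rule cong_add) (rule cong_refl)
  moreover have "i + 10 * j + j = i + 11 * j" by simp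
  ultimately show ?thesis by (simp add: cong_def)
qed

text \<open>The cosets named here are pairwise distinct and together contain \<open>55 + 11 \<cdot> 55 = 660\<close> elements.\<close>

lemma cells:
  assumes "g \<in> carrier G"
  shows "g \<in> N \<or> (\<exists>k<11::nat. \<exists>n\<in>N. g = u [^] k \<otimes> t \<otimes> n)"
proof -
  let ?f = "\<lambda>(k, n). u [^] k \<otimes> t \<otimes> n" and ?A = "{..<11::nat} \<times> N"
  have finN: "finite N" using N_G finite_G by (meson finite_subset subsetI)
  have "inj_on ?f ?A"
  proof (rule inj_onI)
    fix q q' assume q: "q \<in> ?A" "q' \<in> ?A" "?f q = ?f q'"
    obtain i n j n' where qq: "q = (i, n)" "q' = (j, n')" by (cases q, cases q')
    then have lt: "i < 11" "j < 11" "n \<in> N" "n' \<in> N"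
      and e: "u [^] i \<otimes> t \<otimes> n = u [^] j \<otimes> t \<otimes> n'" using q by auto
    have "i = j" using cell_inj[OF e lt(3,4)] lt by (simp add: cong_def)
    moreover from this have "n = n'" using e lt N_G u_G t_G by simp
    ultimately show "q = q'" by (simp add: qq)
  qed
  then have "card (?f ` ?A) = 605" by (simp add: card_image card_cartesian_product card_N)
  moreover have disj: "?f ` ?A \<inter> N = {}"
  proof -
    have False if k: "n \<in> N" "u [^] (k::nat) \<otimes> t \<otimes> n \<in> N" for k n
    proof -
      have "inv (u [^] k) \<otimes> (u [^] k \<otimes> t \<otimes> n) \<otimes> inv n \<in> N"
        by (intro N_m N_inv upow_N k)
      moreover have "inv (u [^] k) \<otimes> (u [^] k \<otimes> t \<otimes> n) \<otimes> inv n = t"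
        using N_G[OF k(1)] u_G t_G by (simp add: m_assoc)
      ultimately show False using t_notin_N by simp
    qed
    then have "?f q \<notin> N" if "q \<in> ?A" for q using that by (cases q) auto
    then show ?thesis by blast
  qed
  ultimately have "card (?f ` ?A \<union> N) = 660"
    using finN card_N by (subst card_Un_disjoint) auto
  moreover have sub: "?f ` ?A \<union> N \<subseteq> carrier G" using u_G t_G N_G by auto
  ultimately have "?f ` ?A \<union> N = carrier G"
    using card_subset_eq[OF finite_G] order_G by (simp add: order_def)
  then have "g \<in> ?f ` ?A \<or> g \<in> N" using assms by blast
  then show ?thesis by auto
qed

end


text \<open>If \<open>t u\<^sup>k t\<close> were in \<open>N\<close> it would be a power of \<open>u\<close>, as an element of order 11 of \<open>N\<close>. Then \<open>t\<close>
  would normalize the group generated by \<open>u\<close>, so that \<open>N\<close>, of order 55, would contain an involution.\<close>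

lemma (in order_660) exists_big_cell:
  assumes few: "card (composite_elements G) \<le> 110"
  obtains u t where "big_cell G (cyclic_normalizer G u) u t"
proof -
  obtain u where u: "u \<in> carrier G" "u \<noteq> \<one>" "u [^] (11::nat) = \<one>"
    using exists_prime_order[OF finite_G subgroup_self prime_11] order_G by (auto simp: order_def)
  let ?N = "cyclic_normalizer G u"
  have N: "subgroup ?N G" using cyclic_normalizer_subgroup[OF finite_G u(1)] .
  have "?N \<noteq> carrier G"
    using normal_sylow_11_composites[OF u(1,3,2)] few by linarith
  then have N55: "card ?N = 55" using sylow_11_normalizer_card[OF u(1,3,2)] by blast
  have uN: "u \<in> ?N" using u by (auto simp: cyclic_normalizer_def m_assoc intro!: exI[of _ 1])
  obtain t where t: "t \<in> carrier G" "t \<noteq> \<one>" "t [^] (2::nat) = \<one>"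
    using exists_prime_order[OF finite_G subgroup_self two_is_prime_nat] order_G by (auto simp: order_def)
  then have tt: "t \<otimes> t = \<one>" by (simp add: numeral_2_eq_2)
  then have invt: "inv t = t" using t(1) inv_equality by blast
  have tN: "t \<notin> ?N"
  proof
    assume "t \<in> ?N"
    then have "t [^] (55::nat) = \<one>" using subgroup_pow_card[OF N] N55 by metis
    moreover have "coprime 2 (55::nat)" by simp
    ultimately show False using pow_coprime_trivial[OF t(1,3)] t(2) by blast
  qed
  have moves: "t \<otimes> u [^] k \<otimes> t \<notin> ?N" if k: "\<not> 11 dvd k" for k :: nat
  proof
    assume in_N: "t \<otimes> u [^] k \<otimes> t \<in> ?N"
    have cp: "(t \<otimes> u [^] k \<otimes> t) [^] n = t \<otimes> (u [^] k) [^] n \<otimes> t" for n :: nat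
      using conj_pow[of "u [^] k" t n] u t invt by simp
    have "(u [^] k) [^] (11::nat) = \<one>"
      using u pow_eq_one_cong[OF prime_11 u(1,3,2), of "k * 11"] by (simp add: nat_pow_pow)
    then have "(t \<otimes> u [^] k \<otimes> t) [^] (11::nat) = \<one>" using cp t tt by simp
    then have "t \<otimes> u [^] k \<otimes> t \<in> range (\<lambda>i::nat. u [^] i)"
      using prime_order_in_cyclic_normalizer[OF finite_G prime_11 _ u(1,3,2) in_N] by (simp add: order_G)
    then obtain i where i: "t \<otimes> u [^] k \<otimes> t = u [^] (i::nat)" by auto
    obtain j where j: "(u [^] k) [^] (j::nat) = u"
      using pow_root[OF prime_11 u(1,3)] pow_eq_one_cong[OF prime_11 u(1,3,2)] k by blast
    have "t \<otimes> u \<otimes> inv t = u [^] (i * j)"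
      using cp[of j] u unfolding i j invt by (simp add: nat_pow_pow)
    then show False using tN t by (auto simp: cyclic_normalizer_def)
  qed
  have "big_cell G ?N u t"
    by (intro big_cell.intro big_cell_axioms.intro order_660_axioms)
      (use N55 u t tt tN moves in auto)
  then show ?thesis using that by blast
qed

context big_cell begin

text \<open>The products \<open>a t b\<close> with \<open>a, b\<close> in \<open>N\<close> cannot all be distinct, because \<open>55\<^sup>2 > 660\<close>. Two equal ones
  give \<open>x \<noteq> \<one>\<close> in \<open>N\<close> with \<open>t x t\<close> in \<open>N\<close>, and \<open>x\<close> has order 5 because of \<open>t_moves\<close>.\<close>

lemma exists_common_stabilizer_element:
  "\<exists>h\<in>N. h [^] (5::nat) = \<one> \<and> h \<noteq> \<one> \<and> t \<otimes> h \<otimes> t \<in> N"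
proof -
  let ?f = "\<lambda>(a, b). a \<otimes> t \<otimes> b"
  have "\<not> inj_on ?f (N \<times> N)"
  proof
    assume "inj_on ?f (N \<times> N)"
    then have "card (N \<times> N) \<le> card (carrier G)"
      using N_G t_G by (intro card_inj_on_le[OF _ _ finite_G]) auto
    then show False using order_G by (simp add: card_cartesian_product card_N order_def)
  qed
  then obtain a b a' b' where ab: "a \<in> N" "b \<in> N" "a' \<in> N" "b' \<in> N"
    and e: "a \<otimes> t \<otimes> b = a' \<otimes> t \<otimes> b'" and ne: "(a, b) \<noteq> (a', b')"
    by (auto simp: inj_on_def)
  have c: "a \<in> carrier G" "b \<in> carrier G" "a' \<in> carrier G" "b' \<in> carrier G"
    using ab N_G by auto
  define x where "x = inv a' \<otimes> a"
  have x: "x \<in> N" unfolding x_def using ab by (intro N_m N_inv)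
  have xG: "x \<in> carrier G" using x N_G by blast
  have e': "a \<otimes> (t \<otimes> b) = a' \<otimes> (t \<otimes> b')" using e c t_G by (simp add: m_assoc)
  have "t \<otimes> x \<otimes> t = t \<otimes> (inv a' \<otimes> (a \<otimes> (t \<otimes> b))) \<otimes> inv b"
    unfolding x_def using c t_G by (simp add: m_assoc)
  also have "\<dots> = b' \<otimes> inv b"
    unfolding e' using c t_G by (simp add: m_assoc t_t_left)
  finally have conj_x: "t \<otimes> x \<otimes> t = b' \<otimes> inv b" .
  then have conj_x_N: "t \<otimes> x \<otimes> t \<in> N" using ab N_m N_inv by simp
  have x1: "x \<noteq> \<one>"
  proof
    assume "x = \<one>"
    then have "a' \<otimes> (inv a' \<otimes> a) = a'" unfolding x_def using c by simp
    then have "a = a'" using c by simp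
    moreover from this have "b = b'" using e c t_G by simp
    ultimately show False using ne by simp
  qed
  have "x [^] (5::nat) = \<one>"
  proof (rule ccontr)
    assume x5: "x [^] (5::nat) \<noteq> \<one>"
    have "(x [^] (5::nat)) [^] (11::nat) = \<one>"
      using subgroup_pow_card[OF N_sub x] card_N xG by (simp add: nat_pow_pow)
    moreover have "x [^] (5::nat) \<in> N" using subgroup_pow_closed[OF N_sub x] .
    ultimately obtain i where i: "x [^] (5::nat) = u [^] (i::nat)"
      using order_11_in_N by blast
    then have "\<not> 11 dvd i" using x5 pow_eq_one_cong[OF prime_11 u_G u_11 u_ne] by simp
    then have "t \<otimes> x [^] (5::nat) \<otimes> t \<notin> N" unfolding i by (rule t_moves)
    then show False using subgroup_pow_closed[OF N_sub conj_x_N, of 5] conj_t_pow[OF xG, of 5] by simp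
  qed
  then show ?thesis using x x1 conj_x_N by blast
qed

lemma powers_fill:
  assumes "h \<in> N" "h [^] (5::nat) = \<one>" "h \<noteq> \<one>" "g \<in> N"
  obtains i j where "i < 11" "j < 5" "g = u [^] (i::nat) \<otimes> h [^] (j::nat)"
proof -
  have "g \<in> (\<lambda>(i, j). u [^] i \<otimes> h [^] j) ` ({..<11::nat} \<times> {..<5::nat})"
    using powers_11_5_fill[OF N_sub card_N u_N u_11 u_ne assms(1-3)] assms(4) by blast
  then show ?thesis using that by auto
qed

text \<open>Write \<open>t h t = u\<^sup>a h\<^sup>b\<close>. Then \<open>t u\<^sup>a t\<close> lies in \<open>N\<close>, so \<open>u\<^sup>a = \<one>\<close>; and since \<open>t\<close> is an involution,
  \<open>b\<^sup>2 \<equiv> 1\<close> modulo 5.\<close>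

lemma conj_t_power:
  assumes h: "h \<in> N" "h [^] (5::nat) = \<one>" "h \<noteq> \<one>" and tht: "t \<otimes> h \<otimes> t \<in> N"
  shows "t \<otimes> h \<otimes> t = h \<or> t \<otimes> h \<otimes> t = inv h"
proof -
  have hG: "h \<in> carrier G" using h N_G by blast
  obtain a b where b: "b < 5" and ab: "t \<otimes> h \<otimes> t = u [^] (a::nat) \<otimes> h [^] (b::nat)"
    using powers_fill[OF h tht] by blast
  have "u [^] a = t \<otimes> h \<otimes> t \<otimes> inv (h [^] b)"
    unfolding ab using hG u_G by (simp add: m_assoc)
  then have "t \<otimes> u [^] a \<otimes> t = h \<otimes> (t \<otimes> inv (h [^] b) \<otimes> t)"
    using hG t_G t_t_left by (simp add: m_assoc)
  also have "t \<otimes> inv (h [^] b) \<otimes> t = inv (t \<otimes> h [^] b \<otimes> t)"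
    using hG t_G inv_t by (simp add: inv_mult_group m_assoc)
  also have "t \<otimes> h [^] b \<otimes> t = (t \<otimes> h \<otimes> t) [^] b"
    using conj_t_pow[OF hG] by simp
  finally have "t \<otimes> u [^] a \<otimes> t \<in> N"
    using N_m[OF h(1) N_inv[OF subgroup_pow_closed[OF N_sub tht]]] by simp
  then have "u [^] a = \<one>"
    using t_moves pow_eq_one_cong[OF prime_11 u_G u_11 u_ne] by blast
  then have hb: "t \<otimes> h \<otimes> t = h [^] b" using ab hG by simp
  have "h = t \<otimes> (t \<otimes> h \<otimes> t) \<otimes> t" using hG t_G t_t t_t_left by (simp add: m_assoc)
  also have "\<dots> = t \<otimes> h [^] b \<otimes> t" by (simp only: hb)
  also have "\<dots> = (t \<otimes> h \<otimes> t) [^] b" using conj_t_pow[OF hG] by simp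
  also have "\<dots> = h [^] (b * b)" unfolding hb using hG by (simp add: nat_pow_pow)
  finally have "h [^] (b * b) = h [^] (1::nat)" using hG by simp
  then have "[b * b = 1] (mod 5)" using pow_eq_cong[OF prime_5 hG h(2,3)] by blast
  moreover have "b = 0 \<or> b = 1 \<or> b = 2 \<or> b = 3 \<or> b = 4" using b by auto
  ultimately have "b = 1 \<or> b = 4" by (auto simp: cong_def)
  moreover have "h [^] (4::nat) = inv h"
  proof -
    have "h [^] (4::nat) \<otimes> h = \<one>" using h(2) nat_pow_Suc[of h 4] by simp
    then show ?thesis using hG inv_equality by (metis nat_pow_closed)
  qed
  ultimately show ?thesis using hb hG by auto
qed

lemma commutes_with_all_powers:
  assumes "h \<in> carrier G" "\<not> 11 dvd a" "u [^] (a::nat) \<otimes> h = h \<otimes> u [^] a"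
  shows "h \<otimes> u = u \<otimes> h"
proof -
  obtain j where "(u [^] a) [^] (j::nat) = u"
    using pow_root[OF prime_11 u_G u_11] pow_eq_one_cong[OF prime_11 u_G u_11 u_ne] assms(2) by blast
  then show ?thesis
    using group_commutes_pow[OF assms(3) _ assms(1), of j] u_G by simp
qed

text \<open>Only powers of \<open>h\<close> normalize the group \<open>H\<close> generated by \<open>h\<close> inside \<open>N\<close>. An element
  \<open>u\<^sup>k t n\<close> outside \<open>N\<close> that normalizes \<open>H\<close> must have \<open>u\<^sup>k = \<one>\<close>, because \<open>h\<close> fixes only two cosets of
  \<open>N\<close>, and it then equals \<open>t\<close> times a power of \<open>h\<close>.\<close>

lemma card_cyclic_normalizer_le_10:
  assumes h: "h \<in> N" "h [^] (5::nat) = \<one>" "h \<noteq> \<one>"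
    and not_comm: "h \<otimes> u \<noteq> u \<otimes> h" and tht: "t \<otimes> h \<otimes> t = h"
  shows "card (cyclic_normalizer G h) \<le> 10"
proof -
  have hG: "h \<in> carrier G" using h N_G by blast
  let ?M = "cyclic_normalizer G h"
  have H: "subgroup (range (\<lambda>i::nat. h [^] i)) G" "card (range (\<lambda>i::nat. h [^] i)) = 5"
    using powers_subgroup[OF prime_5 hG h(2,3)] by auto
  have M: "subgroup ?M G" using cyclic_normalizer_subgroup[OF finite_G hG] .
  have tM: "t \<in> ?M" using tht t_G inv_t hG by (auto simp: cyclic_normalizer_def intro!: exI[of _ 1])
  have MN: "g \<in> range (\<lambda>i::nat. h [^] i)" if g: "g \<in> ?M" "g \<in> N" for g
  proof -
    obtain a b where ab: "g = u [^] (a::nat) \<otimes> h [^] (b::nat)" using powers_fill[OF h g(2)] by blast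
    obtain k where k: "g \<otimes> h \<otimes> inv g = h [^] (k::nat)" using g by (auto simp: cyclic_normalizer_def)
    have "u [^] a \<otimes> h \<otimes> inv (u [^] a) = g \<otimes> h \<otimes> inv g"
      unfolding ab using hG u_G group_commutes_pow[of h h b]
      by (simp add: m_assoc inv_mult_group)
    then have e: "u [^] a \<otimes> h \<otimes> inv (u [^] a) \<otimes> inv h = h [^] k \<otimes> inv h" using k by simp
    obtain r where r: "h \<otimes> u \<otimes> inv h = u [^] (r::nat)"
      using h(1) unfolding N_eq by (auto simp: cyclic_normalizer_def)
    define w where "w = h [^] k \<otimes> inv h"
    have "h \<otimes> inv (u [^] a) \<otimes> inv h = inv (h \<otimes> u [^] a \<otimes> inv h)"
      using hG u_G by (simp add: inv_mult_group m_assoc)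
    also have "\<dots> = inv (u [^] (r * a))"
      using conj_pow[OF u_G hG, of a] r u_G by (simp add: nat_pow_pow)
    finally have "w = u [^] a \<otimes> inv (u [^] (r * a))"
      unfolding w_def e[symmetric] using hG u_G by (simp add: m_assoc)
    then have "w \<in> range (\<lambda>i::nat. u [^] i)"
      using powers_subgroup(1)[OF prime_11 u_G u_11 u_ne]
      by (auto intro!: subgroup.m_closed subgroup.m_inv_closed)
    then have w11: "w [^] (11::nat) = \<one>"
      using subgroup_pow_card[OF powers_subgroup(1)[OF prime_11 u_G u_11 u_ne]]
        powers_subgroup(2)[OF prime_11 u_G u_11 u_ne] by metis
    have "w \<in> range (\<lambda>i::nat. h [^] i)"
      unfolding w_def using H(1) hG
      by (intro subgroup.m_closed subgroup.m_inv_closed) (auto intro: range_eqI[of _ _ "1::nat"])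
    then have w5: "w [^] (5::nat) = \<one>" using subgroup_pow_card[OF H(1)] H(2) by metis
    have "coprime 11 (5::nat)" using prime_imp_coprime[OF prime_11, of 5] by simp
    then have "w = \<one>" using pow_coprime_trivial[OF _ w11 w5] hG by (simp add: w_def)
    then have "u [^] a \<otimes> h \<otimes> inv (u [^] a) \<otimes> inv h \<otimes> h \<otimes> u [^] a = h \<otimes> u [^] a"
      using e hG u_G by (simp add: w_def)
    then have "u [^] a \<otimes> h = h \<otimes> u [^] a" using hG u_G by (simp add: m_assoc)
    then have "11 dvd a" using commutes_with_all_powers[OF hG] not_comm by blast
    then have "u [^] a = \<one>" using pow_eq_one_cong[OF prime_11 u_G u_11 u_ne] by simp
    then show ?thesis using ab hG by simp
  qed
  have M_sub: "?M \<subseteq> range (\<lambda>i::nat. h [^] i) \<union> (\<lambda>x. t \<otimes> x) ` range (\<lambda>i::nat. h [^] i)"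
  proof
    fix g assume g: "g \<in> ?M"
    then have gG: "g \<in> carrier G" by (simp add: cyclic_normalizer_def)
    consider "g \<in> N" | k n where "n \<in> N" "g = u [^] (k::nat) \<otimes> t \<otimes> n"
      using cells[OF gG] by blast
    then show "g \<in> range (\<lambda>i::nat. h [^] i) \<union> (\<lambda>x. t \<otimes> x) ` range (\<lambda>i::nat. h [^] i)"
    proof cases
      case 1
      then show ?thesis using MN[OF g] by blast
    next
      case 2
      have nG: "n \<in> carrier G" using 2 N_G by blast
      have "inv g \<in> ?M" using subgroup.m_inv_closed[OF M g] .
      then obtain j where j: "inv g \<otimes> h \<otimes> g = h [^] (j::nat)"
        using gG by (auto simp: cyclic_normalizer_def)
      obtain r where r: "inv h \<otimes> u \<otimes> h = u [^] (r::nat)"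
        using N_inv[OF h(1)] hG unfolding N_eq by (auto simp: cyclic_normalizer_def)
      have "t \<otimes> (inv (u [^] k) \<otimes> h \<otimes> u [^] k) \<otimes> t = n \<otimes> (inv g \<otimes> h \<otimes> g) \<otimes> inv n"
        unfolding 2(2) using nG hG u_G t_G inv_t by (simp add: inv_mult_group m_assoc)
      also have "\<dots> \<in> N"
        unfolding j by (intro N_m N_inv 2 subgroup_pow_closed[OF N_sub] h)
      finally have in_N: "t \<otimes> (inv (u [^] k) \<otimes> h \<otimes> u [^] k) \<otimes> t \<in> N" .
      define w where "w = inv (u [^] (r * k)) \<otimes> u [^] k"
      have wG: "w \<in> carrier G" unfolding w_def using u_G by simp
      have "inv h \<otimes> u [^] k \<otimes> h = u [^] (r * k)"
        using conj_pow[OF u_G inv_closed[OF hG], of k] r hG u_G by (simp add: nat_pow_pow)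
      then have "w = inv (inv h \<otimes> u [^] k \<otimes> h) \<otimes> u [^] k" by (simp add: w_def)
      then have hw: "h \<otimes> w = inv (u [^] k) \<otimes> h \<otimes> u [^] k"
        using hG u_G by (simp add: m_assoc inv_mult_group)
      have "w \<in> range (\<lambda>i::nat. u [^] i)"
        unfolding w_def using powers_subgroup(1)[OF prime_11 u_G u_11 u_ne]
        by (intro subgroup.m_closed subgroup.m_inv_closed) auto
      then obtain c where c: "w = u [^] (c::nat)" by auto
      have "t \<otimes> w \<otimes> t = inv (t \<otimes> h \<otimes> t) \<otimes> (t \<otimes> (h \<otimes> w) \<otimes> t)"
        using hG wG t_G inv_t by (simp add: inv_mult_group m_assoc t_t_left)
      also have "\<dots> \<in> N"
        unfolding tht hw by (rule N_m[OF N_inv[OF h(1)] in_N])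
      finally have "w = \<one>"
        using t_moves[of c] pow_eq_one_cong[OF prime_11 u_G u_11 u_ne] unfolding c by blast
      then have "u [^] k \<otimes> h = u [^] k \<otimes> (inv (u [^] k) \<otimes> h \<otimes> u [^] k)"
        using hw hG by simp
      then have "u [^] k \<otimes> h = h \<otimes> u [^] k" using hG u_G by (simp add: m_assoc)
      then have "11 dvd k" using commutes_with_all_powers[OF hG] not_comm by blast
      then have "u [^] k = \<one>" using pow_eq_one_cong[OF prime_11 u_G u_11 u_ne] by simp
      then have gtn: "g = t \<otimes> n" using 2 t_G nG by simp
      then have "n = t \<otimes> g" using t_G nG t_t_left by simp
      then have "n \<in> ?M" using subgroup.m_closed[OF M tM g] by simp
      then show ?thesis using MN[OF _ 2(1)] gtn by blast
    qed
  qed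
  show ?thesis
  proof -
    have "card ?M \<le> card (range (\<lambda>i::nat. h [^] i) \<union> (\<lambda>x. t \<otimes> x) ` range (\<lambda>i::nat. h [^] i))"
      using M_sub H(2) by (intro card_mono) (auto simp: card_ge_0_finite intro!: finite_imageI)
    also have "\<dots> \<le> 5 + card ((\<lambda>x. t \<otimes> x) ` range (\<lambda>i::nat. h [^] i))"
      using card_Un_le H(2) by metis
    also have "\<dots> \<le> 5 + 5"
      using card_image_le[of "range (\<lambda>i::nat. h [^] i)" "\<lambda>x. t \<otimes> x"] H(2)
      by (simp add: card_ge_0_finite)
    finally show ?thesis by simp
  qed
qed

text \<open>The four elements \<open>t h\<^sup>i\<close> have order 10, and their sixth powers are the \<open>h\<^sup>i\<close>. So whoever conjugates
  one of them to another one normalizes the group generated by \<open>h\<close>, which leaves at least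
  \<open>660 \<cdot> 4 / 10 = 264\<close> conjugates.\<close>

lemma order_10_composites:
  assumes h: "h \<in> N" "h [^] (5::nat) = \<one>" "h \<noteq> \<one>"
    and not_comm: "h \<otimes> u \<noteq> u \<otimes> h" and tht: "t \<otimes> h \<otimes> t = h"
  shows "card (composite_elements G) > 110"
proof -
  have hG: "h \<in> carrier G" using h N_G by blast
  let ?M = "cyclic_normalizer G h"
  let ?B = "(\<lambda>i. t \<otimes> h [^] i) ` {1..<5::nat}"
  let ?C = "(\<lambda>(g, b). g \<otimes> b \<otimes> inv g) ` (carrier G \<times> ?B)"
  have th: "t \<otimes> h = h \<otimes> t"
  proof -
    have "t \<otimes> (t \<otimes> h \<otimes> t) = h \<otimes> t" using hG t_G by (simp add: m_assoc t_t_left)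
    then show ?thesis using tht by simp
  qed
  have pw: "(t \<otimes> h [^] i) [^] n = t [^] n \<otimes> h [^] (i * n)" for i n :: nat
    using pow_mult_distrib[of t "h [^] i" n] group_commutes_pow[of h t i] th hG t_G
    by (simp add: nat_pow_pow)
  have t2: "t [^] (2::nat) = \<one>" using t_t t_G by (simp add: numeral_2_eq_2)
  have cardM: "card ?M \<le> 10" using card_cyclic_normalizer_le_10[OF assms] .
  have hpow: "h [^] i = h [^] j \<longleftrightarrow> [i = j] (mod 5)" for i j :: nat
    using pow_eq_cong[OF prime_5 hG h(2,3)] .
  have h1: "h [^] i = \<one> \<longleftrightarrow> 5 dvd i" for i :: nat
    using pow_eq_one_cong[OF prime_5 hG h(2,3)] .
  have "order G * card ?B \<le> card ?M * card ?C"
  proof (rule card_conjugates_ge[OF finite_G])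
    fix g b assume g: "g \<in> carrier G" and b: "b \<in> ?B" "g \<otimes> b \<otimes> inv g \<in> ?B"
    then obtain i j where i: "i \<in> {1..<5}" "b = t \<otimes> h [^] (i::nat)"
      and j: "g \<otimes> b \<otimes> inv g = t \<otimes> h [^] (j::nat)" by auto
    \<comment> \<open>The sixth power removes \<open>t\<close> and keeps \<open>h\<close>.\<close>
    have t6: "t [^] (6::nat) = \<one>" using nat_pow_pow[OF t_G, of 2 3] t2 by simp
    have h6: "h [^] (m * 6) = h [^] m" for m :: nat
    proof -
      have "(m + 5 * m) mod 5 = m mod 5" by (rule mod_mult_self2)
      then show ?thesis unfolding hpow cong_def by (simp add: mult.commute)
    qed
    have b6: "(t \<otimes> h [^] m) [^] (6::nat) = h [^] m" for m :: nat
      unfolding pw t6 h6 using hG by simp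
    have "(g \<otimes> b \<otimes> inv g) [^] (6::nat) = g \<otimes> b [^] (6::nat) \<otimes> inv g"
      using conj_pow[of b g 6] g i t_G hG by simp
    then have e: "h [^] j = g \<otimes> h [^] i \<otimes> inv g"
      by (simp only: j) (simp only: i(2) b6)
    have "\<not> 5 dvd i" using i(1) by (auto dest: dvd_imp_le)
    then obtain k where k: "(h [^] i) [^] (k::nat) = h"
      using pow_root[OF prime_5 hG h(2)] h1 by blast
    have "g \<otimes> h \<otimes> inv g = (h [^] j) [^] k"
      unfolding e using conj_pow[of "h [^] i" g k] k g hG by simp
    also have "\<dots> = h [^] (j * k)" using hG by (simp add: nat_pow_pow)
    finally show "g \<in> ?M" using g by (auto simp: cyclic_normalizer_def)
  qed (use hG t_G in \<open>auto simp: cyclic_normalizer_def\<close>)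
  moreover have "inj_on (\<lambda>i. t \<otimes> h [^] i) {1..<5::nat}"
    using hpow t_G hG by (auto simp: inj_on_def cong_def)
  then have "card ?B = 4" by (simp add: card_image)
  ultimately have "2640 \<le> card ?M * card ?C" using order_G by simp
  also have "\<dots> \<le> 10 * card ?C" using cardM by simp
  also have "card ?C \<le> card (composite_elements G)"
  proof (rule card_mono[OF finite_composite], rule subsetI)
    fix c assume "c \<in> ?C"
    then obtain g i where g: "g \<in> carrier G" and i: "i \<in> {1..<5}"
      and c: "c = g \<otimes> (t \<otimes> h [^] (i::nat)) \<otimes> inv g" by auto
    have cp: "c [^] n = g \<otimes> (t [^] n \<otimes> h [^] (i * n)) \<otimes> inv g" for n :: nat
      unfolding c using conj_pow[of "t \<otimes> h [^] i" g n] pw g hG t_G by simp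
    have conj1: "x = \<one>" if "g \<otimes> x \<otimes> inv g = \<one>" "x \<in> carrier G" for x
    proof -
      have "inv g \<otimes> (g \<otimes> x \<otimes> inv g) \<otimes> g = x" using g that(2) by (simp add: m_assoc)
      then show ?thesis using that(1) g by simp
    qed
    have t5: "t [^] (5::nat) = t" and t10: "t [^] (10::nat) = \<one>"
      using pow_mod[OF t_G t2, of 5] pow_mod[OF t_G t2, of 10] t_G by simp_all
    have "h [^] (i * 5) = \<one>" "h [^] (i * 10) = \<one>" by (simp_all add: h1)
    then have "c [^] (2 * 5 :: nat) = \<one>" "c [^] (5::nat) = g \<otimes> t \<otimes> inv g"
      using cp[of 10] cp[of 5] g t_G t5 t10 by simp_all
    moreover have "t \<noteq> \<one>" using t_notin_N subgroup.one_closed[OF N_sub] by blast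
    then have "g \<otimes> t \<otimes> inv g \<noteq> \<one>" using conj1 t_G by blast
    moreover have "h [^] (i * 2) \<noteq> \<one>"
    proof -
      have "i = 1 \<or> i = 2 \<or> i = 3 \<or> i = 4" using i by auto
      then show ?thesis unfolding h1 by auto
    qed
    then have "c [^] (2::nat) \<noteq> \<one>" using cp[of 2] t2 conj1[of "h [^] (i * 2)"] hG by auto
    moreover have "c \<in> carrier G" unfolding c using g hG t_G by simp
    ultimately show "c \<in> composite_elements G" by (intro composite_elementsI[of _ 2 5]) simp_all
  qed
  finally show ?thesis by simp
qed

text \<open>The exponent \<open>r\<close> by which \<open>h\<close> acts on \<open>u\<close> has order 5 modulo 11, as does 3; so 3 is a power of \<open>r\<close>.\<close>

lemma exists_power_acting_by_3:
  assumes h: "h \<in> N" "h [^] (5::nat) = \<one>" "h \<noteq> \<one>" and not_comm: "h \<otimes> u \<noteq> u \<otimes> h"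
  shows "\<exists>j::nat. h [^] j \<otimes> u = u [^] (3::nat) \<otimes> h [^] j"
proof -
  have hG: "h \<in> carrier G" using h N_G by blast
  obtain r where r: "h \<otimes> u \<otimes> inv h = u [^] (r::nat)"
    using h(1) unfolding N_eq by (auto simp: cyclic_normalizer_def)
  have "u [^] (r ^ 5) = u [^] (1::nat)"
    using iterated_conj[OF u_G hG r, of 5] h(2) u_G by simp
  then have "[r ^ 5 = 1] (mod 11)" unfolding u_pow_eq .
  then have r5: "(r mod 11) ^ 5 mod 11 = 1" by (simp add: cong_def power_mod)
  have "r mod 11 \<noteq> 1"
  proof
    assume "r mod 11 = 1"
    then have "u [^] r = u [^] (1::nat)" unfolding u_pow_eq by (simp add: cong_def)
    then have "h \<otimes> u \<otimes> inv h \<otimes> h = u \<otimes> h" using r u_G by simp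
    then show False using not_comm hG u_G by (simp add: m_assoc)
  qed
  moreover have "s = 0 \<or> s = 1 \<or> s = 2 \<or> s = 3 \<or> s = 4 \<or> s = 5 \<or> s = 6 \<or> s = 7 \<or> s = 8 \<or> s = 9 \<or> s = 10"
    if "s < 11" for s :: nat using that by presburger
  from this[of "r mod 11"] have "r mod 11 = 0 \<or> r mod 11 = 1 \<or> r mod 11 = 2 \<or> r mod 11 = 3 \<or> r mod 11 = 4
      \<or> r mod 11 = 5 \<or> r mod 11 = 6 \<or> r mod 11 = 7 \<or> r mod 11 = 8 \<or> r mod 11 = 9 \<or> r mod 11 = 10"
    by simp
  ultimately have "r mod 11 = 3 \<or> r mod 11 = 4 \<or> r mod 11 = 5 \<or> r mod 11 = 9"
    using r5 by auto
  then have "\<exists>j::nat. (r mod 11) ^ j mod 11 = 3"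
    by (elim disjE) (rule exI[of _ 1], simp, rule exI[of _ 4], simp, rule exI[of _ 2], simp, rule exI[of _ 3], simp)
  then obtain j where "(r mod 11) ^ j mod 11 = 3" by blast
  then have "[r ^ j = 3] (mod 11)" by (simp add: cong_def power_mod)
  then have "u [^] (r ^ j) = u [^] (3::nat)" unfolding u_pow_eq .
  then have "h [^] j \<otimes> u \<otimes> inv (h [^] j) = u [^] (3::nat)"
    using iterated_conj[OF u_G hG r, of j] by simp
  then have "h [^] j \<otimes> u \<otimes> inv (h [^] j) \<otimes> h [^] j = u [^] (3::nat) \<otimes> h [^] j" by simp
  then show ?thesis using hG u_G by (auto simp: m_assoc)
qed

end

text \<open>In the action on the cosets of \<open>N\<close>, the element \<open>h\<close> fixes infinity and 0 and multiplies the other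
  points by 3, a generator of the group of squares modulo 11.\<close>

locale torus_triple = big_cell +
  fixes h :: 'a
  assumes h_N: "h \<in> N" and h_5: "h [^] (5::nat) = \<one>" and h_ne: "h \<noteq> \<one>"
    and h_u: "h \<otimes> u = u [^] (3::nat) \<otimes> h" and t_h: "t \<otimes> h = inv h \<otimes> t"
begin

lemma h_G: "h \<in> carrier G"
  using h_N N_G by blast

lemma hpow_N: "h [^] (i::nat) \<in> N"
  using subgroup_pow_closed[OF N_sub h_N] .

lemma hpow_eq: "h [^] (i::nat) = h [^] (j::nat) \<longleftrightarrow> [i = j] (mod 5)"
  using pow_eq_cong[OF prime_5 h_G h_5 h_ne] .

lemma hpow_upow: "h [^] (i::nat) \<otimes> u [^] (k::nat) = u [^] (3 ^ i * k) \<otimes> h [^] i"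
proof -
  have "h \<otimes> u \<otimes> inv h = u [^] (3::nat)" using h_u h_G u_G by (simp add: m_assoc)
  then have "h [^] i \<otimes> u \<otimes> inv (h [^] i) = u [^] ((3::nat) ^ i)"
    using iterated_conj[OF u_G h_G] by blast
  then have "h [^] i \<otimes> u [^] k \<otimes> inv (h [^] i) = u [^] (3 ^ i * k)"
    using conj_pow[OF u_G, of "h [^] i" k] h_G u_G by (simp add: nat_pow_pow)
  then have "h [^] i \<otimes> u [^] k \<otimes> inv (h [^] i) \<otimes> h [^] i = u [^] (3 ^ i * k) \<otimes> h [^] i" by simp
  then show ?thesis using h_G u_G by (simp add: m_assoc)
qed

lemma t_hpow: "t \<otimes> h [^] (i::nat) = h [^] (4 * i) \<otimes> t"
proof (induction i)
  case (Suc i)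
  have "h [^] (4::nat) \<otimes> h = \<one>" using h_5 nat_pow_Suc[of h 4] by simp
  then have h4: "inv h = h [^] (4::nat)" using h_G inv_equality by simp
  have "t \<otimes> h [^] Suc i = h [^] (4 * i) \<otimes> (t \<otimes> h)"
    using Suc h_G t_G by (simp flip: m_assoc)
  also have "\<dots> = h [^] (4 * i) \<otimes> h [^] (4::nat) \<otimes> t"
    unfolding t_h h4 using h_G t_G by (simp add: m_assoc)
  also have "\<dots> = h [^] (4 * Suc i) \<otimes> t" using h_G by (simp add: nat_pow_mult add.commute)
  finally show ?case .
qed (use t_G in simp)

text \<open>The exponent 16 arises as \<open>4 \<cdot> 4\<close>: moving a power of \<open>h\<close> past \<open>t\<close> multiplies its exponent by 4, which
  is \<open>-1\<close> modulo 5.\<close>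

lemma hpow_16: "h [^] (16 * i) = h [^] (i::nat)"
proof -
  have "(i + 5 * (3 * i)) mod 5 = i mod 5" by (rule mod_mult_self2)
  then show ?thesis unfolding hpow_eq cong_def by simp
qed

lemma absorb: "x \<in> carrier G \<Longrightarrow> n \<in> N \<Longrightarrow> (x \<otimes> n) <# N = x <# N"
  using l_coset_absorb[OF N_sub] by blast

lemma act: "x \<in> carrier G \<Longrightarrow> y \<in> carrier G \<Longrightarrow> x <# (y <# N) = (x \<otimes> y) <# N"
  using l_coset_assoc[OF subgroup.subset[OF N_sub]] by blast

lemma hpow_pt: "(h [^] (i::nat) \<otimes> (u [^] (k::nat) \<otimes> t)) <# N = (u [^] (3 ^ i * k) \<otimes> t) <# N"
proof -
  have "h [^] i \<otimes> (u [^] k \<otimes> t) = u [^] (3 ^ i * k) \<otimes> (h [^] (16 * i) \<otimes> t)"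
    unfolding hpow_16 using h_G u_G t_G hpow_upow by (simp flip: m_assoc)
  also have "h [^] (16 * i) \<otimes> t = t \<otimes> h [^] (4 * i)" using t_hpow[of "4 * i"] by simp
  finally have "h [^] i \<otimes> (u [^] k \<otimes> t) = u [^] (3 ^ i * k) \<otimes> t \<otimes> h [^] (4 * i)"
    using u_G t_G h_G by (simp add: m_assoc)
  then show ?thesis using absorb hpow_N u_G t_G by simp
qed

text \<open>Since \<open>t\<close> inverts \<open>h\<close>, multiplying a point by \<open>3\<^sup>m\<close> divides its image under \<open>t\<close> by \<open>3\<^sup>m\<close>, and the
  inverse of 3 modulo 11 is the residue of \<open>81 = 3\<^sup>4\<close>.\<close>

lemma t_pt_scale:
  assumes "(t \<otimes> u [^] (k::nat) \<otimes> t) <# N = (u [^] (c::nat) \<otimes> t) <# N"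
  shows "(t \<otimes> u [^] (3 ^ m * k) \<otimes> t) <# N = (u [^] (81 ^ m * c) \<otimes> t) <# N"
proof -
  have "(t \<otimes> u [^] (3 ^ m * k) \<otimes> t) <# N = (t \<otimes> u [^] (3 ^ m * k) \<otimes> t \<otimes> h [^] (4 * m)) <# N"
    using absorb hpow_N u_G t_G by simp
  also have "t \<otimes> u [^] (3 ^ m * k) \<otimes> t \<otimes> h [^] (4 * m) = t \<otimes> (u [^] (3 ^ m * k) \<otimes> h [^] m) \<otimes> t"
    using t_hpow[of "4 * m"] hpow_16[of m] u_G t_G h_G by (simp add: m_assoc)
  also have "\<dots> = t \<otimes> h [^] m \<otimes> u [^] k \<otimes> t"
    unfolding hpow_upow[symmetric] using u_G t_G h_G by (simp add: m_assoc)
  also have "\<dots> = h [^] (4 * m) \<otimes> (t \<otimes> u [^] k \<otimes> t)"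
    unfolding t_hpow using u_G t_G h_G by (simp add: m_assoc)
  also have "\<dots> <# N = (h [^] (4 * m) \<otimes> (u [^] c \<otimes> t)) <# N"
    using act[of "h [^] (4 * m)"] assms u_G t_G h_G by (metis m_closed nat_pow_closed)
  also have "\<dots> = (u [^] (81 ^ m * c) \<otimes> t) <# N"
    unfolding hpow_pt by (simp add: power_mult)
  finally show ?thesis .
qed

lemma no_fixed_point: "(t \<otimes> (u [^] (k::nat) \<otimes> t)) <# N \<noteq> (u [^] k \<otimes> t) <# N"
proof
  define x where "x = u [^] k \<otimes> t"
  have xG: "x \<in> carrier G" using u_G t_G by (simp add: x_def)
  assume "(t \<otimes> (u [^] k \<otimes> t)) <# N = (u [^] k \<otimes> t) <# N"
  then have "(t \<otimes> x) <# N = x <# N" by (simp only: x_def)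
  then have y: "inv x \<otimes> (t \<otimes> x) \<in> N" using l_coset_eq_iff[OF N_sub] xG t_G by simp
  have "inv x \<otimes> (t \<otimes> x) \<otimes> (inv x \<otimes> (t \<otimes> x)) = inv x \<otimes> (t \<otimes> (t \<otimes> x))"
    using xG t_G by (simp add: m_assoc)
  also have "\<dots> = \<one>" using xG t_t_left by simp
  finally have "inv x \<otimes> (t \<otimes> x) = \<one>" using N_no_involution[OF y] by blast
  then have "x \<otimes> (inv x \<otimes> (t \<otimes> x)) = x" using xG by simp
  then have "t \<otimes> x = x" using xG t_G by simp
  then have "t = \<one>" using xG t_G by simp
  then show False using t_notin_N subgroup.one_closed[OF N_sub] by simp
qed

text \<open>Let \<open>c\<close> be the image of the point 1 under \<open>t\<close>. If \<open>c\<close> is a square \<open>9\<^sup>m\<close>, then \<open>t\<close> maps \<open>3\<^sup>m\<close> to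
  \<open>9\<^sup>m / 3\<^sup>m\<close>, a fixed point. So \<open>c\<close> is a non-square, like \<open>10 = -1\<close>, and some power of \<open>h\<close> maps \<open>c\<close>
  to 10.\<close>

lemma exists_normalized:
  shows "\<exists>t'. torus_triple G N u t' h \<and> (t' \<otimes> u \<otimes> t') <# N = (u [^] (10::nat) \<otimes> t') <# N"
proof -
  have "t \<otimes> u \<otimes> t \<notin> N" using t_moves[of 1] u_G by simp
  then obtain c n where c: "c < 11" and n: "n \<in> N" and tut: "t \<otimes> u \<otimes> t = u [^] (c::nat) \<otimes> t \<otimes> n"
    using cells[of "t \<otimes> u \<otimes> t"] t_G u_G by auto
  then have cos: "(t \<otimes> u [^] (1::nat) \<otimes> t) <# N = (u [^] c \<otimes> t) <# N"
    using absorb u_G t_G by simp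
  have "c \<noteq> 0"
  proof
    assume "c = 0"
    then have "t \<otimes> (t \<otimes> u \<otimes> t) = t \<otimes> (t \<otimes> n)" using tut t_G n N_G by simp
    then have "u \<otimes> t = n" using t_G u_G n N_G by (simp add: m_assoc t_t_left)
    then have "inv u \<otimes> n = t" using t_G u_G by auto
    then show False using t_notin_N N_m[OF N_inv[OF u_N] n] by simp
  qed
  have False if "[81 ^ m * c = 3 ^ m] (mod 11)" for m
  proof -
    have "(t \<otimes> u [^] (3 ^ m * 1 :: nat) \<otimes> t) <# N = (u [^] (3 ^ m :: nat) \<otimes> t) <# N"
      using t_pt_scale[OF cos, of m] that u_pow_eq by metis
    then show False using no_fixed_point[of "3 ^ m"] t_G u_G by (simp add: m_assoc)
  qed
  note square = this
  have "c \<noteq> 1" "c \<noteq> 9" "c \<noteq> 4" "c \<noteq> 3" "c \<noteq> 5"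
    using square[of 0] square[of 1] square[of 2] square[of 3] square[of 4]
    by (auto simp: cong_def)
  moreover have "c = 0 \<or> c = 1 \<or> c = 2 \<or> c = 3 \<or> c = 4 \<or> c = 5 \<or> c = 6 \<or> c = 7 \<or> c = 8 \<or> c = 9 \<or> c = 10"
    using c by presburger
  ultimately have "c \<in> {2, 6, 7, 8, 10}" using \<open>c \<noteq> 0\<close> by auto
  then have "\<exists>i. [3 ^ i * c = 10] (mod 11)"
    by (elim insertE emptyE)
      (rule exI[of _ 3], simp add: cong_def, rule exI[of _ 2], simp add: cong_def, rule exI[of _ 1], simp add: cong_def,
        rule exI[of _ 4], simp add: cong_def, rule exI[of _ 0], simp add: cong_def)
  then obtain i where i: "[3 ^ i * c = 10] (mod 11)" by blast
  define t' where "t' = h [^] i \<otimes> t"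
  have t'G: "t' \<in> carrier G" unfolding t'_def using h_G t_G by simp
  have t'_eq: "t' = t \<otimes> h [^] (4 * i)"
    unfolding t'_def t_hpow using hpow_16[of i] by simp
  have h5: "h [^] (4 * i) \<otimes> h [^] i = \<one>" "h [^] i \<otimes> h [^] (4 * i) = \<one>"
    using pow_eq_one_cong[OF prime_5 h_G h_5 h_ne] h_G by (simp_all add: nat_pow_mult)
  have conj: "t' \<otimes> u [^] k \<otimes> t' = h [^] i \<otimes> (t \<otimes> u [^] k \<otimes> t) \<otimes> h [^] (4 * i)" for k :: nat
    by (subst (2) t'_eq) (use h_G t_G u_G in \<open>simp add: t'_def m_assoc\<close>)
  have "big_cell G N u t'"
  proof (intro big_cell.intro big_cell_axioms.intro order_660_axioms N_eq card_N u_G u_11 u_ne t'G)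
    have "t' \<otimes> t' = t \<otimes> (h [^] (4 * i) \<otimes> h [^] i) \<otimes> t"
      by (subst t'_eq) (use h_G t_G in \<open>simp add: t'_def m_assoc\<close>)
    then show "t' \<otimes> t' = \<one>" using h5 t_G t_t by simp
    show "t' \<notin> N"
    proof
      assume "t' \<in> N"
      then have "h [^] (4 * i) \<otimes> t' \<in> N" using N_m hpow_N by blast
      moreover have "h [^] (4 * i) \<otimes> t' = t"
        unfolding t'_def using h5 h_G t_G by (simp flip: m_assoc)
      ultimately show False using t_notin_N by simp
    qed
    show "t' \<otimes> u [^] k \<otimes> t' \<notin> N" if "\<not> 11 dvd k" for k :: nat
    proof
      assume "t' \<otimes> u [^] k \<otimes> t' \<in> N"
      then have "h [^] (4 * i) \<otimes> (t' \<otimes> u [^] k \<otimes> t') \<otimes> h [^] i \<in> N" using N_m hpow_N by blast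
      moreover have "h [^] (4 * i) \<otimes> (t' \<otimes> u [^] k \<otimes> t') \<otimes> h [^] i
          = (h [^] (4 * i) \<otimes> h [^] i) \<otimes> (t \<otimes> u [^] k \<otimes> t) \<otimes> (h [^] (4 * i) \<otimes> h [^] i)"
        unfolding conj using h_G t_G u_G by (simp add: m_assoc)
      ultimately show False using t_moves[OF that] h5 t_G u_G by simp
    qed
  qed
  moreover have "t' \<otimes> h = inv h \<otimes> t'"
  proof -
    have "h [^] i \<otimes> inv h = inv h \<otimes> h [^] i"
      using group_commutes_pow[of h "inv h" i] h_G by simp
    then have "inv h \<otimes> t' = h [^] i \<otimes> (inv h \<otimes> t)"
      unfolding t'_def using h_G t_G by (simp flip: m_assoc)
    then show ?thesis unfolding t'_def t_h[symmetric] using h_G t_G by (simp add: m_assoc)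
  qed
  ultimately have "torus_triple G N u t' h"
    by (intro torus_triple.intro torus_triple_axioms.intro h_N h_5 h_ne h_u)
  moreover have "(t' \<otimes> u \<otimes> t') <# N = (u [^] (10::nat) \<otimes> t') <# N"
  proof -
    have "(t' \<otimes> u \<otimes> t') <# N = (h [^] i \<otimes> (t \<otimes> u [^] (1::nat) \<otimes> t)) <# N"
      using conj[of 1] absorb[OF _ hpow_N] h_G t_G u_G by simp
    also have "\<dots> = (h [^] i \<otimes> (u [^] c \<otimes> t)) <# N"
      using act[of "h [^] i"] cos u_G t_G h_G by (metis m_closed nat_pow_closed)
    also have "\<dots> = (u [^] (10::nat) \<otimes> t) <# N"
      unfolding hpow_pt using i u_pow_eq by metis
    also have "\<dots> = (u [^] (10::nat) \<otimes> t') <# N"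
      unfolding t'_eq using absorb[OF _ hpow_N, of "u [^] (10::nat) \<otimes> t"] u_G t_G h_G by (simp add: m_assoc)
    finally show ?thesis .
  qed
  ultimately show ?thesis by blast
qed

end

text \<open>With this normalization \<open>t\<close> acts as \<open>k \<mapsto> -1/k\<close>; \<open>u\<close>, \<open>h\<close> and \<open>t\<close> behave like the images of the
  matrices with rows \<open>(1, 1), (0, 1)\<close>, rows \<open>(5, 0), (0, 9)\<close> and rows \<open>(0, -1), (1, 0)\<close>.\<close>

locale sl2_triple = torus_triple +
  assumes t_u_t: "(t \<otimes> u \<otimes> t) <# N = (u [^] (10::nat) \<otimes> t) <# N"

theorem (in order_660) exists_sl2_triple:
  assumes few: "card (composite_elements G) \<le> 110"
  shows "\<exists>N u t h. sl2_triple G N u t h"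
proof -
  obtain u t where "big_cell G (cyclic_normalizer G u) u t"
    using exists_big_cell[OF few] .
  then interpret big_cell G "cyclic_normalizer G u" u t .
  let ?N = "cyclic_normalizer G u"
  have not_comm: "h \<otimes> u \<noteq> u \<otimes> h" if "h \<in> ?N" "h [^] (5::nat) = \<one>" "h \<noteq> \<one>" for h
    using commuting_11_5_composites[OF u_G u_11 u_ne card_N N_G[OF that(1)] that(2,3)] few by linarith
  obtain x where x: "x \<in> ?N" "x [^] (5::nat) = \<one>" "x \<noteq> \<one>" and conj_x_N: "t \<otimes> x \<otimes> t \<in> ?N"
    using exists_common_stabilizer_element by blast
  have xG: "x \<in> carrier G" using x N_G by blast
  have "t \<otimes> x \<otimes> t \<noteq> x"
    using order_10_composites[OF x not_comm[OF x]] few by linarith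
  then have inv: "t \<otimes> x \<otimes> t = inv x" using conj_t_power[OF x conj_x_N] by blast
  obtain j where j: "x [^] (j::nat) \<otimes> u = u [^] (3::nat) \<otimes> x [^] j"
    using exists_power_acting_by_3[OF x not_comm[OF x]] by blast
  define h where "h = x [^] j"
  have hG: "h \<in> carrier G" unfolding h_def using xG by simp
  have "h \<noteq> \<one>"
  proof
    assume "h = \<one>"
    then have "u [^] (1::nat) = u [^] (3::nat)" using j u_G by (simp add: h_def)
    then show False unfolding u_pow_eq by (simp add: cong_def)
  qed
  moreover have "h \<in> ?N" unfolding h_def using subgroup_pow_closed[OF N_sub x(1)] .
  moreover have "h [^] (5::nat) = \<one>"
    unfolding h_def using nat_pow_pow[OF xG, of 5 j] nat_pow_pow[OF xG, of j 5] x(2) by (simp add: mult.commute)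
  moreover have "t \<otimes> h = inv h \<otimes> t"
  proof -
    have "t \<otimes> h \<otimes> t = (inv x) [^] j" using conj_t_pow[OF xG, of j] inv by (simp add: h_def)
    then have "t \<otimes> h \<otimes> t = inv h" using nat_pow_inv[OF xG] by (simp add: h_def)
    then have "t \<otimes> h \<otimes> t \<otimes> t = inv h \<otimes> t" by simp
    then show ?thesis using hG t_G t_t by (simp add: m_assoc)
  qed
  ultimately have "torus_triple G ?N u t h"
    using j by (intro torus_triple.intro torus_triple_axioms.intro big_cell_axioms) (simp_all add: h_def)
  from torus_triple.exists_normalized[OF this]
  obtain t' where "torus_triple G ?N u t' h" "(t' \<otimes> u \<otimes> t') <# ?N = (u [^] (10::nat) \<otimes> t') <# ?N"
    by (elim exE conjE)
  then have "sl2_triple G ?N u t' h"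
    by (intro sl2_triple.intro sl2_triple_axioms.intro)
  then show ?thesis by blast
qed

section \<open>Uniqueness of the action on twelve cosets\<close>

text \<open>The labelling is not injective on natural numbers: labels count modulo 11. This avoids reducing
  exponents when \<open>u\<close> and \<open>h\<close> act.\<close>

definition point :: "('a, 'b) monoid_scheme \<Rightarrow> 'a set \<Rightarrow> 'a \<Rightarrow> 'a \<Rightarrow> nat option \<Rightarrow> 'a set" where
  "point G N u t a =
     (case a of None \<Rightarrow> N | Some k \<Rightarrow> (u [^]\<^bsub>G\<^esub> k \<otimes>\<^bsub>G\<^esub> t) <#\<^bsub>G\<^esub> N)"

context sl2_triple begin

abbreviation pt :: "nat option \<Rightarrow> 'a set" where
  "pt \<equiv> point G N u t"

lemma pt_None: "pt None = \<one> <# N"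
  using subgroup.subset[OF N_sub] by (simp add: point_def lcos_mult_one)

lemma pt_Some: "pt (Some k) = (u [^] k \<otimes> t) <# N"
  by (simp add: point_def)

lemma pt_rep: "\<exists>x\<in>carrier G. pt a = x <# N"
  using pt_None pt_Some u_G t_G by (cases a) auto

lemma act_mult: "x \<in> carrier G \<Longrightarrow> y \<in> carrier G \<Longrightarrow> (x \<otimes> y) <# pt a = x <# (y <# pt a)"
  using pt_rep[of a] act by (metis m_assoc m_closed)

lemma pt_Some_eq: "pt (Some i) = pt (Some j) \<longleftrightarrow> [i = j] (mod 11)"
proof
  assume "pt (Some i) = pt (Some j)"
  moreover define n where "n = inv (u [^] j \<otimes> t) \<otimes> (u [^] i \<otimes> t)"
  ultimately have n: "n \<in> N"
    unfolding pt_Some using l_coset_eq_iff[OF N_sub] u_G t_G by simp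
  have "u [^] i \<otimes> t \<otimes> \<one> = u [^] j \<otimes> t \<otimes> n" using u_G t_G by (simp add: n_def)
  then show "[i = j] (mod 11)"
    by (rule cell_inj[OF _ subgroup.one_closed[OF N_sub] n])
next
  assume "[i = j] (mod 11)"
  then show "pt (Some i) = pt (Some j)" unfolding pt_Some by (simp add: u_pow_eq[THEN iffD2])
qed

lemma pt_None_ne: "pt None \<noteq> pt (Some k)"
proof
  assume "pt None = pt (Some k)"
  then have "(u [^] k \<otimes> t) <# N = \<one> <# N" by (simp only: pt_None pt_Some)
  then have "u [^] k \<otimes> t \<in> N"
    using l_coset_eq_iff[OF N_sub _ one_closed, of "u [^] k \<otimes> t"] u_G t_G by simp
  then have "inv (u [^] k) \<otimes> (u [^] k \<otimes> t) \<in> N" by (rule N_m[OF N_inv[OF upow_N]])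
  then show False using t_notin_N u_G t_G by simp
qed

lemma u_pt_Some: "u <# pt (Some k) = pt (Some (Suc k))"
  unfolding pt_Some using u_G t_G group_commutes_pow[of u u k] by (simp add: act m_assoc)

lemma hpow_pt_None: "h [^] (i::nat) <# pt None = pt None"
  unfolding pt_None using act[of "h [^] i" \<one>] absorb[OF one_closed hpow_N[of i]] h_G by simp

lemma hpow_pt_Some: "h [^] (i::nat) <# pt (Some k) = pt (Some (3 ^ i * k))"
  unfolding pt_Some using u_G t_G h_G by (simp add: act hpow_pt)

lemma t_pt_None: "t <# pt None = pt (Some 0)"
  unfolding pt_None pt_Some using act[of t \<one>] t_G by simp

lemma t_pt_0: "t <# pt (Some 0) = pt None"
  unfolding pt_None pt_Some using act[of t t] t_G t_t by simp

lemma t_pt_cong: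
  assumes "t <# pt (Some k) = pt (Some c)"
  shows "t <# pt (Some (3 ^ m * k)) = pt (Some (81 ^ m * c))"
  using t_pt_scale[of k c m] assms u_G t_G by (simp add: pt_Some act m_assoc)

lemma t_pt_1: "t <# pt (Some 1) = pt (Some 10)"
  unfolding pt_Some using t_u_t u_G t_G by (simp add: act m_assoc)

lemma t_pt_10: "t <# pt (Some 10) = pt (Some 1)"
proof -
  have "t <# (t <# pt (Some 1)) = pt (Some 1)"
    using act_mult[OF t_G t_G, of "Some 1"] t_t t_G u_G act[of \<one>] by (simp add: pt_Some)
  then show ?thesis unfolding t_pt_1 .
qed

lemma upow_pt_None: "u [^] (i::nat) <# pt None = pt None"
  unfolding pt_None using act[of "u [^] i" \<one>] absorb[OF one_closed upow_N[of i]] u_G by simp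

lemma upow_pt_Some: "u [^] (i::nat) <# pt (Some k) = pt (Some (i + k))"
proof (induction i arbitrary: k)
  case 0
  show ?case using pt_rep[of "Some k"] act[of \<one>] by auto
next
  case (Suc i)
  then show ?case using act_mult[of "u [^] i" u "Some k"] u_pt_Some u_G by simp
qed

text \<open>An element fixing infinity is some \<open>u\<^sup>i h\<^sup>j\<close>, acting as \<open>k \<mapsto> i + 3\<^sup>j k\<close>; evaluate at 0 and 1.\<close>

lemma pt_faithful:
  assumes x: "x \<in> carrier G" and stab: "\<And>a. x <# pt a = pt a"
  shows "x = \<one>"
proof -
  have "x <# N = \<one> <# N" using stab[of None] act[of x \<one>] x by (simp add: pt_None)
  then have "x \<in> N" using l_coset_eq_iff[OF N_sub x one_closed] x by simp
  then obtain i j where ij: "i < 11" "j < 5" "x = u [^] (i::nat) \<otimes> h [^] (j::nat)"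
    using powers_fill[OF h_N h_5 h_ne] by blast
  have eq: "[i + 3 ^ j * k = k] (mod 11)" for k
    using stab[of "Some k"] act_mult[of "u [^] i" "h [^] j" "Some k"] u_G h_G
    by (simp add: ij hpow_pt_Some upow_pt_Some pt_Some_eq)
  have "i = 0" using eq[of 0] ij(1) by (simp add: cong_def)
  moreover have "j = 0 \<or> j = 1 \<or> j = 2 \<or> j = 3 \<or> j = 4" using ij(2) by presburger
  then have "j = 0" using eq[of 1] \<open>i = 0\<close> by (auto simp: cong_def)
  ultimately show ?thesis using ij by simp
qed

end

text \<open>The elements \<open>g\<close> and \<open>g'\<close> permute the labels in the same way. This relation will be the graph of an
  isomorphism.\<close>

definition same_action where
  "same_action G N u t G' N' u' t' g g' \<longleftrightarrow>
     g \<in> carrier G \<and> g' \<in> carrier G' \<and>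
     (\<forall>a. \<exists>b. g <#\<^bsub>G\<^esub> point G N u t a = point G N u t b \<and>
              g' <#\<^bsub>G'\<^esub> point G' N' u' t' a = point G' N' u' t' b)"

lemma same_action_sym:
  "same_action G N u t G' N' u' t' g g' \<longleftrightarrow> same_action G' N' u' t' G N u t g' g"
  unfolding same_action_def by blast

locale two_triples = A: sl2_triple G N u t h + B: sl2_triple G' N' u' t' h'
  for G :: "('a, 'b) monoid_scheme" and N u t h and G' :: "('c, 'd) monoid_scheme" and N' u' t' h'
begin

abbreviation same where "same \<equiv> same_action G N u t G' N' u' t'"

text \<open>In both groups two labels name the same point if and only if they are equal or congruent modulo 11;
  so comparing points through their labels is legitimate.\<close>

lemma pt_eq_transfer: "A.pt a = A.pt b \<longleftrightarrow> B.pt a = B.pt b"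
  using A.pt_Some_eq B.pt_Some_eq A.pt_None_ne B.pt_None_ne
  by (cases a; cases b) (auto simp: eq_commute[of "A.pt (Some _)" "A.pt None"] eq_commute[of "B.pt (Some _)" "B.pt None"])

lemma same_mult:
  assumes "same g g'" "same k k'"
  shows "same (g \<otimes>\<^bsub>G\<^esub> k) (g' \<otimes>\<^bsub>G'\<^esub> k')"
  unfolding same_action_def
proof (intro conjI allI)
  show "g \<otimes>\<^bsub>G\<^esub> k \<in> carrier G" "g' \<otimes>\<^bsub>G'\<^esub> k' \<in> carrier G'"
    using assms by (auto simp: same_action_def)
  fix a
  obtain b where "k <#\<^bsub>G\<^esub> A.pt a = A.pt b" "k' <#\<^bsub>G'\<^esub> B.pt a = B.pt b"
    using assms(2) unfolding same_action_def by blast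
  moreover obtain c where "g <#\<^bsub>G\<^esub> A.pt b = A.pt c" "g' <#\<^bsub>G'\<^esub> B.pt b = B.pt c"
    using assms(1) unfolding same_action_def by blast
  ultimately have "(g \<otimes>\<^bsub>G\<^esub> k) <#\<^bsub>G\<^esub> A.pt a = A.pt c" "(g' \<otimes>\<^bsub>G'\<^esub> k') <#\<^bsub>G'\<^esub> B.pt a = B.pt c"
    using assms A.act_mult B.act_mult by (auto simp: same_action_def)
  then show "\<exists>b. (g \<otimes>\<^bsub>G\<^esub> k) <#\<^bsub>G\<^esub> A.pt a = A.pt b \<and> (g' \<otimes>\<^bsub>G'\<^esub> k') <#\<^bsub>G'\<^esub> B.pt a = B.pt b"
    by blast
qed

lemma same_unique:
  assumes "same g x" "same g y"
  shows "x = y"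
proof -
  have xy: "x \<in> carrier G'" "y \<in> carrier G'" using assms by (auto simp: same_action_def)
  have "x <#\<^bsub>G'\<^esub> B.pt a = y <#\<^bsub>G'\<^esub> B.pt a" for a
    using assms pt_eq_transfer unfolding same_action_def by metis
  then have "(inv\<^bsub>G'\<^esub> y \<otimes>\<^bsub>G'\<^esub> x) <#\<^bsub>G'\<^esub> B.pt a = B.pt a" for a
    using B.act_mult[of "inv\<^bsub>G'\<^esub> y" x a] B.act_mult[of "inv\<^bsub>G'\<^esub> y" y a] xy B.pt_rep[of a] B.act[of "\<one>\<^bsub>G'\<^esub>"]
    by auto
  then have "inv\<^bsub>G'\<^esub> y \<otimes>\<^bsub>G'\<^esub> x = \<one>\<^bsub>G'\<^esub>" using B.pt_faithful xy by simp
  then have "y \<otimes>\<^bsub>G'\<^esub> (inv\<^bsub>G'\<^esub> y \<otimes>\<^bsub>G'\<^esub> x) = y" using xy by simp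
  then show ?thesis using xy by simp
qed

lemma same_upow: "same (u [^]\<^bsub>G\<^esub> (i::nat)) (u' [^]\<^bsub>G'\<^esub> i)"
  unfolding same_action_def
proof (intro conjI allI)
  show "\<exists>b. u [^]\<^bsub>G\<^esub> i <#\<^bsub>G\<^esub> A.pt a = A.pt b \<and> u' [^]\<^bsub>G'\<^esub> i <#\<^bsub>G'\<^esub> B.pt a = B.pt b" for a
    using A.upow_pt_None A.upow_pt_Some B.upow_pt_None B.upow_pt_Some by (cases a) blast+
qed (use A.u_G B.u_G in auto)

lemma same_hpow: "same (h [^]\<^bsub>G\<^esub> (i::nat)) (h' [^]\<^bsub>G'\<^esub> i)"
  unfolding same_action_def
proof (intro conjI allI)
  show "\<exists>b. h [^]\<^bsub>G\<^esub> i <#\<^bsub>G\<^esub> A.pt a = A.pt b \<and> h' [^]\<^bsub>G'\<^esub> i <#\<^bsub>G'\<^esub> B.pt a = B.pt b" for a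
    using A.hpow_pt_None A.hpow_pt_Some B.hpow_pt_None B.hpow_pt_Some by (cases a) blast+
qed (use A.h_G B.h_G in auto)

text \<open>Starting from \<open>1 \<mapsto> 10\<close> and \<open>10 \<mapsto> 1\<close>, scaling by powers of 3 reaches every nonzero residue: the squares
  from 1 and the non-squares from 10.\<close>

lemma same_t: "same t t'"
  unfolding same_action_def
proof (intro conjI allI)
  fix a
  show "\<exists>b. t <#\<^bsub>G\<^esub> A.pt a = A.pt b \<and> t' <#\<^bsub>G'\<^esub> B.pt a = B.pt b"
  proof (cases a)
    case None
    then show ?thesis using A.t_pt_None B.t_pt_None by blast
  next
    case (Some k)
    define Q where "Q l \<longleftrightarrow> (\<exists>b. t <#\<^bsub>G\<^esub> A.pt (Some l) = A.pt b \<and> t' <#\<^bsub>G'\<^esub> B.pt (Some l) = B.pt b)" for l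
    have Q1: "Q (3 ^ m * 1)" for m :: nat
      unfolding Q_def using A.t_pt_cong[OF A.t_pt_1] B.t_pt_cong[OF B.t_pt_1] by blast
    have Q10: "Q (3 ^ m * 10)" for m :: nat
      unfolding Q_def using A.t_pt_cong[OF A.t_pt_10] B.t_pt_cong[OF B.t_pt_10] by blast
    have Q0: "Q 0"
      unfolding Q_def using A.t_pt_0 B.t_pt_0 by blast
    have Q_cong: "Q k" if "[k = l] (mod 11)" "Q l" for l
      using that(2) unfolding Q_def A.pt_Some_eq[THEN iffD2, OF that(1)] B.pt_Some_eq[THEN iffD2, OF that(1)] .
    have "[k = 0] (mod 11) \<or> (\<exists>m. [k = 3 ^ m * 1] (mod 11)) \<or> (\<exists>m. [k = 3 ^ m * 10] (mod 11))"
    proof -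
      have eq: "P (k mod 11)" if "P 0" "P 1" "P 2" "P 3" "P 4" "P 5" "P 6" "P 7" "P 8" "P 9" "P 10"
        for P :: "nat \<Rightarrow> bool"
      proof -
        have "k mod 11 = 0 \<or> k mod 11 = 1 \<or> k mod 11 = 2 \<or> k mod 11 = 3 \<or> k mod 11 = 4 \<or> k mod 11 = 5
            \<or> k mod 11 = 6 \<or> k mod 11 = 7 \<or> k mod 11 = 8 \<or> k mod 11 = 9 \<or> k mod 11 = 10" by presburger
        then show ?thesis using that by (elim disjE) simp_all
      qed
      let ?P = "\<lambda>r::nat. r = 0 \<or> (\<exists>m::nat. r = 3 ^ m * 1 mod 11) \<or> (\<exists>m::nat. r = 3 ^ m * 10 mod 11)"
      have sq: "?P r" if "r = 3 ^ m mod 11 \<or> r = 3 ^ m * 10 mod 11" for r m using that by auto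
      have "?P (k mod 11)"
        by (rule eq) (use sq[of 1 0] sq[of 2 2] sq[of 3 1] sq[of 4 4] sq[of 5 3] sq[of 6 3] sq[of 7 4]
          sq[of 8 1] sq[of 9 2] sq[of 10 0] in simp_all)
      then show ?thesis by (auto simp: cong_def)
    qed
    then have "Q k" using Q_cong Q0 Q1 Q10 by blast
    then show ?thesis by (simp add: Q_def Some)
  qed
qed (use A.t_G B.t_G in auto)

lemma same_total:
  assumes "g \<in> carrier G"
  shows "\<exists>g'. same g g'"
proof -
  have N: "\<exists>n'. same n n'" if n: "n \<in> N" for n
  proof -
    obtain i j where "n = u [^]\<^bsub>G\<^esub> (i::nat) \<otimes>\<^bsub>G\<^esub> h [^]\<^bsub>G\<^esub> (j::nat)"
      using A.powers_fill[OF A.h_N A.h_5 A.h_ne n] by blast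
    then show ?thesis using same_mult[OF same_upow same_hpow] by blast
  qed
  consider "g \<in> N" | k n where "n \<in> N" "g = u [^]\<^bsub>G\<^esub> (k::nat) \<otimes>\<^bsub>G\<^esub> t \<otimes>\<^bsub>G\<^esub> n"
    using A.cells[OF assms] by blast
  then show ?thesis
  proof cases
    case 1
    then show ?thesis by (rule N)
  next
    case 2
    then obtain n' where "same n n'" using N by blast
    then show ?thesis using same_mult[OF same_mult[OF same_upow same_t]] 2(2) by blast
  qed
qed

end

lemma two_triples_swap:
  "two_triples G N u t h G' N' u' t' h' \<Longrightarrow> two_triples G' N' u' t' h' G N u t h"
  by (simp add: two_triples_def)

text \<open>The relation of acting in the same way is total and single-valued in both directions, since the
  generators correspond and both actions are faithful, and it respects products.\<close>

theorem (in two_triples) triples_iso: "G \<cong> G'"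
proof -
  interpret swap: two_triples G' N' u' t' h' G N u t h
    by (rule two_triples_swap) (rule two_triples_axioms)
  define f where "f g = (THE g'. same g g')" for g
  have f: "same g (f g)" if "g \<in> carrier G" for g
    unfolding f_def using same_total[OF that] same_unique by (metis theI')
  have f_eq: "f g = g'" if "same g g'" for g g'
    unfolding f_def using that same_unique by blast
  have "f \<in> hom G G'"
  proof (rule homI)
    show "f x \<in> carrier G'" if "x \<in> carrier G" for x
      using f[OF that] by (simp add: same_action_def)
    show "f (x \<otimes>\<^bsub>G\<^esub> y) = f x \<otimes>\<^bsub>G'\<^esub> f y" if "x \<in> carrier G" "y \<in> carrier G" for x y
      by (rule f_eq) (rule same_mult[OF f[OF that(1)] f[OF that(2)]])
  qed
  moreover have "bij_betw f (carrier G) (carrier G')"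
  proof (rule bij_betwI')
    fix x y assume xy: "x \<in> carrier G" "y \<in> carrier G"
    show "f x = f y \<longleftrightarrow> x = y"
    proof
      assume "f x = f y"
      then have "swap.same (f x) x" "swap.same (f x) y"
        using f[OF xy(1)] f[OF xy(2)] same_action_sym by metis+
      then show "x = y" by (rule swap.same_unique)
    qed simp
  next
    show "f x \<in> carrier G'" if "x \<in> carrier G" for x
      using f[OF that] by (simp add: same_action_def)
  next
    fix y assume "y \<in> carrier G'"
    then obtain x where "swap.same y x" using swap.same_total by blast
    then have "same x y" using same_action_sym by metis
    then show "\<exists>x\<in>carrier G. y = f x" using f_eq by (metis same_action_def)
  qed
  ultimately show ?thesis by (auto simp: is_iso_def iso_def)
qed

section \<open>Element orders in the projective special linear group over eleven elements\<close>

abbreviation F11 :: "int ring" where "F11 \<equiv> residue_ring 11"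

interpretation F11: residues 11 F11
  by unfold_locales simp_all

interpretation SL: group "SL2 F11"
  by (rule SL2_group) (rule F11.cring)

lemma SL_carrier:
  "carrier (SL2 F11) = {(a, b, c, d). a \<in> {0..10} \<and> b \<in> {0..10} \<and> c \<in> {0..10} \<and> d \<in> {0..10} \<and>
     (a * d - b * c) mod 11 = 1}"
proof -
  have det: "det2 F11 (a, b, c, d) = (a * d - b * c) mod 11" for a b c d
  proof -
    have "(x mod 11 + - (y mod 11) mod 11) mod 11 = (x - y) mod 11" for x y :: int
      using mod_add_eq[of x 11 "- y"] mod_minus_eq[of y 11] by (simp only: diff_conv_add_uminus)
    then show ?thesis
      unfolding det2_def prod.case a_minus_def F11.res_neg_eq F11.res_mult_eq F11.res_add_eq .
  qed
  have eleven: "11 - 1 = (10::int)" by simp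
  show ?thesis
    unfolding SL2_def F11.res_carrier_eq F11.res_one_eq eleven by (auto simp only: det partial_object.simps)
qed

lemma SL_mult:
  "(a, b, c, d) \<otimes>\<^bsub>SL2 F11\<^esub> (a', b', c', d') =
     ((a * a' + b * c') mod 11, (a * b' + b * d') mod 11, (c * a' + d * c') mod 11, (c * b' + d * d') mod 11)"
  unfolding SL2_def monoid.simps mult2_def prod.case F11.res_mult_eq F11.res_add_eq
  by (simp only: mod_add_eq)

lemma SL_one: "\<one>\<^bsub>SL2 F11\<^esub> = (1, 0, 0, 1)"
  by (simp add: SL2_def F11.res_one_eq F11.res_zero_eq)

definition pairs :: "(int \<times> int) list" where
  "pairs = List.product [0..10] [0..10]"

lemma set_pairs: "set pairs = {0..10} \<times> {0..10}"
  by (simp add: pairs_def)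

lemma distinct_pairs: "distinct pairs"
  by (simp add: pairs_def distinct_product)

lemma number_of_factorizations:
  "\<forall>e\<in>set [0..10]. length (filter (\<lambda>(b, c). (b * c) mod 11 = e) pairs) = (if e = 0 then 21 else 10)"
  by code_simp

lemma card_factorizations:
  assumes "e \<in> {0..10::int}"
  shows "card {(b, c). b \<in> {0..10} \<and> c \<in> {0..10} \<and> (b * c) mod 11 = e} = (if e = 0 then 21 else 10)"
proof -
  have "{(b, c). b \<in> {0..10} \<and> c \<in> {0..10} \<and> (b * c) mod 11 = e} = set (filter (\<lambda>(b, c). (b * c) mod 11 = e) pairs)"
    by (auto simp: set_pairs)
  moreover have "e \<in> set [0..10]" using assms by simp
  ultimately show ?thesis
    using number_of_factorizations by (simp only: distinct_card[OF distinct_filter[OF distinct_pairs]])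
qed

text \<open>For fixed diagonal entries \<open>a\<close> and \<open>d\<close> the off-diagonal entries are a factorization of \<open>a d - 1\<close>, of
  which there are 21 if this is 0 and 10 otherwise.\<close>

lemma card_SL_diagonal:
  "card {A \<in> carrier (SL2 F11). case A of (a, b, c, d) \<Rightarrow> P (a, d)} =
     sum_list (map (\<lambda>(a, d). if (a * d - 1) mod 11 = 0 then 21 else 10) (filter P pairs))"
proof -
  let ?B = "\<lambda>(a, d). {(b, c). b \<in> {0..10::int} \<and> c \<in> {0..10} \<and> (b * c) mod 11 = (a * d - 1) mod 11}"
  let ?f = "\<lambda>((a, d), (b, c)). (a, b, c, d)"
  have det: "(a * d - b * c) mod 11 = 1 \<longleftrightarrow> (b * c) mod 11 = (a * d - 1) mod 11" for a b c d :: int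
  proof -
    have "(x - y) mod 11 = 1 mod 11 \<longleftrightarrow> y mod 11 = (x - 1) mod 11" for x y :: int
    proof -
      have "y - (x - 1) = - (x - y - 1)" by simp
      then show ?thesis unfolding mod_eq_dvd_iff by (simp only: dvd_minus_iff)
    qed
    then show ?thesis by simp
  qed
  have "{A \<in> carrier (SL2 F11). case A of (a, b, c, d) \<Rightarrow> P (a, d)} = ?f ` (SIGMA q:set (filter P pairs). ?B q)"
    by (force simp: SL_carrier det set_pairs image_iff)
  moreover have "inj_on ?f (SIGMA q:set (filter P pairs). ?B q)"
    by (auto simp: inj_on_def)
  ultimately have "card {A \<in> carrier (SL2 F11). case A of (a, b, c, d) \<Rightarrow> P (a, d)} =
      card (SIGMA q:set (filter P pairs). ?B q)"
    by (simp add: card_image)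
  also have "\<dots> = (\<Sum>q\<in>set (filter P pairs). card (?B q))"
  proof (rule card_SigmaI)
    show "\<forall>q\<in>set (filter P pairs). finite (?B q)"
    proof
      fix q
      have "?B q \<subseteq> {0..10} \<times> {0..10}" by (auto split: prod.splits)
      then show "finite (?B q)" by (rule finite_subset) simp
    qed
  qed simp
  also have "\<dots> = (\<Sum>q\<in>set (filter P pairs). case q of (a, d) \<Rightarrow> if (a * d - 1) mod 11 = 0 then 21 else 10)"
  proof (rule sum.cong[OF refl])
    fix q :: "int \<times> int"
    obtain a d where q: "q = (a, d)" by (cases q)
    have "(a * d - 1) mod 11 \<in> {0..10}" by simp
    then show "card (?B q) = (case q of (a, d) \<Rightarrow> if (a * d - 1) mod 11 = 0 then 21 else 10)"
      unfolding q prod.case by (rule card_factorizations)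
  qed
  also have "\<dots> = sum_list (map (\<lambda>(a, d). if (a * d - 1) mod 11 = 0 then 21 else 10) (filter P pairs))"
    by (rule sum.distinct_set_conv_list) (simp add: distinct_pairs)
  finally show ?thesis .
qed

lemma order_SL: "order (SL2 F11) = 1320"
proof -
  have "sum_list (map (\<lambda>(a, d). if (a * d - 1) mod 11 = 0 then 21 else 10 :: nat) (filter (\<lambda>_. True) pairs)) = 1320"
    by code_simp
  then have "card {A \<in> carrier (SL2 F11). case A of (a, b, c, d) \<Rightarrow> True} = 1320"
    unfolding card_SL_diagonal[of "\<lambda>_. True"] .
  then show ?thesis by (simp add: order_def case_prod_unfold)
qed

abbreviation trace5 :: "int mat2 set" where
  "trace5 \<equiv> {A \<in> carrier (SL2 F11). case A of (a, b, c, d) \<Rightarrow> (a + d) mod 11 = 5}"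

lemma card_trace5: "card trace5 = 110"
proof -
  have "sum_list (map (\<lambda>(a, d). if (a * d - 1) mod 11 = 0 then 21 else 10 :: nat)
      (filter (\<lambda>(a, d). (a + d) mod 11 = 5) pairs)) = 110"
    by code_simp
  then show ?thesis
    using card_SL_diagonal[of "\<lambda>(a, d). (a + d) mod 11 = 5"] by (simp only: prod.case)
qed

abbreviation Z :: "int mat2 set" where "Z \<equiv> centre (SL2 F11)"

lemma square_one_mod_11: "a \<in> {0..10::int} \<Longrightarrow> (a * a) mod 11 = 1 \<Longrightarrow> a = 1 \<or> a = 10"
proof -
  have "\<forall>a\<in>set [0..10::int]. (a * a) mod 11 = 1 \<longrightarrow> a = 1 \<or> a = 10" by code_simp
  then show "a \<in> {0..10::int} \<Longrightarrow> (a * a) mod 11 = 1 \<Longrightarrow> a = 1 \<or> a = 10" by simp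
qed

lemma scalar_in_SL:
  assumes "(a, 0, 0, a) \<in> carrier (SL2 F11)"
  shows "a = 1 \<or> a = 10"
  using assms square_one_mod_11[of a] by (simp add: SL_carrier)

text \<open>A matrix that commutes with the two elementary matrices is scalar, and a scalar matrix of
  determinant 1 is \<open>1\<close> or \<open>-1\<close>, the latter having the entry \<open>10\<close>.\<close>

lemma centre_SL: "Z = {(1, 0, 0, 1), (10, 0, 0, 10)}"
proof (intro equalityI subsetI)
  fix z assume "z \<in> Z"
  then have z: "z \<in> carrier (SL2 F11)" and comm: "\<And>x. x \<in> carrier (SL2 F11) \<Longrightarrow> z \<otimes>\<^bsub>SL2 F11\<^esub> x = x \<otimes>\<^bsub>SL2 F11\<^esub> z"
    by (auto simp: centre_def)
  obtain a b c d where zz: "z = (a, b, c, d)" by (cases z)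
  then have r: "a \<in> {0..10}" "b \<in> {0..10}" "c \<in> {0..10}" "d \<in> {0..10}"
    using z by (auto simp: SL_carrier)
  have "z \<otimes>\<^bsub>SL2 F11\<^esub> (1, 1, 0, 1) = (1, 1, 0, 1) \<otimes>\<^bsub>SL2 F11\<^esub> z"
    by (rule comm) (simp add: SL_carrier)
  then have e: "[a + 0 = a + c] (mod 11)" "[a + b = d + b] (mod 11)"
    by (simp_all add: zz SL_mult cong_def add.commute)
  have residue_eq: "x = y" if "[x = y] (mod 11)" "x \<in> {0..10}" "y \<in> {0..10}" for x y :: int
    using that by (simp add: cong_def)
  have "[0 = c] (mod 11)" using e(1) by (simp only: cong_add_lcancel)
  then have "c = 0" using residue_eq[of 0 c] r(3) by simp
  moreover have "[a = d] (mod 11)" using e(2) by (simp only: cong_add_rcancel)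
  then have "a = d" using residue_eq r(1,4) by blast
  moreover have "z \<otimes>\<^bsub>SL2 F11\<^esub> (1, 0, 1, 1) = (1, 0, 1, 1) \<otimes>\<^bsub>SL2 F11\<^esub> z"
    by (rule comm) (simp add: SL_carrier)
  then have "[a + b = a + 0] (mod 11)"
    by (simp_all add: zz SL_mult cong_def)
  then have "[b = 0] (mod 11)" by (simp only: cong_add_lcancel)
  then have "b = 0" using residue_eq[of b 0] r(2) by simp
  ultimately show "z \<in> {(1, 0, 0, 1), (10, 0, 0, 10)}"
    using scalar_in_SL[of a] z zz by auto
next
  fix z :: "int mat2" assume z: "z \<in> {(1, 0, 0, 1), (10, 0, 0, 10)}"
  then show "z \<in> Z"
    by (auto simp: centre_def SL_carrier SL_mult mult.commute)
qed

text \<open>The matrix \<open>x A + y\<close>.\<close>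

definition lin_comb :: "int mat2 \<Rightarrow> int \<times> int \<Rightarrow> int mat2" where
  "lin_comb = (\<lambda>(a, b, c, d) (x, y). ((x * a + y) mod 11, x * b mod 11, x * c mod 11, (x * d + y) mod 11))"

text \<open>The pair \<open>(x, y)\<close> with \<open>A\<^sup>n = x A + y\<close> for every matrix \<open>A\<close> of determinant 1 and trace \<open>t\<close>.\<close>

primrec power_coeffs :: "int \<Rightarrow> nat \<Rightarrow> int \<times> int" where
  "power_coeffs t 0 = (0, 1)"
| "power_coeffs t (Suc n) = (case power_coeffs t n of (x, y) \<Rightarrow> ((t * x + y) mod 11, (- x) mod 11))"

text \<open>By the Cayley-Hamilton identity \<open>A\<^sup>2 = t A - 1\<close>.\<close>

lemma lin_mult:
  assumes "(a, b, c, d) \<in> carrier (SL2 F11)"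
  shows "lin_comb (a, b, c, d) (x, y) \<otimes>\<^bsub>SL2 F11\<^esub> (a, b, c, d) =
     lin_comb (a, b, c, d) (((a + d) mod 11 * x + y) mod 11, (- x) mod 11)"
proof -
  have det: "[a * d - b * c = 1] (mod 11)" using assms by (simp add: SL_carrier cong_def)
  have e: "[(x * a + y) * a + x * b * c = ((a + d) * x + y) * a + (- x)] (mod 11)"
  proof -
    have "[((a + d) * x + y) * a - x * (a * d - b * c) = ((a + d) * x + y) * a - x * 1] (mod 11)"
      by (intro cong_diff cong_mult cong_refl det)
    then show ?thesis by (simp add: algebra_simps)
  qed
  have f: "[x * c * b + (x * d + y) * d = ((a + d) * x + y) * d + (- x)] (mod 11)"
  proof -
    have "[((a + d) * x + y) * d - x * (a * d - b * c) = ((a + d) * x + y) * d - x * 1] (mod 11)"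
      by (intro cong_diff cong_mult cong_refl det)
    then show ?thesis by (simp add: algebra_simps)
  qed
  have g: "(x * a + y) * b + x * b * d = ((a + d) * x + y) * b" "x * c * a + (x * d + y) * c = ((a + d) * x + y) * c"
    by (simp_all add: algebra_simps)
  have m: "[r mod 11 = r] (mod 11)" for r :: int by (simp add: cong_def)
  have "(p mod 11 * v + q mod 11 * w) mod 11 = (p * v + q * w) mod 11" for p q v w :: int
    unfolding cong_def[symmetric] by (intro cong_add cong_mult cong_refl m)
  moreover have "(((a + d) mod 11 * x + y) mod 11 * v + (- x) mod 11) mod 11 = (((a + d) * x + y) * v + (- x)) mod 11" for v
    unfolding cong_def[symmetric] by (intro cong_add cong_mult cong_refl m cong_trans[OF m])
  moreover have "((a + d) mod 11 * x + y) mod 11 * v mod 11 = (((a + d) * x + y) * v) mod 11" for v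
    unfolding cong_def[symmetric] by (intro cong_add cong_mult cong_refl m cong_trans[OF m])
  ultimately show ?thesis
    using e f unfolding lin_comb_def SL_mult prod.case cong_def by (simp only: g)
qed

lemma SL_pow:
  assumes "(a, b, c, d) \<in> carrier (SL2 F11)"
  shows "(a, b, c, d) [^]\<^bsub>SL2 F11\<^esub> n = lin_comb (a, b, c, d) (power_coeffs ((a + d) mod 11) n)"
proof (induction n)
  case 0
  then show ?case by (simp add: SL_one lin_comb_def)
next
  case (Suc n)
  obtain x y where "power_coeffs ((a + d) mod 11) n = (x, y)" by (cases "power_coeffs ((a + d) mod 11) n")
  then show ?case using Suc lin_mult[OF assms, of x y] by simp
qed

lemma lin_in_centre: "y = 1 \<or> y = 10 \<Longrightarrow> lin_comb A (0, y) \<in> Z"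
  by (cases A) (auto simp: lin_comb_def centre_SL)

lemma lin_not_in_centre:
  assumes A: "A \<in> carrier (SL2 F11)" "A \<notin> Z" and x: "x \<in> {1..10}"
  shows "lin_comb A (x, y) \<notin> Z"
proof
  assume L: "lin_comb A (x, y) \<in> Z"
  obtain a b c d where AA: "A = (a, b, c, d)" by (cases A)
  then have r: "a \<in> {0..10}" "b \<in> {0..10}" "c \<in> {0..10}" "d \<in> {0..10}"
    using A by (auto simp: SL_carrier)
  have "coprime x 11"
  proof -
    have "\<forall>x\<in>set [1..10::int]. coprime x 11" by code_simp
    then show ?thesis using x by simp
  qed
  then have canc: "v = w" if "[x * v = x * w] (mod 11)" "v \<in> {0..10}" "w \<in> {0..10}" for v w
  proof -
    have "v mod 11 = w mod 11"
      using that(1) cong_mult_lcancel[OF \<open>coprime x 11\<close>, of v w] by (simp add: cong_def)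
    then show ?thesis using that(2,3) by simp
  qed
  have "x * b mod 11 = 0" "x * c mod 11 = 0" "(x * a + y) mod 11 = (x * d + y) mod 11"
    using L by (auto simp: AA lin_comb_def centre_SL)
  then have e: "[x * b = x * 0] (mod 11)" "[x * c = x * 0] (mod 11)" "[x * a + y = x * d + y] (mod 11)"
    unfolding cong_def by simp_all
  have "[x * a = x * d] (mod 11)" using e(3) by (simp only: cong_add_rcancel)
  then have "b = 0" "c = 0" "a = d" using canc[OF e(1)] canc[OF e(2)] canc[of a d] r by simp_all
  then show False using A scalar_in_SL[of a] by (auto simp: AA centre_SL)
qed

interpretation Zn: normal Z "SL2 F11"
  by (rule SL.centre_normal)

interpretation PSL: group "PSL2 F11"
  by (rule PSL2_group) (rule F11.cring)

lemma PSL_carrier: "carrier (PSL2 F11) = (\<lambda>A. Z #>\<^bsub>SL2 F11\<^esub> A) ` carrier (SL2 F11)"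
  by (simp add: PSL2_def carrier_FactGroup)

lemma order_PSL: "order (PSL2 F11) = 660"
proof -
  have "card (rcosets\<^bsub>SL2 F11\<^esub> Z) * card Z = 1320"
    using SL.lagrange[OF Zn.subgroup_axioms] order_SL by simp
  then show ?thesis by (simp add: centre_SL PSL2_def FactGroup_def order_def)
qed

lemma finite_PSL: "finite (carrier (PSL2 F11))"
  using order_PSL by (intro card_ge_0_finite) (simp add: order_def)

lemma PSL_pow_eq_one:
  assumes A: "A \<in> carrier (SL2 F11)"
  shows "(Z #>\<^bsub>SL2 F11\<^esub> A) [^]\<^bsub>PSL2 F11\<^esub> (n::nat) = \<one>\<^bsub>PSL2 F11\<^esub> \<longleftrightarrow> A [^]\<^bsub>SL2 F11\<^esub> n \<in> Z"
proof -
  have "(Z #>\<^bsub>SL2 F11\<^esub> A) [^]\<^bsub>PSL2 F11\<^esub> n = Z #>\<^bsub>SL2 F11\<^esub> (A [^]\<^bsub>SL2 F11\<^esub> n)"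
    using Zn.FactGroup_pow[OF A] by (simp add: PSL2_def)
  moreover have An: "A [^]\<^bsub>SL2 F11\<^esub> n \<in> carrier (SL2 F11)" using A by simp
  moreover have "Z #>\<^bsub>SL2 F11\<^esub> (A [^]\<^bsub>SL2 F11\<^esub> n) = Z \<longleftrightarrow> A [^]\<^bsub>SL2 F11\<^esub> n \<in> Z"
    using SL.coset_join2[OF An Zn.subgroup_axioms] SL.rcos_self[OF An Zn.subgroup_axioms] by auto
  ultimately show ?thesis by (simp add: PSL2_def)
qed

text \<open>By \<open>SL_pow\<close>, a power of a non-scalar \<open>A\<close> is scalar if and only if its first coefficient vanishes, which
  depends on the trace only. The orders are 2, 3, 11, 5, 5 and 6 for the traces 0, 1, 2, 3, 4 and 5 up
  to sign.\<close>

lemma PSL_order: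
  assumes A: "A \<in> carrier (SL2 F11)" "A \<notin> Z" and AA: "A = (a, b, c, d)"
  shows "if (a + d) mod 11 \<in> {5, 6} then PSL.ord (Z #>\<^bsub>SL2 F11\<^esub> A) = 6
         else Factorial_Ring.prime (PSL.ord (Z #>\<^bsub>SL2 F11\<^esub> A))"
proof -
  let ?X = "Z #>\<^bsub>SL2 F11\<^esub> A"
  define s where "s = (a + d) mod 11"
  have X: "?X \<in> carrier (PSL2 F11)" using A by (auto simp: PSL_carrier)
  have dvd: "PSL.ord ?X dvd n \<longleftrightarrow> lin_comb A (power_coeffs s n) \<in> Z" for n
    using PSL_pow_eq_one[OF A(1), of n] PSL.pow_eq_id[OF X, of n] SL_pow[of a b c d n] A(1)
    by (simp add: AA s_def)
  have pair: "power_coeffs s n = (fst (power_coeffs s n), snd (power_coeffs s n))" for n by simp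
  have "A [^]\<^bsub>SL2 F11\<^esub> (1::nat) \<notin> Z" using A by simp
  then have ne1: "PSL.ord ?X \<noteq> 1" using PSL_pow_eq_one[OF A(1), of 1] PSL.pow_eq_id[OF X, of 1] by auto
  have central: "PSL.ord ?X dvd n" if "fst (power_coeffs s n) = 0" "snd (power_coeffs s n) = 1 \<or> snd (power_coeffs s n) = 10" for n
    unfolding dvd by (subst pair, subst that(1), rule lin_in_centre, rule that(2))
  have not_central: "\<not> PSL.ord ?X dvd n" if "fst (power_coeffs s n) \<in> {1..10}" for n
    unfolding dvd by (subst pair, rule lin_not_in_centre[OF A that])
  have "\<forall>t\<in>set [0..10]. (t \<in> {5, 6} \<and> fst (power_coeffs t 6) = 0 \<and> (snd (power_coeffs t 6) = 1 \<or> snd (power_coeffs t 6) = 10) \<and>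
        1 \<le> fst (power_coeffs t 2) \<and> fst (power_coeffs t 2) \<le> 10 \<and> 1 \<le> fst (power_coeffs t 3) \<and> fst (power_coeffs t 3) \<le> 10) \<or>
      (t \<notin> {5, 6} \<and> (\<exists>p\<in>set [2, 3, 5, 11]. fst (power_coeffs t p) = 0 \<and> (snd (power_coeffs t p) = 1 \<or> snd (power_coeffs t p) = 10)))"
    by code_simp
  moreover have "s \<in> set [0..10]" by (simp add: s_def)
  ultimately consider
    "s \<in> {5, 6}" "fst (power_coeffs s 6) = 0" "snd (power_coeffs s 6) = 1 \<or> snd (power_coeffs s 6) = 10"
       "fst (power_coeffs s 2) \<in> {1..10}" "fst (power_coeffs s 3) \<in> {1..10}"
    | p where "s \<notin> {5, 6}" "p \<in> set [2, 3, 5, 11]" "fst (power_coeffs s p) = 0" "snd (power_coeffs s p) = 1 \<or> snd (power_coeffs s p) = 10"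
    unfolding atLeastAtMost_iff by blast
  then show ?thesis
  proof cases
    case 1
    have "n = 1 \<or> n = 2 \<or> n = 3 \<or> n = 6" if "n dvd 6" for n :: nat
    proof -
      have "n \<le> 6" using that by (intro dvd_imp_le) simp_all
      then have "n = 0 \<or> n = 1 \<or> n = 2 \<or> n = 3 \<or> n = 4 \<or> n = 5 \<or> n = 6" by presburger
      then show ?thesis using that by (elim disjE) simp_all
    qed
    then have "PSL.ord ?X = 6"
      using ne1 central[OF 1(2,3)] not_central[OF 1(4)] not_central[OF 1(5)] by fastforce
    then show ?thesis using 1(1) by (simp add: s_def)
  next
    case 2
    have p: "Factorial_Ring.prime p" using 2(2) by (auto simp: prime_nat_numeral_eq)
    have "Factorial_Ring.prime (PSL.ord ?X)"
      using central[OF 2(3,4)] ne1 p by (auto simp: prime_nat_iff)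
    then show ?thesis using 2(1) by (simp add: s_def)
  qed
qed

lemma minus_trace:
  fixes x y :: int
  shows "(10 * x mod 11 + 10 * y mod 11) mod 11 = 10 * ((x + y) mod 11) mod 11"
proof -
  have "(10 * x mod 11 + 10 * y mod 11) mod 11 = (10 * x + 10 * y) mod 11" by (rule mod_add_eq)
  then show ?thesis by (simp add: mod_mult_right_eq distrib_left)
qed

text \<open>By \<open>PSL_order\<close> the composite elements are the cosets of the matrices with trace 5 or \<open>-5\<close>, and
  multiplication by \<open>-1\<close> turns trace \<open>-5\<close> into trace 5.\<close>

lemma composite_elements_PSL:
  "composite_elements (PSL2 F11) = (\<lambda>A. Z #>\<^bsub>SL2 F11\<^esub> A) ` trace5"
  and PSL_composite_order: "q \<in> composite_elements (PSL2 F11) \<Longrightarrow> PSL.ord q = 6"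
proof -
  have six: "PSL.ord q = 6" if q: "q \<in> (\<lambda>A. Z #>\<^bsub>SL2 F11\<^esub> A) ` trace5" for q
  proof -
    obtain A where A: "A \<in> trace5" "q = Z #>\<^bsub>SL2 F11\<^esub> A" using q by blast
    obtain a b c d where AA: "A = (a, b, c, d)" by (cases A)
    have "A \<notin> Z" using A(1) by (auto simp: centre_SL)
    then show ?thesis using PSL_order[of A a b c d] A AA by simp
  qed
  show eq: "composite_elements (PSL2 F11) = (\<lambda>A. Z #>\<^bsub>SL2 F11\<^esub> A) ` trace5"
  proof (intro equalityI subsetI)
    fix q assume "q \<in> composite_elements (PSL2 F11)"
    then have q: "q \<in> carrier (PSL2 F11)" "q \<noteq> \<one>\<^bsub>PSL2 F11\<^esub>" "\<not> Factorial_Ring.prime (PSL.ord q)"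
      by (auto simp: composite_elements_def)
    then obtain A where A: "A \<in> carrier (SL2 F11)" "q = Z #>\<^bsub>SL2 F11\<^esub> A" by (auto simp: PSL_carrier)
    obtain a b c d where AA: "A = (a, b, c, d)" by (cases A)
    have "A \<notin> Z" using q(2) PSL_pow_eq_one[OF A(1), of 1] A q(1) by auto
    then have "(a + d) mod 11 = 5 \<or> (a + d) mod 11 = 6"
      using PSL_order[OF A(1) _ AA] q(3) A(2) by (auto split: if_splits)
    then show "q \<in> (\<lambda>A. Z #>\<^bsub>SL2 F11\<^esub> A) ` trace5"
    proof
      assume "(a + d) mod 11 = 5"
      then show ?thesis using A AA by auto
    next
      assume tr: "(a + d) mod 11 = 6"
      let ?m = "(10, 0, 0, 10) :: int mat2"
      have m: "?m \<in> Z" by (simp add: centre_SL)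
      have mc: "?m \<in> carrier (SL2 F11)" using m Zn.subset by blast
      have "?m \<otimes>\<^bsub>SL2 F11\<^esub> A \<in> carrier (SL2 F11)" using SL.m_closed[OF mc A(1)] .
      moreover have "?m \<otimes>\<^bsub>SL2 F11\<^esub> A = (10 * a mod 11, 10 * b mod 11, 10 * c mod 11, 10 * d mod 11)"
        by (simp only: AA SL_mult mult_zero_left add_0_left add_0_right)
      moreover have "(10 * a mod 11 + 10 * d mod 11) mod 11 = 5" unfolding minus_trace tr by simp
      ultimately have mA: "?m \<otimes>\<^bsub>SL2 F11\<^esub> A \<in> trace5"
        by (simp only: mem_Collect_eq prod.case simp_thms)
      have "Z #>\<^bsub>SL2 F11\<^esub> (?m \<otimes>\<^bsub>SL2 F11\<^esub> A) = q"
        unfolding SL.coset_mult_assoc[OF Zn.subset mc A(1), symmetric]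
          SL.coset_join2[OF mc Zn.subgroup_axioms m] A(2) ..
      then show ?thesis using mA by (intro image_eqI[of _ _ "?m \<otimes>\<^bsub>SL2 F11\<^esub> A"]) (rule sym)
    qed
  next
    fix q assume q: "q \<in> (\<lambda>A. Z #>\<^bsub>SL2 F11\<^esub> A) ` trace5"
    have "q \<in> carrier (PSL2 F11)" using q by (auto simp: PSL_carrier)
    moreover have "\<not> Factorial_Ring.prime (6::nat)" by (simp add: prime_nat_numeral_eq)
    ultimately show "q \<in> composite_elements (PSL2 F11)"
      using six[OF q] by (auto simp: composite_elements_def)
  qed
  show "PSL.ord q = 6" if "q \<in> composite_elements (PSL2 F11)"
    using that six unfolding eq by blast
qed

lemma card_composite_elements_PSL: "card (composite_elements (PSL2 F11)) = 110"
proof -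
  have "inj_on (\<lambda>A. Z #>\<^bsub>SL2 F11\<^esub> A) trace5"
  proof (rule inj_onI)
    fix A B assume A: "A \<in> trace5" and B: "B \<in> trace5" and e: "Z #>\<^bsub>SL2 F11\<^esub> A = Z #>\<^bsub>SL2 F11\<^esub> B"
    obtain a b c d where AA: "A = (a, b, c, d)" by (cases A)
    obtain a' b' c' d' where BB: "B = (a', b', c', d')" by (cases B)
    have "A \<in> Z #>\<^bsub>SL2 F11\<^esub> B" using SL.rcos_self[OF _ Zn.subgroup_axioms] A e by blast
    then have "A = (1, 0, 0, 1) \<otimes>\<^bsub>SL2 F11\<^esub> B \<or> A = (10, 0, 0, 10) \<otimes>\<^bsub>SL2 F11\<^esub> B"
      by (auto simp: r_coset_def centre_SL)
    moreover have "A \<noteq> (10, 0, 0, 10) \<otimes>\<^bsub>SL2 F11\<^esub> B"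
    proof
      assume "A = (10, 0, 0, 10) \<otimes>\<^bsub>SL2 F11\<^esub> B"
      then have "a = 10 * a' mod 11" "d = 10 * d' mod 11"
        by (simp_all only: AA BB SL_mult prod.inject mult_zero_left add_0_left add_0_right)
      then have "(a + d) mod 11 = (10 * a' mod 11 + 10 * d' mod 11) mod 11" by (simp only:)
      also have "\<dots> = 10 * ((a' + d') mod 11) mod 11" by (rule minus_trace)
      finally show False using A B by (simp add: AA BB)
    qed
    ultimately show "A = B" using SL.l_one[of B] B by (simp add: SL_one)
  qed
  then show ?thesis by (simp add: composite_elements_PSL card_image card_trace5)
qed

lemma Omega_rho_PSL: "Omega_rho (PSL2 F11) = 769"
proof -
  have "big_omega 6 = 2"
    using big_omega_mult[of 2 3] big_omega_prime[of 2] big_omega_prime[of 3]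
    by (simp add: prime_nat_numeral_eq)
  then show ?thesis
    using PSL.Omega_rho_eq[OF finite_PSL] PSL_composite_order order_PSL card_composite_elements_PSL by simp
qed

section \<open>The characterization of the projective special linear group\<close>

lemma Omega_rho_iso:
  assumes "group G" "group H" "G \<cong> H"
  shows "Omega_rho G = Omega_rho H"
proof -
  interpret G: group G by fact
  interpret H: group H by fact
  obtain f where f: "f \<in> hom G H" "bij_betw f (carrier G) (carrier H)"
    using assms(3) by (auto simp: is_iso_def iso_def)
  interpret f: group_hom G H f
    by unfold_locales (rule f(1))
  have ord: "H.ord (f x) = G.ord x" if x: "x \<in> carrier G" for x
  proof -
    have "f x [^]\<^bsub>H\<^esub> n = \<one>\<^bsub>H\<^esub> \<longleftrightarrow> x [^]\<^bsub>G\<^esub> n = \<one>\<^bsub>G\<^esub>" for n :: nat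
    proof -
      have "f x [^]\<^bsub>H\<^esub> n = f (x [^]\<^bsub>G\<^esub> n)" using f.hom_nat_pow[OF x] by simp
      moreover have "f (x [^]\<^bsub>G\<^esub> n) = f \<one>\<^bsub>G\<^esub> \<longleftrightarrow> x [^]\<^bsub>G\<^esub> n = \<one>\<^bsub>G\<^esub>"
        using bij_betw_imp_inj_on[OF f(2)] x by (intro inj_on_eq_iff) auto
      ultimately show ?thesis by simp
    qed
    then show ?thesis
      using H.ord_unique[of "f x" "G.ord x"] G.pow_eq_id[OF x] f.hom_closed[OF x] by simp
  qed
  have "rho H = (\<Prod>x\<in>carrier G. H.ord (f x))"
    unfolding rho_def by (rule prod.reindex_bij_betw[OF f(2), symmetric])
  also have "\<dots> = rho G"
    unfolding rho_def using ord by (rule prod.cong[OF refl])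
  finally show ?thesis by (simp add: Omega_rho_def)
qed

text \<open>Both groups act on their twelve points by the same formulas.\<close>

lemma few_composite_elements_iso:
  assumes "order_660 G" "card (composite_elements G) \<le> 110"
    and "order_660 H" "card (composite_elements H) \<le> 110"
  shows "G \<cong> H"
proof -
  obtain N u t h where "sl2_triple G N u t h"
    using order_660.exists_sl2_triple[OF assms(1,2)] by blast
  moreover obtain N' u' t' h' where "sl2_triple H N' u' t' h'"
    using order_660.exists_sl2_triple[OF assms(3,4)] by blast
  ultimately have "two_triples G N u t h H N' u' t' h'"
    by (rule two_triples.intro)
  then show ?thesis by (rule two_triples.triples_iso)
qed

theorem theorem2p15:
  fixes G :: "('a, 'b) monoid_scheme"
  assumes "group G" and "finite (carrier G)" and "order G = 660"
  shows "Omega_rho (PSL2 (residue_ring 11)) \<le> Omega_rho G \<and>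
         (Omega_rho G = 769 \<longleftrightarrow> G \<cong> PSL2 (residue_ring 11))"
proof -
  interpret order_660 G
    by (intro order_660.intro order_660_axioms.intro assms)
  have PSL: "order_660 (PSL2 F11)"
    by (intro order_660.intro order_660_axioms.intro PSL.group_axioms finite_PSL order_PSL)
  have iso: "G \<cong> PSL2 F11" if "Omega_rho G \<le> 769"
  proof (rule few_composite_elements_iso[OF order_660_axioms _ PSL])
    show "card (composite_elements G) \<le> 110"
      using Omega_rho_ge[OF finite_G] that by (simp add: order_G)
  qed (simp add: card_composite_elements_PSL)
  have "Omega_rho G = 769" if "G \<cong> PSL2 F11"
    using Omega_rho_iso[OF group_axioms PSL.group_axioms that] by (simp add: Omega_rho_PSL)
  then show ?thesis
    using iso Omega_rho_PSL by (metis linorder_le_cases order_refl)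
qed

end
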